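(* Let $n\ge 2$, let $v\in C^{1,1}(B_1)$, set $f=\Delta v$ (in the weak sense), let $g\in C(\partial B_1)$, and let $u\in W^{1,2}(B_1)$ be a weak solution of $$\Delta u=f\chi_{\{u\neq 0\}}\ \text{in } B_1,\qquad u=g \ \text{on }\partial B_1 .$$ Then $u\in C^{1,1}(B_{1/2})$ and $$\|D^2u\|_{L^\infty(B_{1/2})}\le C\big(\|u\|_{L^1(B_1)}+\|D^2v\|_{L^\infty(B_1)}\big),$$ where $C$ depends only on the dimension $n$.
   Context: $B_r(x)$ is the open ball of radius $r$ centered at $x$ in $\mathbb{R}^n$, $B_r=B_r(0)$. $\chi_A$ denotes the characteristic function of a set $A$. "Weak solution" means $u\in W^{1,2}(B_1)$ and $\Delta u=f\chi_{\{u\ne0\}}$ in the sense of distributions in $B_1$ (with boundary values $g$ in the trace sense). *)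

theory Defs
  imports "HOL-Analysis.Analysis" "HOL-Probability.Essential_Supremum"
begin

definition pd :: "'n::finite \<Rightarrow> (real^'n \<Rightarrow> real) \<Rightarrow> real^'n \<Rightarrow> real" where
  "pd i f = (\<lambda>x. frechet_derivative f (at x) (axis i 1))"

definition grad :: "(real^'n::finite \<Rightarrow> real) \<Rightarrow> real^'n \<Rightarrow> real^'n" where
  "grad f = (\<lambda>x. \<chi> i. pd i f x)"

definition lap :: "(real^'n::finite \<Rightarrow> real) \<Rightarrow> real^'n \<Rightarrow> real" where
  "lap f = (\<lambda>x. \<Sum>i\<in>UNIV. pd i (pd i f) x)"

coinductive smooth_fun :: "(real^'n::finite \<Rightarrow> real) \<Rightarrow> bool" where
  "\<lbrakk>\<forall>x. f differentiable (at x); \<forall>i. smooth_fun (pd i f)\<rbrakk> \<Longrightarrow> smooth_fun f"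

definition test_fun :: "(real^'n::finite) set \<Rightarrow> (real^'n \<Rightarrow> real) \<Rightarrow> bool" where
  "test_fun U \<phi> \<longleftrightarrow> smooth_fun \<phi> \<and> compact (closure {x. \<phi> x \<noteq> 0})
     \<and> closure {x. \<phi> x \<noteq> 0} \<subseteq> U"

definition loc_integrable :: "(real^'n::finite) set \<Rightarrow> (real^'n \<Rightarrow> real) \<Rightarrow> bool" where
  "loc_integrable U f \<longleftrightarrow> (\<forall>K. compact K \<and> K \<subseteq> U \<longrightarrow> set_integrable lebesgue K f)"

definition weak_grad :: "(real^'n::finite) set \<Rightarrow> (real^'n \<Rightarrow> real) \<Rightarrow> (real^'n \<Rightarrow> real^'n) \<Rightarrow> bool" where
  "weak_grad U u G \<longleftrightarrow> loc_integrable U u \<and> (\<forall>i. loc_integrable U (\<lambda>x. G x $ i)) \<and>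
     (\<forall>\<phi> i. test_fun U \<phi> \<longrightarrow>
        (LINT x:U|lebesgue. u x * pd i \<phi> x) = - (LINT x:U|lebesgue. G x $ i * \<phi> x))"

definition W12_grad :: "(real^'n::finite) set \<Rightarrow> (real^'n \<Rightarrow> real) \<Rightarrow> (real^'n \<Rightarrow> real^'n) \<Rightarrow> bool" where
  "W12_grad U u G \<longleftrightarrow> weak_grad U u G \<and> set_integrable lebesgue U (\<lambda>x. (u x)\<^sup>2)
     \<and> set_integrable lebesgue U (\<lambda>x. (norm (G x))\<^sup>2)"

definition W12 :: "(real^'n::finite) set \<Rightarrow> (real^'n \<Rightarrow> real) \<Rightarrow> bool" where
  "W12 U u \<longleftrightarrow> (\<exists>G. W12_grad U u G)"

definition weak_lap :: "(real^'n::finite) set \<Rightarrow> (real^'n \<Rightarrow> real) \<Rightarrow> (real^'n \<Rightarrow> real) \<Rightarrow> bool" where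
  "weak_lap U u h \<longleftrightarrow> loc_integrable U u \<and> loc_integrable U h \<and>
     (\<forall>\<phi>. test_fun U \<phi> \<longrightarrow>
        (LINT x:U|lebesgue. u x * lap \<phi> x) = (LINT x:U|lebesgue. h x * \<phi> x))"

text \<open>Trace of u in W^{1,2}(B_1) equals g on the unit sphere: u is the W^{1,2}(B_1)-limit of
  functions phi_k which are C^1 on a neighbourhood of the closed ball and whose restrictions to the
  sphere converge to g in L^2 of the surface measure. The surface integral is written via
  polar coordinates: int_{S} h d sigma = n * int_{B_1} h(x/|x|) dx.\<close>
definition trace_eq :: "(real^'n::finite \<Rightarrow> real) \<Rightarrow> (real^'n \<Rightarrow> real) \<Rightarrow> bool" where
  "trace_eq u g \<longleftrightarrow> (\<exists>G \<phi>. W12_grad (ball 0 1) u G \<and>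
     (\<forall>k. \<exists>V. open V \<and> cball 0 1 \<subseteq> V \<and> (\<forall>x\<in>V. \<phi> k differentiable (at x))
            \<and> continuous_on V (grad (\<phi> k))) \<and>
     (\<lambda>k. LINT x:ball 0 1|lebesgue. (\<phi> k x - u x)\<^sup>2) \<longlonglongrightarrow> 0 \<and>
     (\<lambda>k. LINT x:ball 0 1|lebesgue. (norm (grad (\<phi> k) x - G x))\<^sup>2) \<longlonglongrightarrow> 0 \<and>
     (\<lambda>k. real CARD('n) * (LINT x:ball 0 1|lebesgue.
            (\<phi> k (x /\<^sub>R norm x) - g (x /\<^sub>R norm x))\<^sup>2)) \<longlonglongrightarrow> 0)"

definition C11 :: "(real^'n::finite) set \<Rightarrow> (real^'n \<Rightarrow> real) \<Rightarrow> bool" where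
  "C11 U f \<longleftrightarrow> (\<forall>x\<in>U. f differentiable (at x)) \<and>
     (\<exists>L. \<forall>x\<in>U. \<forall>y\<in>U. norm (grad f x - grad f y) \<le> L * dist x y)"

definition hess :: "(real^'n::finite \<Rightarrow> real) \<Rightarrow> real^'n \<Rightarrow> real^'n \<Rightarrow> real^'n" where
  "hess f x = frechet_derivative (grad f) (at x)"

definition hess_Linf :: "(real^'n::finite) set \<Rightarrow> (real^'n \<Rightarrow> real) \<Rightarrow> ereal" where
  "hess_Linf U f = esssup (lebesgue_on U) (\<lambda>x. ereal (onorm (hess f x)))"

end

theory Submission
  imports Defs
begin

text \<open>Write \<open>h = u - v\<close> up to an affine function, so that \<open>\<Delta>h = g = - f \<chi>\<^sub>\<Lambda>\<close> with \<open>\<Lambda> = {u = 0}\<close>, and mollify: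
  \<open>h\<^sub>k = h * \<eta>\<^sub>r\<close> with \<open>r = 4\<^sup>-\<^sup>k/16\<close>. The kernel is chosen such that \<open>\<eta>\<^sub>r - \<eta>\<^bsub>r/4\<^esub> = \<Delta>\<psi>\<^sub>r\<close> with \<open>\<psi>\<^sub>r\<close> compactly
  supported, hence \<open>h\<^sub>k - h\<^bsub>k+1\<^esub> = g * \<psi>\<^sub>r\<close>. So \<open>h\<^sub>k\<close> converges in \<open>C\<^sup>1\<close>, and one step changes \<open>D\<^sup>2h\<^sub>k(x)\<close> by at
  most a constant times the density of \<open>\<Lambda>\<close> in \<open>B\<^sub>r(x)\<close>. It remains to bound \<open>D\<^sup>2h\<^sub>k\<close> uniformly in \<open>k\<close>.

  At most points of \<open>\<Lambda>\<close> the second differences of \<open>u\<close> at a small scale vanish, so \<open>D\<^sup>2h\<^sub>m\<close> is bounded there for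
  large \<open>m\<close>. If \<open>|D\<^sup>2h\<^sub>k(x)|\<close> is large, then \<open>D\<^sup>2(h\<^sub>k - h\<^sub>m)\<close> is large on \<open>\<Lambda>\<close> near \<open>x\<close>, while its
  \<open>L\<^sup>2\<close> norm is controlled by the measure of \<open>\<Lambda>\<close> in a four times larger ball
  (\<open>\<parallel>\<partial>\<^sub>i\<partial>\<^sub>j\<Phi>\<parallel>\<^sub>2 \<le> \<parallel>\<Delta>\<Phi>\<parallel>\<^sub>2\<close>). Thus the density of \<open>\<Lambda>\<close> is halved at every scale at which the Hessian is large, and
  the increments of the Hessian over a run of such scales add up to a bounded amount.

  Rademacher's theorem links the essential supremum of the Hessian to the Lipschitz constant of the gradient,
  both for \<open>v\<close> and for the solution.\<close>

subsection \<open>Partial derivatives and smooth functions\<close>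

text \<open>A bounded Laplacian alone does not bound the Hessian: each scale contributes an
  increment that is bounded but carries no power of the radius, so the crude sum over scales
  diverges logarithmically. The coincidence set has to supply the missing decay. Differences of two
  compactly supported kernels keep every increment local and reduce the analysis to the L2 bound for
  second derivatives, an integration by parts.

  The affine function removed from \<open>v\<close> is its first-order Taylor polynomial at 0. It
  leaves the Laplacian and all second differences unchanged and makes \<open>v\<close> bounded by
  its second derivatives, so that the final constant does not see the value and the gradient of
  \<open>v\<close> at 0.

  Consecutive scales have ratio 4. Halving a density normalised by the n-th power of the radius
  therefore means that the measure shrinks by 2 * 4^n; this, together with the bound for the Hessian
  on the coincidence set, fixes the threshold above which a Hessian counts as large.\<close>

lemma pd_eqI: "(f has_derivative f') (at x) \<Longrightarrow> pd i f x = f' (axis i 1)"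
  unfolding pd_def by (simp add: frechet_derivative_at[symmetric])

lemma linear_eq_sum_axis:
  fixes f :: "real^'n \<Rightarrow> real"
  assumes "linear f"
  shows "f h = (\<chi> i. f (axis i 1)) \<bullet> h"
proof -
  have "f h = f (\<Sum>i\<in>UNIV. h $ i *\<^sub>R axis i 1)"
    by (simp add: basis_expansion[where x=h, unfolded scalar_mult_eq_scaleR] )
  also have "\<dots> = (\<Sum>i\<in>UNIV. h $ i * f (axis i 1))"
    by (simp add: linear_sum[OF assms] linear_scale[OF assms])
  finally show ?thesis by (simp add: inner_vec_def mult.commute)
qed

lemma has_derivative_grad:
  assumes "f differentiable (at x)"
  shows "(f has_derivative (\<lambda>h. grad f x \<bullet> h)) (at x)"
proof -
  have D: "(f has_derivative frechet_derivative f (at x)) (at x)"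
    using assms frechet_derivative_works by blast
  have "frechet_derivative f (at x) = (\<lambda>h. grad f x \<bullet> h)"
    by (rule ext, subst linear_eq_sum_axis[OF linear_frechet_derivative[OF assms]])
       (simp add: grad_def pd_def)
  with D show ?thesis by simp
qed

lemma inner_axis_one: "(v::real^'n) \<bullet> axis i 1 = v $ i"
  by (simp add: inner_axis)

lemma has_derivative_inner_pd:
  assumes "(f has_derivative (\<lambda>h. (v::real^'n) \<bullet> h)) (at x)"
  shows "pd i f x = v $ i" and "grad f x = v"
proof -
  show *: "pd i f x = v $ i" for i using pd_eqI[OF assms] by (simp add: inner_axis_one)
  show "grad f x = v" by (simp add: grad_def vec_eq_iff *)
qed

lemma pd_cong_open:
  assumes "open S" "x \<in> S" "\<And>y. y \<in> S \<Longrightarrow> f y = g y"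
  shows "pd i f x = pd i g x"
proof -
  have "(f has_derivative D) (at x) \<longleftrightarrow> (g has_derivative D) (at x)" for D
    using has_derivative_transform_within_open[OF _ assms(1,2)] assms(3) by metis
  \<comment> \<open>\<open>frechet_derivative\<close> is a Hilbert choice among the derivatives, so
    the same derivatives give the same choice, even where none exists.\<close>
  then have "frechet_derivative f (at x) = frechet_derivative g (at x)"
    by (simp add: frechet_derivative_def)
  then show ?thesis by (simp add: pd_def)
qed

lemma smooth_fun_differentiable: "smooth_fun f \<Longrightarrow> f differentiable (at x)"
  by (auto elim: smooth_fun.cases)

lemma smooth_fun_pd: "smooth_fun f \<Longrightarrow> smooth_fun (pd i f)"
  by (auto elim: smooth_fun.cases)

lemma smooth_fun_continuous: "smooth_fun f \<Longrightarrow> continuous_on S f"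
  using smooth_fun_differentiable
  by (meson continuous_at_imp_continuous_on differentiable_imp_continuous_within)

lemma pd_add: "f differentiable (at x) \<Longrightarrow> g differentiable (at x) \<Longrightarrow>
    pd i (\<lambda>x. f x + g x) x = pd i f x + pd i g x"
  using has_derivative_inner_pd(1)[where v="grad f x + grad g x" and f="\<lambda>x. f x + g x" and i=i and x=x]
    has_derivative_add[OF has_derivative_grad has_derivative_grad, of f x g]
  by (simp add: inner_add_left grad_def)

lemma pd_cmult: "f differentiable (at x) \<Longrightarrow> pd i (\<lambda>x. c * f x) x = c * pd i f x"
  using pd_eqI[OF has_derivative_mult_right[OF has_derivative_grad, of f x c]]
  by (simp add: inner_axis_one grad_def)

lemma pd_mult: "f differentiable (at x) \<Longrightarrow> g differentiable (at x) \<Longrightarrow>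
    pd i (\<lambda>x. f x * g x) x = f x * pd i g x + pd i f x * g x"
  using pd_eqI[OF has_derivative_mult[OF has_derivative_grad has_derivative_grad], of f x g]
  by (simp add: inner_axis_one grad_def)

lemma pd_affine:
  assumes "f differentiable (at (a + c *\<^sub>R x))"
  shows "(\<lambda>x. f (a + c *\<^sub>R x)) differentiable (at x)"
    and "pd i (\<lambda>x. f (a + c *\<^sub>R x)) x = c * pd i f (a + c *\<^sub>R x)"
proof -
  have *: "((\<lambda>x. a + c *\<^sub>R x) has_derivative (\<lambda>h. c *\<^sub>R h)) (at x)"
    by (auto intro!: derivative_eq_intros)
  have "((\<lambda>x. f (a + c *\<^sub>R x)) has_derivative (\<lambda>h. grad f (a + c *\<^sub>R x) \<bullet> (c *\<^sub>R h))) (at x)"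
    using diff_chain_at[OF * has_derivative_grad[OF assms]] by (simp add: o_def)
  then show "(\<lambda>x. f (a + c *\<^sub>R x)) differentiable (at x)"
    and "pd i (\<lambda>x. f (a + c *\<^sub>R x)) x = c * pd i f (a + c *\<^sub>R x)"
    by (auto simp: differentiable_def inner_axis_one grad_def dest: pd_eqI[where i=i])
qed

text \<open>The invariant \<open>X\<close> is a class of functions stable under \<open>pd\<close>;
  the closure properties of \<open>smooth_fun\<close> are proved by naming such a class.\<close>

lemma smooth_fun_coinduct_pd:
  assumes "X f" "\<And>f x. X f \<Longrightarrow> f differentiable (at x)" "\<And>f i. X f \<Longrightarrow> X (pd i f)"
  shows "smooth_fun f"
  using assms(1) by (coinduction arbitrary: f rule: smooth_fun.coinduct) (use assms in blast)

lemma smooth_fun_add: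
  fixes f :: "real^'n \<Rightarrow> real"
  assumes "smooth_fun f" "smooth_fun g" shows "smooth_fun (\<lambda>x. f x + g x)"
proof (rule smooth_fun_coinduct_pd[where X="\<lambda>k. \<exists>f g. smooth_fun f \<and> smooth_fun g \<and> k = (\<lambda>x. f x + g x)"])
  fix k i assume "\<exists>f g. smooth_fun f \<and> smooth_fun g \<and> k = (\<lambda>x. f x + g x)"
  then obtain f g where k: "smooth_fun f" "smooth_fun g" "k = (\<lambda>x. f x + g x)" by blast
  then have "pd i k = (\<lambda>x. pd i f x + pd i g x)"
    by (intro ext) (simp add: pd_add smooth_fun_differentiable)
  then show "\<exists>f g. smooth_fun f \<and> smooth_fun g \<and> pd i k = (\<lambda>x. f x + g x)"
    using k smooth_fun_pd by blast
qed (use assms in \<open>auto intro!: differentiable_add differentiable_mult simp: smooth_fun_differentiable\<close>)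

lemma smooth_fun_cmult:
  fixes f :: "real^'n \<Rightarrow> real"
  assumes "smooth_fun f" shows "smooth_fun (\<lambda>x. c * f x)"
proof (rule smooth_fun_coinduct_pd[where X="\<lambda>k. \<exists>f. smooth_fun f \<and> k = (\<lambda>x. c * f x)"])
  fix k i assume "\<exists>f. smooth_fun f \<and> k = (\<lambda>x. c * f x)"
  then obtain f where k: "smooth_fun f" "k = (\<lambda>x. c * f x)" by blast
  then have "pd i k = (\<lambda>x. c * pd i f x)"
    by (intro ext) (simp add: pd_cmult smooth_fun_differentiable)
  then show "\<exists>f. smooth_fun f \<and> pd i k = (\<lambda>x. c * f x)"
    using k smooth_fun_pd by blast
qed (use assms in \<open>auto intro!: differentiable_add differentiable_mult simp: smooth_fun_differentiable\<close>)

lemma smooth_fun_affine: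
  fixes f :: "real^'n \<Rightarrow> real"
  assumes "smooth_fun f" shows "smooth_fun (\<lambda>x. f (a + c *\<^sub>R x))"
proof (rule smooth_fun_coinduct_pd[where X="\<lambda>k. \<exists>f. smooth_fun f \<and> k = (\<lambda>x. f (a + c *\<^sub>R x))"])
  fix k i assume "\<exists>f. smooth_fun f \<and> k = (\<lambda>x. f (a + c *\<^sub>R x))"
  then obtain f where k: "smooth_fun f" "k = (\<lambda>x. f (a + c *\<^sub>R x))" by blast
  then have "pd i k = (\<lambda>x. (\<lambda>y. c * pd i f y) (a + c *\<^sub>R x))"
    by (intro ext) (simp add: pd_affine smooth_fun_differentiable)
  then show "\<exists>f. smooth_fun f \<and> pd i k = (\<lambda>x. f (a + c *\<^sub>R x))"
    using k smooth_fun_pd smooth_fun_cmult by blast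
next
  fix k :: "real^'n \<Rightarrow> real" and x assume "\<exists>f. smooth_fun f \<and> k = (\<lambda>x. f (a + c *\<^sub>R x))"
  then show "k differentiable (at x)"
    using pd_affine(1)[OF smooth_fun_differentiable] by blast
qed (use assms in auto)

lemma smooth_fun_zero: "smooth_fun (\<lambda>x::real^'n. 0)"
proof (rule smooth_fun_coinduct_pd[where X="\<lambda>k. k = (\<lambda>x. 0)"])
  fix k :: "real^'n \<Rightarrow> real" and i assume "k = (\<lambda>x. 0)"
  then show "pd i k = (\<lambda>x. 0)" by (simp add: pd_def)
qed auto

lemma smooth_fun_sum:
  assumes "\<And>l. l \<in> I \<Longrightarrow> smooth_fun (f l)" shows "smooth_fun (\<lambda>x. \<Sum>l\<in>I. f l x)"
  using assms by (induction I rule: infinite_finite_induct) (auto intro: smooth_fun_zero smooth_fun_add)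

lemma differentiable_sum_fun:
  "(\<And>l. l \<in> I \<Longrightarrow> f l differentiable (at x)) \<Longrightarrow> (\<lambda>x. \<Sum>l\<in>I. f l x) differentiable (at x)"
  by (induction I rule: infinite_finite_induct) auto

lemma pd_sum:
  assumes "\<And>l. l \<in> I \<Longrightarrow> f l differentiable (at x)"
  shows "pd i (\<lambda>x. \<Sum>l\<in>I. f l x) x = (\<Sum>l\<in>I. pd i (f l) x)"
  using assms
proof (induction I rule: infinite_finite_induct)
  case (insert a I)
  then have "(\<lambda>x. \<Sum>l\<in>I. f l x) differentiable (at x)"
    by (intro differentiable_sum_fun) auto
  with insert show ?case by (simp add: pd_add)
qed (auto simp: pd_def)

text \<open>The mean value theorem is applied twice: along \<open>axis i 1\<close> to the difference
  of two translates of \<open>f\<close>, then along \<open>axis j 1\<close> to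
  \<open>pd i f\<close>. Besides the symmetry of second derivatives it serves to read off a Hessian
  entry from four values.\<close>

lemma second_difference_mvt:
  fixes f :: "real^'n \<Rightarrow> real"
  assumes f: "\<And>y. f differentiable (at y)" and fi: "\<And>y. pd i f differentiable (at y)" and t: "t > 0"
  obtains \<xi> where "norm (\<xi> - x) \<le> 2 * t"
    "f (x + t *\<^sub>R axis i 1 + t *\<^sub>R axis j 1) - f (x + t *\<^sub>R axis i 1) - f (x + t *\<^sub>R axis j 1) + f x
      = t\<^sup>2 * pd j (pd i f) \<xi>"
proof -
  have dir: "((\<lambda>s. g (y + s *\<^sub>R axis k 1)) has_real_derivative pd k g (y + s *\<^sub>R axis k 1)) (at s)"
    if "\<And>y. g differentiable (at y)" for g :: "real^'n \<Rightarrow> real" and y k s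
  proof -
    have "((\<lambda>s. y + s *\<^sub>R axis k 1) has_derivative (\<lambda>h. h *\<^sub>R axis k 1)) (at s)"
      by (auto intro!: derivative_eq_intros)
    from diff_chain_at[OF this has_derivative_grad[OF that]]
    show ?thesis by (simp add: o_def has_field_derivative_def inner_axis_one grad_def mult_commute_abs)
  qed
  define F where "F s = f (x + t *\<^sub>R axis j 1 + s *\<^sub>R axis i 1) - f (x + s *\<^sub>R axis i 1)" for s
  have "(F has_real_derivative (pd i f (x + t *\<^sub>R axis j 1 + s *\<^sub>R axis i 1) - pd i f (x + s *\<^sub>R axis i 1))) (at s)" for s
    unfolding F_def by (intro DERIV_diff dir f)
  then obtain s where s: "0 < s" "s < t"
    and Fs: "F t - F 0 = (t - 0) * (pd i f (x + t *\<^sub>R axis j 1 + s *\<^sub>R axis i 1) - pd i f (x + s *\<^sub>R axis i 1))"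
    using MVT2[OF t, of F "\<lambda>s. pd i f (x + t *\<^sub>R axis j 1 + s *\<^sub>R axis i 1) - pd i f (x + s *\<^sub>R axis i 1)"] by blast
  obtain \<sigma> where \<sigma>: "0 < \<sigma>" "\<sigma> < t"
    and eq: "pd i f (x + s *\<^sub>R axis i 1 + t *\<^sub>R axis j 1) - pd i f (x + s *\<^sub>R axis i 1 + 0 *\<^sub>R axis j 1)
      = (t - 0) * pd j (pd i f) (x + s *\<^sub>R axis i 1 + \<sigma> *\<^sub>R axis j 1)"
    using MVT2[OF t, of "\<lambda>\<sigma>. pd i f (x + s *\<^sub>R axis i 1 + \<sigma> *\<^sub>R axis j 1)"
        "\<lambda>\<sigma>. pd j (pd i f) (x + s *\<^sub>R axis i 1 + \<sigma> *\<^sub>R axis j 1)"] dir[OF fi] by blast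
  show ?thesis
  proof
    show "norm (x + s *\<^sub>R axis i 1 + \<sigma> *\<^sub>R axis j 1 - x) \<le> 2 * t"
      using norm_triangle_ineq[of "s *\<^sub>R axis i (1::real)" "\<sigma> *\<^sub>R axis j 1"] s \<sigma> by simp
    show "f (x + t *\<^sub>R axis i 1 + t *\<^sub>R axis j 1) - f (x + t *\<^sub>R axis i 1) - f (x + t *\<^sub>R axis j 1) + f x
      = t\<^sup>2 * pd j (pd i f) (x + s *\<^sub>R axis i 1 + \<sigma> *\<^sub>R axis j 1)"
      using Fs eq by (simp add: F_def power2_eq_square algebra_simps)
  qed
qed

text \<open>The second difference is symmetric in \<open>i\<close> and \<open>j\<close>; divided by
  the square of its step it tends to either mixed derivative, by continuity of the latter.\<close>

lemma pd_commute:
  assumes "smooth_fun f" shows "pd i (pd j f) x = pd j (pd i f) x"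
proof -
  have lim: "(\<lambda>n. (f (x + inverse (Suc n) *\<^sub>R axis i 1 + inverse (Suc n) *\<^sub>R axis j 1)
      - f (x + inverse (Suc n) *\<^sub>R axis i 1) - f (x + inverse (Suc n) *\<^sub>R axis j 1) + f x) / (inverse (Suc n))\<^sup>2)
     \<longlonglongrightarrow> pd j (pd i f) x" for i j
  proof -
    let ?t = "\<lambda>n. inverse (real (Suc n))"
    have "\<exists>\<xi>. norm (\<xi> - x) \<le> 2 * ?t n \<and> (f (x + ?t n *\<^sub>R axis i 1 + ?t n *\<^sub>R axis j 1)
      - f (x + ?t n *\<^sub>R axis i 1) - f (x + ?t n *\<^sub>R axis j 1) + f x) = (?t n)\<^sup>2 * pd j (pd i f) \<xi>" for n
      by (rule second_difference_mvt[of f i "?t n" x j])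
         (use assms smooth_fun_differentiable smooth_fun_pd in auto)
    then obtain \<xi> where \<xi>: "\<And>n. norm (\<xi> n - x) \<le> 2 * ?t n"
      "\<And>n. (f (x + ?t n *\<^sub>R axis i 1 + ?t n *\<^sub>R axis j 1)
      - f (x + ?t n *\<^sub>R axis i 1) - f (x + ?t n *\<^sub>R axis j 1) + f x) = (?t n)\<^sup>2 * pd j (pd i f) (\<xi> n)"
      by metis
    have "(\<lambda>n. \<xi> n - x) \<longlonglongrightarrow> 0"
      by (rule Lim_null_comparison[where g="\<lambda>n. 2 * ?t n"])
         (use \<xi> tendsto_mult[OF tendsto_const[of 2] LIMSEQ_inverse_real_of_nat] in \<open>auto simp del: of_nat_Suc\<close>)
    then have "\<xi> \<longlonglongrightarrow> x" by (simp add: LIM_zero_cancel)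
    moreover have "isCont (pd j (pd i f)) x"
      using smooth_fun_continuous[of "pd j (pd i f)" UNIV] smooth_fun_pd assms
      by (auto simp: continuous_on_eq_continuous_at)
    ultimately have "(\<lambda>n. pd j (pd i f) (\<xi> n)) \<longlonglongrightarrow> pd j (pd i f) x"
      using isCont_tendsto_compose by blast
    then show ?thesis by (simp add: \<xi>(2) del: of_nat_Suc)
  qed
  have "(\<lambda>n. (f (x + inverse (Suc n) *\<^sub>R axis i 1 + inverse (Suc n) *\<^sub>R axis j 1)
      - f (x + inverse (Suc n) *\<^sub>R axis i 1) - f (x + inverse (Suc n) *\<^sub>R axis j 1) + f x) / (inverse (Suc n))\<^sup>2)
     \<longlonglongrightarrow> pd i (pd j f) x"
    using lim[of j i] by (simp add: algebra_simps)
  with lim[of i j] show ?thesis using LIMSEQ_unique by blast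
qed

subsection \<open>Smooth bump functions\<close>

text \<open>\<open>bump 0\<close> is the classical cut-off exp(-1/s). The factor s^(-k) is carried
  along because the family then spans its own derivatives, which makes smoothness an algebraic
  matter.\<close>

definition bump :: "nat \<Rightarrow> real \<Rightarrow> real" where
  "bump k s = (if s > 0 then (1 / s) ^ k * exp (- (1 / s)) else 0)"

lemma bump_nonneg: "bump k s \<ge> 0" by (simp add: bump_def)

lemma bump_has_derivative:
  "(bump k has_real_derivative (bump (k + 2) s - k * bump (k + 1) s)) (at s)"
proof -
  consider "s > 0" | "s < 0" | "s = 0" by linarith
  then show ?thesis
  proof cases
    case 1
    have d: "((\<lambda>s. 1 / s) has_real_derivative - (1 / s^2)) (at s)"
      using 1 by (auto intro!: derivative_eq_intros simp: power2_eq_square)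
    have "((\<lambda>s. (1 / s) ^ k * exp (- (1 / s))) has_real_derivative
      real k * (- (1 / s^2) * (1 / s) ^ (k - Suc 0)) * exp (- (1 / s)) + exp (- (1 / s)) * - (- (1 / s^2)) * (1 / s) ^ k) (at s)"
      by (rule DERIV_mult[OF DERIV_power[OF d] DERIV_fun_exp[OF DERIV_minus[OF d]]])
    moreover have "real k * (- (1 / s^2) * (1 / s) ^ (k - Suc 0)) * exp (- (1 / s)) + exp (- (1 / s)) * - (- (1 / s^2)) * (1 / s) ^ k
      = bump (k + 2) s - k * bump (k + 1) s"
      using 1 by (cases k) (auto simp: bump_def power2_eq_square field_simps)
    ultimately have "((\<lambda>s. (1 / s) ^ k * exp (- (1 / s))) has_real_derivative (bump (k + 2) s - k * bump (k + 1) s)) (at s)"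
      by metis
    then show ?thesis
      by (rule has_field_derivative_transform_within_open[of _ _ _ "{0<..}"]) (use 1 in \<open>auto simp: bump_def\<close>)
  next
    case 2
    have "((\<lambda>s. 0) has_real_derivative (bump (k + 2) s - k * bump (k + 1) s)) (at s)"
      using 2 by (simp add: bump_def)
    then show ?thesis
      by (rule has_field_derivative_transform_within_open[of _ _ _ "{..<0}"]) (use 2 in \<open>auto simp: bump_def\<close>)
  next
    case 3
    \<comment> \<open>Only the right-hand quotient at 0 is nontrivial; with y = 1/h it is y^(k+1)
      exp(-y), which vanishes at infinity.\<close>
    have "((\<lambda>h::real. (1 / h) ^ k * exp (- (1 / h)) / h) \<longlongrightarrow> 0) (at_right 0)"
    proof -
      have "(\<lambda>h. (1 / h) ^ k * exp (- (1 / h)) / h) = (\<lambda>h::real. inverse h ^ Suc k / exp (inverse h))"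
        by (simp add: fun_eq_iff exp_minus inverse_eq_divide)
      then show ?thesis
        by (rule ssubst) (rule filterlim_compose[OF tendsto_power_div_exp_0[of "Suc k"] filterlim_inverse_at_top_right])
    qed
    then have "((\<lambda>h. (bump k (0 + h) - bump k 0) / h) \<longlongrightarrow> 0) (at_right 0)"
      by (rule Lim_transform_eventually) (auto simp: eventually_at_filter bump_def)
    moreover have "((\<lambda>h. (bump k (0 + h) - bump k 0) / h) \<longlongrightarrow> 0) (at_left 0)"
      by (rule Lim_transform_eventually[OF tendsto_const]) (auto simp: eventually_at_filter bump_def)
    ultimately have "((\<lambda>h. (bump k (0 + h) - bump k 0) / h) \<longlongrightarrow> 0) (at 0)"
      by (simp add: filterlim_split_at)
    then show ?thesis using 3 by (simp add: DERIV_def bump_def)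
  qed
qed

lemma continuous_on_bump: "continuous_on S (bump k)"
  using bump_has_derivative DERIV_isCont continuous_at_imp_continuous_on by blast

text \<open>Functions of a parameter t and a point, closed under spatial partial derivatives; used both
  for explicit test functions and for integrals of such over the parameter.\<close>

inductive bump_alg :: "(real \<Rightarrow> real^'n \<Rightarrow> real) \<Rightarrow> bool" where
  param: "continuous_on {1/4..1} p \<Longrightarrow> bump_alg (\<lambda>t x. p t)"
| coord: "bump_alg (\<lambda>t x. x $ i)"
| add: "bump_alg f \<Longrightarrow> bump_alg g \<Longrightarrow> bump_alg (\<lambda>t x. f t x + g t x)"
| mult: "bump_alg f \<Longrightarrow> bump_alg g \<Longrightarrow> bump_alg (\<lambda>t x. f t x * g t x)"
| bump: "bump_alg f \<Longrightarrow> bump_alg (\<lambda>t x. bump k (f t x))"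

lemma bump_alg_const: "bump_alg (\<lambda>t x. c)"
  by (rule bump_alg.param) auto

lemma bump_alg_diff: "bump_alg f \<Longrightarrow> bump_alg g \<Longrightarrow> bump_alg (\<lambda>t x. f t x - g t x)"
  using bump_alg.add[OF _ bump_alg.mult[OF bump_alg_const[of "-1"]], of f g] by simp

lemma bump_alg_prod: "(\<And>i. i \<in> I \<Longrightarrow> bump_alg (f i)) \<Longrightarrow> bump_alg (\<lambda>t x. \<Prod>i\<in>I. f i t x)"
  by (induction I rule: infinite_finite_induct) (auto intro: bump_alg_const bump_alg.mult)

lemma bump_alg_sum: "(\<And>i. i \<in> I \<Longrightarrow> bump_alg (f i)) \<Longrightarrow> bump_alg (\<lambda>t x. \<Sum>i\<in>I. f i t x)"
  by (induction I rule: infinite_finite_induct) (auto intro: bump_alg_const bump_alg.add)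

lemma bump_alg_continuous:
  assumes "bump_alg f" shows "continuous_on ({1/4..1} \<times> UNIV) (\<lambda>(t,x). f t x)"
  using assms
proof induction
  case (param p)
  then show ?case
    by (auto simp: case_prod_beta intro!: continuous_on_compose2[OF param] continuous_intros)
next
  case (bump f k)
  show ?case
    using continuous_on_compose2[OF continuous_on_bump[of UNIV k] bump.IH] by (simp add: case_prod_beta)
qed (auto simp: case_prod_beta intro!: continuous_intros)

text \<open>The gradient is produced with components in the class again; this is the stability that
  the coinduction for \<open>smooth_fun\<close> asks for.\<close>

lemma bump_alg_derivative:
  fixes f :: "real \<Rightarrow> real^'n \<Rightarrow> real"
  assumes "bump_alg f"
  shows "\<exists>G. (\<forall>i. bump_alg (\<lambda>t x. G t x $ i)) \<and> (\<forall>t x. (f t has_derivative (\<lambda>h. (G t x::real^'n) \<bullet> h)) (at x))"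
  using assms
proof induction
  case (param p)
  show ?case by (rule exI[of _ "\<lambda>t x. 0"]) (auto intro: bump_alg_const)
next
  case (coord k)
  show ?case
    by (rule exI[of _ "\<lambda>t x. axis k 1"])
       (auto intro!: bump_alg_const bounded_linear_imp_has_derivative bounded_linear_vec_nth simp: inner_axis')
next
  case (add f g)
  then obtain F G where "\<And>i. bump_alg (\<lambda>t x. F t x $ i)" "\<And>i. bump_alg (\<lambda>t x. G t x $ i)"
    "\<And>t x. (f t has_derivative (\<lambda>h. F t x \<bullet> h)) (at x)" "\<And>t x. (g t has_derivative (\<lambda>h. G t x \<bullet> h)) (at x)"
    by blast
  then show ?case
    by (intro exI[of _ "\<lambda>t x. F t x + G t x"])
       (auto intro!: bump_alg.add derivative_eq_intros simp: inner_add_left)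
next
  case (mult f g)
  then obtain F G where "\<And>i. bump_alg (\<lambda>t x. F t x $ i)" "\<And>i. bump_alg (\<lambda>t x. G t x $ i)"
    "\<And>t x. (f t has_derivative (\<lambda>h. F t x \<bullet> h)) (at x)" "\<And>t x. (g t has_derivative (\<lambda>h. G t x \<bullet> h)) (at x)"
    by blast
  then show ?case using mult.hyps
    by (intro exI[of _ "\<lambda>t x. f t x *\<^sub>R G t x + g t x *\<^sub>R F t x"])
       (auto intro!: bump_alg.add bump_alg.mult derivative_eq_intros simp: inner_add_left algebra_simps)
next
  case (bump f k)
  then obtain F where F: "\<And>i. bump_alg (\<lambda>t x. F t x $ i)" "\<And>t x. (f t has_derivative (\<lambda>h. F t x \<bullet> h)) (at x)"
    by blast
  let ?b = "\<lambda>t x. bump (k + 2) (f t x) - real k * bump (k + 1) (f t x)"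
  have "bump_alg ?b"
    by (intro bump_alg_diff bump_alg.mult bump_alg_const bump_alg.bump bump.hyps)
  moreover have "((\<lambda>x. bump k (f t x)) has_derivative (\<lambda>h. (?b t x *\<^sub>R F t x) \<bullet> h)) (at x)" for t x
    using diff_chain_at[OF F(2) bump_has_derivative[of k "f t x", unfolded has_field_derivative_def]]
    by (simp add: o_def)
  ultimately show ?case using F
    by (intro exI[of _ "\<lambda>t x. ?b t x *\<^sub>R F t x"]) (auto intro!: bump_alg.mult)
qed

lemma smooth_fun_bump_alg:
  fixes f :: "real \<Rightarrow> real^'n \<Rightarrow> real"
  assumes "bump_alg f" shows "smooth_fun (f t)"
proof (rule smooth_fun_coinduct_pd[where X="\<lambda>k. \<exists>f. bump_alg f \<and> k = f t"])
  fix k :: "real^'n \<Rightarrow> real" and i assume "\<exists>f. bump_alg f \<and> k = f t"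
  then obtain f where f: "bump_alg f" "k = f t" by blast
  from bump_alg_derivative[OF f(1)] obtain G
    where G: "\<forall>i. bump_alg (\<lambda>t x. G t x $ i)" "\<forall>t x. (f t has_derivative (\<lambda>h. G t x \<bullet> h)) (at x)" by blast
  have "pd i k = (\<lambda>x. G t x $ i)"
    using G(2) f(2) has_derivative_inner_pd(1) by blast
  with G(1) show "\<exists>f. bump_alg f \<and> pd i k = f t"
    by (intro exI[of _ "\<lambda>t x. G t x $ i"]) auto
next
  fix k :: "real^'n \<Rightarrow> real" and x assume "\<exists>f. bump_alg f \<and> k = f t"
  then show "k differentiable (at x)" using bump_alg_derivative unfolding differentiable_def by blast
qed (use assms in auto)

text \<open>The parameter ranges over 1/4..1 because the potential of the kernel integrates over
  exactly one ratio of scales. Differentiation under the integral is the Leibniz rule, with the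
  derivative written as a continuous family \<open>fx\<close> of bounded linear maps.\<close>

lemma bump_alg_integral_derivative:
  fixes f :: "real \<Rightarrow> real^'n \<Rightarrow> real"
  assumes f: "bump_alg f"
  shows "(\<lambda>x. integral {1/4..1} (\<lambda>t. f t x)) differentiable (at x)"
    and "pd i (\<lambda>x. integral {1/4..1} (\<lambda>t. f t x)) x = integral {1/4..1} (\<lambda>t. pd i (f t) x)"
    and "bump_alg (\<lambda>t. pd i (f t))"
    and "(\<lambda>t. f t x) integrable_on {1/4..1}"
proof -
  from bump_alg_derivative[OF f] obtain G where G: "\<And>i. bump_alg (\<lambda>t x. (G t x::real^'n) $ i)"
    "\<And>t x. (f t has_derivative (\<lambda>h. G t x \<bullet> h)) (at x)" by blast
  have pdG: "pd i (f t) x = G t x $ i" for i t x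
    using G(2) has_derivative_inner_pd(1) by blast
  then show "bump_alg (\<lambda>t. pd i (f t))" using G(1)[of i] by (simp add: fun_eq_iff[symmetric] pdG[abs_def])
  have contf: "continuous_on {1/4..1} (\<lambda>t. f t x)" if "bump_alg f" for x and f :: "real \<Rightarrow> real^'n \<Rightarrow> real"
  proof -
    have "continuous_on {1/4..1} ((\<lambda>(t,x). f t x) \<circ> (\<lambda>t. (t,x)))"
      by (rule continuous_on_compose)
         (auto intro!: continuous_intros continuous_on_subset[OF bump_alg_continuous[OF that]])
    then show ?thesis by (simp add: o_def)
  qed
  show int: "(\<lambda>t. f t x) integrable_on {1/4..1}" for x
    by (rule integrable_continuous_real[OF contf[OF f]])
  have "continuous_on ({1/4..1} \<times> UNIV) (\<lambda>(t,x). G t x)"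
  proof -
    have "continuous_on ({1/4..1} \<times> UNIV) (\<lambda>z. \<chi> i. (\<lambda>(t,x). G t x $ i) z)"
      by (intro continuous_on_vec_lambda bump_alg_continuous[OF G(1)])
    then show ?thesis by (rule continuous_on_eq) auto
  qed
  note c2 = this
  have cG: "continuous_on (UNIV \<times> {1/4..1}) (\<lambda>(x,t). G t x)"
  proof -
    have "continuous_on (UNIV \<times> {1/4..1}) ((\<lambda>(t,x). G t x) \<circ> prod.swap)"
      by (rule continuous_on_compose) (auto intro!: continuous_on_swap continuous_on_subset[OF c2])
    then show ?thesis by (simp add: o_def case_prod_beta)
  qed
  define fx where "fx x t = blinfun_inner_left (G t x)" for x t
  have fx: "blinfun_apply (fx x t) = (\<lambda>h. G t x \<bullet> h)" for x t
    by (simp add: fx_def inner_commute fun_eq_iff)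
  have cfx: "continuous_on (UNIV \<times> {1/4..1}) (\<lambda>(x,t). fx x t)"
    using bounded_linear.continuous_on[OF bounded_linear_blinfun_inner_left cG]
    by (simp add: fx_def case_prod_beta)
  have "((\<lambda>x. integral (cbox (1/4) 1) (\<lambda>t. f t x)) has_derivative integral (cbox (1/4) 1) (fx x)) (at x within UNIV)"
    by (rule leibniz_rule[where f="\<lambda>x t. f t x"]) (use G(2) fx int cfx in auto)
  then have D: "((\<lambda>x. integral {1/4..1} (\<lambda>t. f t x)) has_derivative blinfun_apply (integral {1/4..1} (fx x))) (at x)"
    by simp
  then show "(\<lambda>x. integral {1/4..1} (\<lambda>t. f t x)) differentiable (at x)"
    unfolding differentiable_def by blast
  have "fx x integrable_on {1/4..1}"
  proof (rule integrable_continuous_real)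
    have "continuous_on {1/4..1} ((\<lambda>(x,t). fx x t) \<circ> Pair x)"
      by (rule continuous_on_compose) (auto intro!: continuous_intros continuous_on_subset[OF cfx])
    then show "continuous_on {1/4..1} (fx x)" by (simp add: o_def)
  qed
  then have "blinfun_apply (integral {1/4..1} (fx x)) (axis i 1) = integral {1/4..1} (\<lambda>t. blinfun_apply (fx x t) (axis i 1))"
    by (rule blinfun_apply_integral)
  with pd_eqI[OF D] show "pd i (\<lambda>x. integral {1/4..1} (\<lambda>t. f t x)) x = integral {1/4..1} (\<lambda>t. pd i (f t) x)"
    by (simp add: fx inner_axis_one pdG)
qed

lemma smooth_fun_integral_bump_alg:
  fixes f :: "real \<Rightarrow> real^'n \<Rightarrow> real"
  assumes "bump_alg f" shows "smooth_fun (\<lambda>x. integral {1/4..1} (\<lambda>t. f t x))"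
proof (rule smooth_fun_coinduct_pd[where X="\<lambda>k. \<exists>f. bump_alg f \<and> k = (\<lambda>x. integral {1/4..1} (\<lambda>t. f t x))"])
  fix k :: "real^'n \<Rightarrow> real" and i assume "\<exists>f. bump_alg f \<and> k = (\<lambda>x. integral {1/4..1} (\<lambda>t. f t x))"
  then show "\<exists>f. bump_alg f \<and> pd i k = (\<lambda>x. integral {1/4..1} (\<lambda>t. f t x))"
    using bump_alg_integral_derivative(2,3) by blast
qed (use assms bump_alg_integral_derivative(1) in auto)

subsection \<open>Compactly supported smooth functions\<close>

text \<open>A radius stands in place of a support set, so that it can be tracked through
  derivatives, rescalings and convolutions.\<close>

definition csmooth :: "real \<Rightarrow> (real^'n::finite \<Rightarrow> real) \<Rightarrow> bool" where
  "csmooth R \<phi> \<longleftrightarrow> smooth_fun \<phi> \<and> (\<forall>x. R < norm x \<longrightarrow> \<phi> x = 0)"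

lemma csmoothD: "csmooth R \<phi> \<Longrightarrow> smooth_fun \<phi>" "csmooth R \<phi> \<Longrightarrow> R < norm x \<Longrightarrow> \<phi> x = 0"
  by (auto simp: csmooth_def)

lemma csmooth_differentiable: "csmooth R \<phi> \<Longrightarrow> \<phi> differentiable (at x)"
  by (simp add: csmoothD(1) smooth_fun_differentiable)

lemma csmooth_continuous: "csmooth R \<phi> \<Longrightarrow> continuous_on S \<phi>"
  by (simp add: csmoothD(1) smooth_fun_continuous)

lemma csmooth_borel: "csmooth R \<phi> \<Longrightarrow> \<phi> \<in> borel_measurable borel"
  by (simp add: borel_measurable_continuous_onI csmooth_continuous)

lemma csmooth_pd: 
  assumes "csmooth R \<phi>" shows "csmooth R (pd i \<phi>)"
proof -
  have "pd i \<phi> x = 0" if "R < norm x" for x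
  proof -
    have "pd i \<phi> x = pd i (\<lambda>x. 0) x"
      by (rule pd_cong_open[of "{x. R < norm x}"])
         (use assms that in \<open>auto simp: csmooth_def intro!: open_Collect_less continuous_intros\<close>)
    then show ?thesis by (simp add: pd_def)
  qed
  with assms show ?thesis by (simp add: csmooth_def smooth_fun_pd)
qed

lemma csmooth_mono: "csmooth R \<phi> \<Longrightarrow> R \<le> R' \<Longrightarrow> csmooth R' \<phi>"
  by (auto simp: csmooth_def)

lemma csmooth_cmult: "csmooth R \<phi> \<Longrightarrow> csmooth R (\<lambda>x. c * \<phi> x)"
  by (auto simp: csmooth_def intro: smooth_fun_cmult)

lemma csmooth_sum: "(\<And>l. l \<in> I \<Longrightarrow> csmooth R (\<phi> l)) \<Longrightarrow> csmooth R (\<lambda>x. \<Sum>l\<in>I. \<phi> l x)"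
  by (auto simp: csmooth_def intro!: smooth_fun_sum sum.neutral)

lemma csmooth_scale:
  assumes "csmooth R \<phi>" "c > 0" shows "csmooth (R / c) (\<lambda>x. \<phi> (c *\<^sub>R x))"
  using assms smooth_fun_affine[of \<phi> 0 c] by (auto simp: csmooth_def field_simps)

lemma csmooth_bounded:
  assumes "csmooth R \<phi>" obtains C where "C > 0" "\<And>x. \<bar>\<phi> x\<bar> \<le> C"
proof -
  have "bounded (\<phi> ` cball 0 R)"
    by (intro compact_imp_bounded compact_continuous_image csmooth_continuous[OF assms] compact_cball)
  then obtain C where C: "C > 0" "\<And>x. x \<in> cball 0 R \<Longrightarrow> \<bar>\<phi> x\<bar> \<le> C"
    unfolding bounded_pos by auto
  have "\<bar>\<phi> x\<bar> \<le> C" for x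
    using C csmoothD(2)[OF assms, of x] by (cases "x \<in> cball 0 R") auto
  with C(1) show ?thesis using that by blast
qed

lemma norm_grad_le:
  fixes f :: "real^'n \<Rightarrow> real" and C :: real
  assumes "\<And>i. \<bar>pd i f x\<bar> \<le> C" shows "norm (grad f x) \<le> CARD('n) * C"
  using norm_le_l1_cart[of "grad f x"] sum_bounded_above[of UNIV "\<lambda>i. \<bar>grad f x $ i\<bar>" C] assms
  by (simp add: grad_def)

lemma lipschitz_on_convex_pd:
  fixes f :: "real^'n \<Rightarrow> real" and C :: real
  assumes "convex S" "open S" "\<And>x. x \<in> S \<Longrightarrow> f differentiable (at x)" "\<And>x i. x \<in> S \<Longrightarrow> \<bar>pd i f x\<bar> \<le> C"
    "x \<in> S" "y \<in> S"
  shows "\<bar>f x - f y\<bar> \<le> CARD('n) * C * norm (x - y)"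
proof -
  have "norm (f x - f y) \<le> (CARD('n) * C) * norm (x - y)"
  proof (rule differentiable_bound[where f'="\<lambda>x h. grad f x \<bullet> h" and S=S])
    fix x assume x: "x \<in> S"
    show "(f has_derivative (\<bullet>) (grad f x)) (at x within S)"
      using has_derivative_grad[OF assms(3)[OF x]] has_derivative_at_withinI by blast
    show "onorm ((\<bullet>) (grad f x)) \<le> CARD('n) * C"
    proof (rule onorm_le)
      fix h
      have "\<bar>grad f x \<bullet> h\<bar> \<le> norm (grad f x) * norm h" by (rule Cauchy_Schwarz_ineq2)
      also have "\<dots> \<le> CARD('n) * C * norm h"
        by (intro mult_right_mono norm_grad_le assms(4) x) auto
      finally show "norm (grad f x \<bullet> h) \<le> CARD('n) * C * norm h" by simp
    qed
  qed (use assms in auto)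
  then show ?thesis by simp
qed

lemma csmooth_lipschitz:
  fixes \<phi> :: "real^'n \<Rightarrow> real"
  assumes "csmooth R \<phi>" obtains L where "L > 0" "\<And>x y. \<bar>\<phi> x - \<phi> y\<bar> \<le> L * norm (x - y)"
proof -
  have "\<exists>C. C > 0 \<and> (\<forall>x. \<bar>pd i \<phi> x\<bar> \<le> C)" for i
    using csmooth_bounded[OF csmooth_pd[OF assms]] by metis
  then obtain C where C: "\<And>i. C i > 0" "\<And>i x. \<bar>pd i \<phi> x\<bar> \<le> C i" by metis
  have le: "C i \<le> (\<Sum>i\<in>UNIV. C i)" for i
    by (rule member_le_sum) (use C in \<open>auto simp: less_imp_le\<close>)
  have pos: "(\<Sum>i\<in>UNIV. C i) > 0" by (rule sum_pos) (use C in auto)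
  show ?thesis
  proof (rule that[of "CARD('n) * (\<Sum>i\<in>UNIV. C i)"])
    fix x y
    have bd: "\<bar>pd i \<phi> x\<bar> \<le> (\<Sum>i\<in>UNIV. C i)" for i x
      using C(2)[where i=i and x=x] le[of i] by linarith
    show "\<bar>\<phi> x - \<phi> y\<bar> \<le> CARD('n) * (\<Sum>i\<in>UNIV. C i) * norm (x - y)"
      by (rule lipschitz_on_convex_pd[where f=\<phi> and S=UNIV]) (auto simp: csmooth_differentiable[OF assms] bd)
  qed (use pos in auto)
qed

lemma csmooth_integrable: 
  assumes "csmooth R \<phi>" shows "integrable lborel \<phi>"
proof -
  have "integrable lborel (\<lambda>x. indicator (cball 0 R) x *\<^sub>R \<phi> x)"
    by (rule borel_integrable_compact) (auto intro: csmooth_continuous[OF assms])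
  moreover have "(\<lambda>x. indicator (cball 0 R) x *\<^sub>R \<phi> x) = \<phi>"
    using csmoothD(2)[OF assms] by (force simp: indicator_def fun_eq_iff)
  ultimately show ?thesis by simp
qed

text \<open>The reflected kernel is the test function that turns a weak equation into an identity
  between convolutions at \<open>x\<close>.\<close>

lemma test_fun_reflect:
  assumes "csmooth R \<phi>" "cball x R \<subseteq> U" shows "test_fun U (\<lambda>y. \<phi> (x - y))"
proof -
  have sm: "smooth_fun (\<lambda>y. \<phi> (x - y))"
    using smooth_fun_affine[OF csmoothD(1)[OF assms(1)], where a=x and c="-1"] by simp
  have sub: "closure {y. \<phi> (x - y) \<noteq> 0} \<subseteq> cball x R"
  proof (rule closure_minimal)
    show "{y. \<phi> (x - y) \<noteq> 0} \<subseteq> cball x R"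
      using csmoothD(2)[OF assms(1)] by (force simp: dist_norm)
  qed auto
  then have "compact (closure {y. \<phi> (x - y) \<noteq> 0})"
    by (meson bounded_cball bounded_subset closed_closure compact_eq_bounded_closed)
  with sm sub assms(2) show ?thesis by (auto simp: test_fun_def)
qed

lemma pd_reflect:
  assumes "csmooth R \<phi>" shows "pd i (\<lambda>y. \<phi> (x - y)) y = - pd i \<phi> (x - y)"
  using pd_affine(2)[OF csmooth_differentiable[OF assms], where a=x and c="-1" and x=y and i=i] by simp

lemma lap_reflect:
  assumes "csmooth R \<phi>" shows "lap (\<lambda>y. \<phi> (x - y)) y = lap \<phi> (x - y)"
proof -
  have "pd i (pd i (\<lambda>y. \<phi> (x - y))) y = pd i (pd i \<phi>) (x - y)" for i
  proof -
    have "pd i (\<lambda>y. \<phi> (x - y)) = (\<lambda>y. (-1) * pd i \<phi> (x - y))"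
      by (simp add: fun_eq_iff pd_reflect[OF assms])
    then have "pd i (pd i (\<lambda>y. \<phi> (x - y))) y = (-1) * pd i (\<lambda>y. pd i \<phi> (x - y)) y"
      using pd_cmult[of "\<lambda>y. pd i \<phi> (x - y)" y i "-1"] 
        pd_affine(1)[OF csmooth_differentiable[OF csmooth_pd[OF assms]], where a=x and c="-1" and x=y]
      by simp
    then show ?thesis by (simp add: pd_reflect[OF csmooth_pd[OF assms]])
  qed
  then show ?thesis by (simp add: lap_def)
qed

subsection \<open>Differentiation of integrals\<close>

text \<open>Along the line through \<open>x\<close> in direction \<open>v\<close> the difference
  quotients tend to the square of |v| and are at most B |v|.\<close>

lemma has_derivative_le_lipschitz:
  fixes f :: "'a::euclidean_space \<Rightarrow> real"
  assumes "(f has_derivative (\<lambda>h. v \<bullet> h)) (at x)" "\<And>y. \<bar>f y - f x\<bar> \<le> B * norm (y - x)"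
  shows "norm v \<le> B"
proof (rule ccontr)
  assume "\<not> norm v \<le> B"
  then have lt: "B < norm v" by simp
  have "0 \<le> B" using assms(2)[of "x + (SOME b. b \<in> Basis)"] norm_Basis[OF SOME_Basis] by simp
  then have v: "v \<noteq> 0" using lt by auto
  have "((\<lambda>h. x + h *\<^sub>R v) has_derivative (\<lambda>h. h *\<^sub>R v)) (at 0)"
    by (auto intro!: derivative_eq_intros)
  then have "((\<lambda>s. f (x + s *\<^sub>R v)) has_derivative (\<lambda>h. v \<bullet> (h *\<^sub>R v))) (at 0)"
    using diff_chain_at[of "\<lambda>h. x + h *\<^sub>R v" "\<lambda>h. h *\<^sub>R v" 0 f "\<lambda>h. v \<bullet> h"] assms(1)
    by (simp add: o_def)
  then have "((\<lambda>s. f (x + s *\<^sub>R v)) has_real_derivative v \<bullet> v) (at 0)"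
    by (simp add: has_field_derivative_def mult_commute_abs)
  then have "((\<lambda>s. (f (x + s *\<^sub>R v) - f x) / s) \<longlongrightarrow> v \<bullet> v) (at 0)"
    by (simp add: DERIV_def)
  then have "((\<lambda>s. \<bar>(f (x + s *\<^sub>R v) - f x) / s\<bar>) \<longlongrightarrow> \<bar>v \<bullet> v\<bar>) (at 0)"
    by (rule tendsto_rabs)
  moreover have "\<forall>\<^sub>F s in at 0. \<bar>(f (x + s *\<^sub>R v) - f x) / s\<bar> \<le> B * norm v"
    unfolding eventually_at_filter
  proof (rule eventuallyI, safe)
    fix s :: real assume "s \<noteq> 0"
    then show "\<bar>(f (x + s *\<^sub>R v) - f x) / s\<bar> \<le> B * norm v"
      using assms(2)[of "x + s *\<^sub>R v"] by (simp add: abs_divide field_simps)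
  qed
  ultimately have "\<bar>v \<bullet> v\<bar> \<le> B * norm v"
    by (rule tendsto_upperbound) simp
  then have "norm v * norm v \<le> B * norm v" by (simp add: power2_norm_eq_inner[symmetric] power2_eq_square)
  with lt v show False by simp
qed

text \<open>Dominated convergence for the remainder quotients, with majorant \<open>2 * B\<close>.
  Differentiability is asked at the single point \<open>x\<close> and for almost every \<omega>, the
  form in which Rademacher's theorem delivers it.\<close>

lemma has_derivative_integral_param:
  fixes k :: "'w \<Rightarrow> 'a::euclidean_space \<Rightarrow> real"
  assumes int: "\<And>y. integrable M (\<lambda>\<omega>. k \<omega> y)"
    and G [measurable]: "G \<in> borel_measurable M" and B: "integrable M B"
    and lip: "AE \<omega> in M. \<forall>y. \<bar>k \<omega> y - k \<omega> x\<bar> \<le> B \<omega> * norm (y - x)"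
    and der: "AE \<omega> in M. (k \<omega> has_derivative (\<lambda>h. G \<omega> \<bullet> h)) (at x)"
  shows "integrable M G"
    and "((\<lambda>y. \<integral>\<omega>. k \<omega> y \<partial>M) has_derivative (\<lambda>h. (\<integral>\<omega>. G \<omega> \<partial>M) \<bullet> h)) (at x)"
proof -
  have GB: "AE \<omega> in M. norm (G \<omega>) \<le> B \<omega>"
    using lip der by eventually_elim (blast intro: has_derivative_le_lipschitz)
  show Gi: "integrable M G"
    by (rule Bochner_Integration.integrable_bound[OF B G]) (use GB in eventually_elim, auto)
  have [measurable]: "B \<in> borel_measurable M" "\<And>y. (\<lambda>\<omega>. k \<omega> y) \<in> borel_measurable M"
    using B int by auto
  show "((\<lambda>y. \<integral>\<omega>. k \<omega> y \<partial>M) has_derivative (\<lambda>h. (\<integral>\<omega>. G \<omega> \<partial>M) \<bullet> h)) (at x)"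
    unfolding has_derivative_at
  proof (intro conjI bounded_linear_inner_right)
    show "(\<lambda>h. norm ((\<integral>\<omega>. k \<omega> (x + h) \<partial>M) - (\<integral>\<omega>. k \<omega> x \<partial>M) - (\<integral>\<omega>. G \<omega> \<partial>M) \<bullet> h) / norm h) \<midarrow>0\<rightarrow> 0"
      unfolding LIMSEQ_SEQ_conv[symmetric]
    proof (intro allI impI)
      fix S :: "nat \<Rightarrow> 'a" assume S: "(\<forall>n. S n \<noteq> 0) \<and> S \<longlonglongrightarrow> 0"
      let ?q = "\<lambda>n \<omega>. (k \<omega> (x + S n) - k \<omega> x - G \<omega> \<bullet> S n) / norm (S n)"
      have lim: "(\<lambda>n. \<integral>\<omega>. ?q n \<omega> \<partial>M) \<longlonglongrightarrow> (\<integral>\<omega>. 0 \<partial>M)"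
      proof (rule integral_dominated_convergence[where w="\<lambda>\<omega>. 2 * B \<omega>"])
        show "AE \<omega> in M. (\<lambda>n. ?q n \<omega>) \<longlonglongrightarrow> 0"
          using der
        proof eventually_elim
          case (elim \<omega>)
          then have "(\<lambda>h. norm (k \<omega> (x + h) - k \<omega> x - G \<omega> \<bullet> h) / norm h) \<midarrow>0\<rightarrow> 0"
            by (simp add: has_derivative_at)
          then have "(\<lambda>n. norm (k \<omega> (x + S n) - k \<omega> x - G \<omega> \<bullet> S n) / norm (S n)) \<longlonglongrightarrow> 0"
            using S unfolding LIMSEQ_SEQ_conv[symmetric] by blast
          then have "(\<lambda>n. \<bar>?q n \<omega>\<bar>) \<longlonglongrightarrow> 0" by (simp add: abs_divide)
          then show ?case by (rule tendsto_rabs_zero_cancel)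
        qed
        show "AE \<omega> in M. norm (?q n \<omega>) \<le> 2 * B \<omega>" for n
          using lip GB
        proof eventually_elim
          case (elim \<omega>)
          have "\<bar>k \<omega> (x + S n) - k \<omega> x - G \<omega> \<bullet> S n\<bar> \<le> \<bar>k \<omega> (x + S n) - k \<omega> x\<bar> + \<bar>G \<omega> \<bullet> S n\<bar>" by simp
          also have "\<dots> \<le> B \<omega> * norm (S n) + B \<omega> * norm (S n)"
            using elim(1)[rule_format, of "x + S n"] Cauchy_Schwarz_ineq2[of "G \<omega>" "S n"]
              mult_right_mono[OF elim(2), of "norm (S n)"] by simp
          finally show ?case using S by (simp add: abs_divide field_simps)
        qed
      qed (use B in auto)
      have eq: "(\<integral>\<omega>. ?q n \<omega> \<partial>M) = ((\<integral>\<omega>. k \<omega> (x + S n) \<partial>M) - (\<integral>\<omega>. k \<omega> x \<partial>M) - (\<integral>\<omega>. G \<omega> \<partial>M) \<bullet> S n) / norm (S n)" for n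
        using int Gi by (simp add: Bochner_Integration.integral_diff)
      show "(\<lambda>n. norm ((\<integral>\<omega>. k \<omega> (x + S n) \<partial>M) - (\<integral>\<omega>. k \<omega> x \<partial>M) - (\<integral>\<omega>. G \<omega> \<partial>M) \<bullet> S n) / norm (S n)) \<longlonglongrightarrow> 0"
        using tendsto_rabs[OF lim] unfolding eq by (simp add: abs_divide)
    qed
  qed
qed

lemma lborel_integral_affine:
  fixes f :: "'a::euclidean_space \<Rightarrow> real" 
  assumes "c \<noteq> 0" "f \<in> borel_measurable borel"
  shows "integral\<^sup>L lborel f = \<bar>c\<bar> ^ DIM('a) * (\<integral>x. f (t + c *\<^sub>R x) \<partial>lborel)"
    and "integrable lborel f \<longleftrightarrow> integrable lborel (\<lambda>x. f (t + c *\<^sub>R x))"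
proof -
  have [measurable]: "f \<in> borel_measurable borel" by fact
  have [measurable]: "(\<lambda>x::'a. t + c *\<^sub>R x) \<in> borel \<rightarrow>\<^sub>M borel" by simp
  show "integral\<^sup>L lborel f = \<bar>c\<bar> ^ DIM('a) * (\<integral>x. f (t + c *\<^sub>R x) \<partial>lborel)"
    by (subst lborel_affine[OF assms(1), of t])
       (simp add: integral_density integral_distr)
  show "integrable lborel f \<longleftrightarrow> integrable lborel (\<lambda>x. f (t + c *\<^sub>R x))"
    by (subst lborel_affine[OF assms(1), of t])
       (use assms(1) in \<open>simp add: integrable_density integrable_distr_eq\<close>)
qed

lemma lborel_integral_translation:
  fixes f :: "'a::euclidean_space \<Rightarrow> real" 
  assumes "f \<in> borel_measurable borel"
  shows "(\<integral>x. f (x + a) \<partial>lborel) = (\<integral>x. f x \<partial>lborel)" "(\<integral>x. f (a - x) \<partial>lborel) = (\<integral>x. f x \<partial>lborel)"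
    "integrable lborel (\<lambda>x. f (a - x)) \<longleftrightarrow> integrable lborel f"
    "integrable lborel (\<lambda>x. f (x + a)) \<longleftrightarrow> integrable lborel f"
  using lborel_integral_affine[of 1 f a] lborel_integral_affine[of "-1" f a] assms
  by (auto simp: add.commute)

text \<open>The integral of a translate of \<open>f\<close> does not depend on the translation; its
  derivative, taken under the integral, is the integral of \<open>pd i f\<close>.\<close>

lemma integral_pd_eq_0:
  fixes f :: "real^'n \<Rightarrow> real"
  assumes f: "csmooth R f" shows "(\<integral>x. pd i f x \<partial>lborel) = 0"
proof -
  obtain L where L: "L > 0" "\<And>x y. \<bar>f x - f y\<bar> \<le> L * norm (x - y)" using csmooth_lipschitz[OF f] by blast
  note [measurable] = csmooth_borel[OF f] csmooth_borel[OF csmooth_pd[OF f]]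
  \<comment> \<open>Clamping the translation to [-1, 1] leaves the derivative at 0 unchanged and
    confines all translates to \<open>cball 0 (R + 1)\<close>, so that one integrable majorant works
    for every \<open>y\<close>.\<close>
  let ?I = "\<lambda>y::real. \<integral>x. f (x + (max (-1) (min 1 y)) *\<^sub>R axis i 1) \<partial>lborel"
  let ?c = "\<lambda>y::real. max (-1) (min 1 y)"
  have "(?I has_derivative (\<lambda>h. (\<integral>x. pd i f x \<partial>lborel) \<bullet> h)) (at 0)"
  proof (rule has_derivative_integral_param(2)[where B="\<lambda>x. L * indicator (cball 0 (R + 1)) x"])
    show "integrable lborel (\<lambda>x. f (x + ?c y *\<^sub>R axis i 1))" for y
      using lborel_integral_translation(4)[of f] csmooth_integrable[OF f] by simp
    show "integrable lborel (\<lambda>x. L * indicator (cball 0 (R + 1)) x)"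
      by (intro integrable_mult_right integrable_real_indicator) (auto intro: emeasure_bounded_finite[unfolded infinity_ennreal_def])
    show "AE x in lborel. \<forall>y. \<bar>f (x + ?c y *\<^sub>R axis i 1) - f (x + ?c 0 *\<^sub>R axis i 1)\<bar>
        \<le> L * indicator (cball 0 (R + 1)) x * norm (y - 0)"
    proof (intro AE_I2 allI)
      fix x :: "real^'n" and y :: real
      show "\<bar>f (x + ?c y *\<^sub>R axis i 1) - f (x + ?c 0 *\<^sub>R axis i 1)\<bar> \<le> L * indicator (cball 0 (R + 1)) x * norm (y - 0)"
      proof (cases "norm x \<le> R + 1")
        case True
        have "\<bar>f (x + ?c y *\<^sub>R axis i 1) - f x\<bar> \<le> L * norm (?c y *\<^sub>R axis i 1 :: real^'n)"
          using L(2)[of "x + ?c y *\<^sub>R axis i 1" x] by simp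
        also have "\<dots> \<le> L * \<bar>y\<bar>" using L(1) by (intro mult_left_mono) (auto simp: )
        finally show ?thesis using True by simp
      next
        case False
        have "norm x - norm (?c y *\<^sub>R axis i 1 :: real^'n) \<le> norm (x + ?c y *\<^sub>R axis i 1)"
          using norm_triangle_ineq4[of "x + ?c y *\<^sub>R axis i 1" "?c y *\<^sub>R axis i 1"] by simp
        moreover have "norm (?c y *\<^sub>R axis i 1 :: real^'n) \<le> 1" by simp
        ultimately have "R < norm (x + ?c y *\<^sub>R axis i 1)" "R < norm x" using False by linarith+
        then show ?thesis using False csmoothD(2)[OF f] by simp
      qed
    qed
    show "AE x in lborel. ((\<lambda>y. f (x + ?c y *\<^sub>R axis i 1)) has_derivative (\<lambda>h. pd i f x \<bullet> h)) (at 0)"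
    proof (rule AE_I2)
      fix x :: "real^'n"
      have "((\<lambda>s. x + s *\<^sub>R axis i 1) has_derivative (\<lambda>h. h *\<^sub>R axis i 1)) (at 0)"
        by (auto intro!: derivative_eq_intros)
      then have "((\<lambda>s. f (x + s *\<^sub>R axis i 1)) has_derivative (\<lambda>h. grad f x \<bullet> (h *\<^sub>R axis i 1))) (at 0)"
        using diff_chain_at[of "\<lambda>s. x + s *\<^sub>R axis i 1" "\<lambda>h. h *\<^sub>R axis i 1" 0 f "\<lambda>h. grad f x \<bullet> h"]
          has_derivative_grad[OF csmooth_differentiable[OF f], of x] by (simp add: o_def)
      then have "((\<lambda>s. f (x + s *\<^sub>R axis i 1)) has_derivative (\<lambda>h. pd i f x \<bullet> h)) (at 0)"
        by (simp add: inner_axis_one grad_def mult.commute)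
      then show "((\<lambda>y. f (x + ?c y *\<^sub>R axis i 1)) has_derivative (\<lambda>h. pd i f x \<bullet> h)) (at 0)"
        by (rule has_derivative_transform_within_open[of _ _ _ _ "{-1<..<1}"]) auto
    qed
  qed simp
  moreover have "?I = (\<lambda>y. \<integral>x. f x \<partial>lborel)"
    by (intro ext lborel_integral_translation(1)) simp
  ultimately have "((\<lambda>y::real. \<integral>x. f x \<partial>lborel) has_derivative (\<lambda>h. (\<integral>x. pd i f x \<partial>lborel) \<bullet> h)) (at 0)" by simp
  from has_derivative_unique[OF this has_derivative_const] have "(\<lambda>h. (\<integral>x. pd i f x \<partial>lborel) \<bullet> h) = (\<lambda>h. 0)" .
  from fun_cong[OF this, of 1] show ?thesis by simp
qed

text \<open>By the product rule the derivative of a product is a sum of two products, so the sums,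
  and not the products alone, form a class stable under \<open>pd\<close>.\<close>

inductive sum_of_products :: "(real^'n::finite \<Rightarrow> real) \<Rightarrow> bool" where
  "smooth_fun f \<Longrightarrow> smooth_fun g \<Longrightarrow> sum_of_products (\<lambda>x. f x * g x)"
| "sum_of_products f \<Longrightarrow> sum_of_products g \<Longrightarrow> sum_of_products (\<lambda>x. f x + g x)"

lemma smooth_fun_mult:
  fixes f :: "real^'n \<Rightarrow> real"
  assumes "smooth_fun f" "smooth_fun g" shows "smooth_fun (\<lambda>x. f x * g x)"
proof -
  have *: "k differentiable (at x) \<and> sum_of_products (pd i k)" if "sum_of_products k" for k :: "real^'n \<Rightarrow> real" and x i
    using that
  proof (induction arbitrary: x)
    case (1 f g)
    have "pd i (\<lambda>x. f x * g x) = (\<lambda>x. f x * pd i g x + pd i f x * g x)"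
      using 1 by (simp add: fun_eq_iff pd_mult smooth_fun_differentiable)
    with 1 show ?case
      by (auto intro!: sum_of_products.intros smooth_fun_pd simp: smooth_fun_differentiable)
  next
    case (2 f g)
    then have "pd i (\<lambda>x. f x + g x) = (\<lambda>x. pd i f x + pd i g x)"
      by (simp add: fun_eq_iff pd_add)
    with 2 show ?case by (auto intro!: sum_of_products.intros(2))
  qed
  show ?thesis
    by (rule smooth_fun_coinduct_pd[where X=sum_of_products]) (use * assms sum_of_products.intros in blast)+
qed

lemma csmooth_mult: "csmooth R f \<Longrightarrow> smooth_fun g \<Longrightarrow> csmooth R (\<lambda>x. f x * g x)"
  by (auto simp: csmooth_def intro: smooth_fun_mult)

lemma csmooth_mult_integrable: "csmooth R f \<Longrightarrow> smooth_fun g \<Longrightarrow> integrable lborel (\<lambda>x. f x * g x)"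
  by (rule csmooth_integrable[OF csmooth_mult])

lemma integral_by_parts_pd:
  fixes f :: "real^'n \<Rightarrow> real"
  assumes "csmooth R f" "smooth_fun g"
  shows "(\<integral>x. f x * pd i g x \<partial>lborel) = - (\<integral>x. pd i f x * g x \<partial>lborel)"
proof -
  have "0 = (\<integral>x. pd i (\<lambda>x. f x * g x) x \<partial>lborel)"
    by (rule integral_pd_eq_0[symmetric, OF csmooth_mult[OF assms]])
  also have "\<dots> = (\<integral>x. f x * pd i g x + pd i f x * g x \<partial>lborel)"
    by (intro Bochner_Integration.integral_cong refl pd_mult smooth_fun_differentiable csmoothD(1)[OF assms(1)] assms(2))
  also have "\<dots> = (\<integral>x. f x * pd i g x \<partial>lborel) + (\<integral>x. pd i f x * g x \<partial>lborel)"
    by (intro Bochner_Integration.integral_add csmooth_mult_integrable[of R] assms smooth_fun_pd csmooth_pd)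
  finally show ?thesis by simp
qed

text \<open>Two integrations by parts, first in direction \<open>j\<close>, then in direction
  \<open>i\<close>, with the third derivatives commuted in between.\<close>

lemma integral_pd_pd_sq:
  fixes \<phi> :: "real^'n \<Rightarrow> real"
  assumes \<phi>: "csmooth R \<phi>"
  shows "(\<integral>x. (pd j (pd i \<phi>) x)\<^sup>2 \<partial>lborel) = (\<integral>x. pd i (pd i \<phi>) x * pd j (pd j \<phi>) x \<partial>lborel)"
proof -
  note sm = csmoothD(1)[OF \<phi>]
  have "(\<integral>x. (pd j (pd i \<phi>) x)\<^sup>2 \<partial>lborel) = (\<integral>x. pd j (pd i \<phi>) x * pd j (pd i \<phi>) x \<partial>lborel)"
    by (simp add: power2_eq_square)
  also have "\<dots> = - (\<integral>x. pd i \<phi> x * pd j (pd j (pd i \<phi>)) x \<partial>lborel)"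
    using integral_by_parts_pd[OF csmooth_pd[OF \<phi>, of i], of "pd j (pd i \<phi>)" j] sm by (simp add: smooth_fun_pd)
  also have "pd j (pd j (pd i \<phi>)) = pd i (pd j (pd j \<phi>))"
  proof -
    have "pd j (pd i \<phi>) = pd i (pd j \<phi>)" using pd_commute[OF sm] by blast
    then show ?thesis using pd_commute[OF smooth_fun_pd[OF sm, of j]] by auto
  qed
  also have "- (\<integral>x. pd i \<phi> x * pd i (pd j (pd j \<phi>)) x \<partial>lborel) = (\<integral>x. pd i (pd i \<phi>) x * pd j (pd j \<phi>) x \<partial>lborel)"
    using integral_by_parts_pd[OF csmooth_pd[OF \<phi>, of i], of "pd j (pd j \<phi>)" i] sm by (simp add: smooth_fun_pd)
  finally show ?thesis .
qed

text \<open>The square of the Laplacian expands into products of two pure second derivatives. By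
  \<open>integral_pd_pd_sq\<close> each of them has a nonnegative integral, and the one for the pair
  \<open>i\<close>, \<open>j\<close> is the left-hand side.\<close>

lemma integral_pd_pd_sq_le_lap:
  fixes \<phi> :: "real^'n \<Rightarrow> real"
  assumes \<phi>: "csmooth R \<phi>"
  shows "(\<integral>x. (pd j (pd i \<phi>) x)\<^sup>2 \<partial>lborel) \<le> (\<integral>x. (lap \<phi> x)\<^sup>2 \<partial>lborel)"
proof -
  let ?a = "\<lambda>k l. \<integral>x. pd k (pd k \<phi>) x * pd l (pd l \<phi>) x \<partial>lborel"
  have int: "integrable lborel (\<lambda>x. pd k (pd k \<phi>) x * pd l (pd l \<phi>) x)" for k l
    by (rule csmooth_mult_integrable[of R]) (intro csmooth_pd \<phi> smooth_fun_pd csmoothD(1)[OF \<phi>])+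
  have nn: "?a k l \<ge> 0" for k l
    unfolding integral_pd_pd_sq[OF \<phi>, symmetric] by simp
  have "(\<integral>x. (pd j (pd i \<phi>) x)\<^sup>2 \<partial>lborel) = ?a i j" by (rule integral_pd_pd_sq[OF \<phi>])
  also have "\<dots> \<le> (\<Sum>l\<in>UNIV. ?a i l)" by (rule member_le_sum) (use nn in auto)
  also have "\<dots> \<le> (\<Sum>k\<in>UNIV. \<Sum>l\<in>UNIV. ?a k l)"
    by (rule member_le_sum[where f="\<lambda>k. \<Sum>l\<in>UNIV. ?a k l"]) (use nn in \<open>auto intro: sum_nonneg\<close>)
  also have "\<dots> = (\<integral>x. (\<Sum>k\<in>UNIV. \<Sum>l\<in>UNIV. pd k (pd k \<phi>) x * pd l (pd l \<phi>) x) \<partial>lborel)"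
    using int by simp
  also have "\<dots> = (\<integral>x. (lap \<phi> x)\<^sup>2 \<partial>lborel)"
    by (simp add: lap_def power2_eq_square sum_product)
  finally show ?thesis .
qed

subsection \<open>Mollification\<close>

definition conv :: "(real^'n::finite \<Rightarrow> real) \<Rightarrow> (real^'n \<Rightarrow> real) \<Rightarrow> real^'n \<Rightarrow> real" where
  "conv F \<phi> x = (\<integral>y. F y * \<phi> (x - y) \<partial>lborel)"

lemma conv_integrable:
  assumes F: "integrable lborel F" and \<phi>: "csmooth R \<phi>"
  shows "integrable lborel (\<lambda>y. F y * \<phi> (x - y))"
proof -
  obtain C where C: "C > 0" "\<And>x. \<bar>\<phi> x\<bar> \<le> C" using csmooth_bounded[OF \<phi>] by blast
  have [measurable]: "F \<in> borel_measurable borel" using F by auto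
  note [measurable] = csmooth_borel[OF \<phi>]
  show ?thesis
    by (rule Bochner_Integration.integrable_bound[where f="\<lambda>y. C * F y"])
       (use F C in \<open>auto simp: abs_mult mult.commute[of C] intro!: mult_left_mono\<close>)
qed

text \<open>The derivative falls on the kernel: the integrand is Lipschitz in the point with
  constant |F y| * L, an integrable majorant.\<close>

lemma conv_has_derivative:
  fixes \<phi> :: "real^'n \<Rightarrow> real"
  assumes F: "integrable lborel F" and \<phi>: "csmooth R \<phi>"
  shows "conv F \<phi> differentiable (at x)" "pd i (conv F \<phi>) x = conv F (pd i \<phi>) x"
proof -
  obtain L where L: "L > 0" "\<And>x y. \<bar>\<phi> x - \<phi> y\<bar> \<le> L * norm (x - y)" using csmooth_lipschitz[OF \<phi>] by blast
  have [measurable]: "F \<in> borel_measurable borel" using F by auto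
  note [measurable] = csmooth_borel[OF \<phi>]
  have "continuous_on UNIV (grad \<phi>)"
    unfolding grad_def by (intro continuous_on_vec_lambda csmooth_continuous[OF csmooth_pd[OF \<phi>]])
  then have [measurable]: "grad \<phi> \<in> borel_measurable borel" by (rule borel_measurable_continuous_onI)
  let ?G = "\<lambda>y. F y *\<^sub>R grad \<phi> (x - y)"
  have lip: "AE y in lborel. \<forall>z. \<bar>F y * \<phi> (z - y) - F y * \<phi> (x - y)\<bar> \<le> \<bar>F y\<bar> * L * norm (z - x)"
  proof (intro AE_I2 allI)
    fix y z
    have "\<bar>F y * \<phi> (z - y) - F y * \<phi> (x - y)\<bar> = \<bar>F y\<bar> * \<bar>\<phi> (z - y) - \<phi> (x - y)\<bar>"
      by (simp add: abs_mult[symmetric] algebra_simps)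
    also have "\<dots> \<le> \<bar>F y\<bar> * (L * norm (z - x))"
      using L(2)[of "z - y" "x - y"] by (intro mult_left_mono) auto
    finally show "\<bar>F y * \<phi> (z - y) - F y * \<phi> (x - y)\<bar> \<le> \<bar>F y\<bar> * L * norm (z - x)" by simp
  qed
  have der: "AE y in lborel. ((\<lambda>z. F y * \<phi> (z - y)) has_derivative (\<lambda>h. ?G y \<bullet> h)) (at x)"
  proof (rule AE_I2)
    fix y
    have "((\<lambda>z. z - y) has_derivative (\<lambda>h. h)) (at x)" by (auto intro!: derivative_eq_intros)
    from diff_chain_at[OF this has_derivative_grad[OF csmooth_differentiable[OF \<phi>]]]
    have "((\<lambda>z. \<phi> (z - y)) has_derivative (\<lambda>h. grad \<phi> (x - y) \<bullet> h)) (at x)" by (simp add: o_def)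
    from has_derivative_mult_right[OF this, of "F y"]
    show "((\<lambda>z. F y * \<phi> (z - y)) has_derivative (\<lambda>h. ?G y \<bullet> h)) (at x)" by simp
  qed
  have B: "integrable lborel (\<lambda>y. \<bar>F y\<bar> * L)" using F by simp
  have G: "?G \<in> borel_measurable lborel" by measurable
  have Gi: "integrable lborel ?G"
    by (rule has_derivative_integral_param(1)[OF conv_integrable[OF F \<phi>] G B lip der])
  have D: "(conv F \<phi> has_derivative (\<lambda>h. (\<integral>y. ?G y \<partial>lborel) \<bullet> h)) (at x)"
    unfolding conv_def[abs_def]
    by (rule has_derivative_integral_param(2)[OF conv_integrable[OF F \<phi>] G B lip der])
  then show "conv F \<phi> differentiable (at x)" unfolding differentiable_def by blast
  have "pd i (conv F \<phi>) x = (\<integral>y. ?G y \<partial>lborel) $ i" by (rule has_derivative_inner_pd(1)[OF D])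
  also have "\<dots> = (\<integral>y. ?G y $ i \<partial>lborel)"
    by (rule integral_bounded_linear[OF bounded_linear_vec_nth Gi, symmetric])
  finally show "pd i (conv F \<phi>) x = conv F (pd i \<phi>) x" by (simp add: conv_def grad_def)
qed

lemma pd_conv: "integrable lborel F \<Longrightarrow> csmooth R \<phi> \<Longrightarrow> pd i (conv F \<phi>) = conv F (pd i \<phi>)"
  using conv_has_derivative(2) by blast

lemma smooth_fun_conv:
  fixes \<phi> :: "real^'n \<Rightarrow> real"
  assumes F: "integrable lborel F" and \<phi>: "csmooth R \<phi>"
  shows "smooth_fun (conv F \<phi>)"
proof (rule smooth_fun_coinduct_pd[where X="\<lambda>k. \<exists>\<phi>. csmooth R \<phi> \<and> k = conv F \<phi>"])
  fix k :: "real^'n \<Rightarrow> real" and i assume "\<exists>\<phi>. csmooth R \<phi> \<and> k = conv F \<phi>"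
  then show "\<exists>\<phi>. csmooth R \<phi> \<and> pd i k = conv F \<phi>" using pd_conv[OF F] csmooth_pd by blast
next
  fix k :: "real^'n \<Rightarrow> real" and x assume "\<exists>\<phi>. csmooth R \<phi> \<and> k = conv F \<phi>"
  then show "k differentiable (at x)" using conv_has_derivative(1)[OF F] by blast
qed (use \<phi> in blast)

lemma conv_cong_local:
  assumes \<phi>: "csmooth R \<phi>" "\<And>y. y \<in> cball x R \<Longrightarrow> F y = F' y"
  shows "conv F \<phi> x = conv F' \<phi> x"
proof -
  have "F y * \<phi> (x - y) = F' y * \<phi> (x - y)" for y
    using assms(2)[of y] csmoothD(2)[OF \<phi>(1), of "x - y"] by (cases "y \<in> cball x R") (auto simp: dist_norm)
  then show ?thesis unfolding conv_def by (simp only:)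
qed

lemma csmooth_conv:
  assumes F: "integrable lborel F" "\<And>y. S < norm y \<Longrightarrow> F y = 0" and \<phi>: "csmooth R \<phi>"
  shows "csmooth (S + R) (conv F \<phi>)"
proof -
  have "conv F \<phi> x = 0" if x: "S + R < norm x" for x
  proof -
    have "conv F \<phi> x = conv (\<lambda>_. 0) \<phi> x"
    proof (rule conv_cong_local[OF \<phi>])
      fix y assume "y \<in> cball x R"
      then have "norm (x - y) \<le> R" by (simp add: dist_norm)
      then show "F y = 0" using F(2)[of y] norm_triangle_ineq2[of x y] x by linarith
    qed
    then show ?thesis by (simp add: conv_def)
  qed
  with smooth_fun_conv[OF F(1) \<phi>] show ?thesis by (simp add: csmooth_def)
qed

text \<open>Only the values of \<open>F\<close> in the ball enter. This is what later turns the
  measure of the coincidence set in a ball into a bound for one step of the mollification.\<close>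

lemma conv_bound_local:
  assumes F: "integrable lborel F" and \<phi>: "csmooth R \<phi>" and C: "\<And>x. \<bar>\<phi> x\<bar> \<le> C"
  shows "\<bar>conv F \<phi> x\<bar> \<le> C * (\<integral>y. indicator (cball x R) y * \<bar>F y\<bar> \<partial>lborel)"
proof -
  have "\<bar>conv F \<phi> x\<bar> \<le> (\<integral>y. C * (indicator (cball x R) y * \<bar>F y\<bar>) \<partial>lborel)"
    unfolding conv_def
  proof (rule order_trans[OF integral_abs_bound integral_mono])
    show "integrable lborel (\<lambda>y. C * (indicator (cball x R) y * \<bar>F y\<bar>))"
      using F by (intro integrable_mult_right) (auto intro!: integrable_real_mult_indicator simp: mult.commute)
    fix y show "\<bar>F y * \<phi> (x - y)\<bar> \<le> C * (indicator (cball x R) y * \<bar>F y\<bar>)"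
      using C[of "x - y"] csmoothD(2)[OF \<phi>, of "x - y"]
      by (cases "y \<in> cball x R") (auto simp: abs_mult dist_norm mult.commute[of C] intro!: mult_left_mono)
  qed (use conv_integrable[OF F \<phi>] in simp)
  then show ?thesis by simp
qed

lemma conv_bound_sup:
  assumes F: "integrable lborel F" and \<phi>: "csmooth R \<phi>" and G: "\<And>y. \<bar>F y\<bar> \<le> G"
  shows "\<bar>conv F \<phi> x\<bar> \<le> G * (\<integral>y. \<bar>\<phi> y\<bar> \<partial>lborel)"
proof -
  note [measurable] = csmooth_borel[OF \<phi>]
  have "integrable lborel (\<lambda>y. \<bar>\<phi> y\<bar>)" using csmooth_integrable[OF \<phi>] by simp
  then have i: "integrable lborel (\<lambda>y. \<bar>\<phi> (x - y)\<bar>)"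
    using lborel_integral_translation(3)[of "\<lambda>y. \<bar>\<phi> y\<bar>" x] by simp
  have "\<bar>conv F \<phi> x\<bar> \<le> (\<integral>y. G * \<bar>\<phi> (x - y)\<bar> \<partial>lborel)"
    unfolding conv_def
    by (rule order_trans[OF integral_abs_bound integral_mono])
       (use integrable_abs[OF conv_integrable[OF F \<phi>]] conv_integrable[OF F \<phi>] G i in \<open>auto simp: abs_mult intro!: mult_right_mono\<close>)
  also have "\<dots> = G * (\<integral>y. \<bar>\<phi> y\<bar> \<partial>lborel)"
    using lborel_integral_translation(2)[of "\<lambda>y. \<bar>\<phi> y\<bar>" x] by simp
  finally show ?thesis .
qed

text \<open>Young's inequality, by Tonelli and translation invariance.\<close>

lemma conv_L1_bound:
  assumes F: "integrable lborel F" "integrable lborel (conv F \<phi>)" and \<phi>: "csmooth R \<phi>"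
  shows "(\<integral>x. \<bar>conv F \<phi> x\<bar> \<partial>lborel) \<le> (\<integral>y. \<bar>F y\<bar> \<partial>lborel) * (\<integral>y. \<bar>\<phi> y\<bar> \<partial>lborel)"
proof -
  note [measurable] = csmooth_borel[OF \<phi>]
  have [measurable]: "F \<in> borel_measurable borel" using F by auto
  have i\<phi>: "integrable lborel (\<lambda>y. \<bar>\<phi> y\<bar>)" using csmooth_integrable[OF \<phi>] by simp
  let ?I = "\<integral>y. \<bar>\<phi> y\<bar> \<partial>lborel"
  have "ennreal (\<integral>x. \<bar>conv F \<phi> x\<bar> \<partial>lborel) = (\<integral>\<^sup>+x. ennreal \<bar>conv F \<phi> x\<bar> \<partial>lborel)"
    using F(2) by (intro nn_integral_eq_integral[symmetric]) auto
  also have "\<dots> \<le> (\<integral>\<^sup>+x. (\<integral>\<^sup>+y. ennreal (\<bar>F y\<bar> * \<bar>\<phi> (x - y)\<bar>) \<partial>lborel) \<partial>lborel)"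
  proof (rule nn_integral_mono)
    fix x
    have "\<bar>conv F \<phi> x\<bar> \<le> (\<integral>y. \<bar>F y\<bar> * \<bar>\<phi> (x - y)\<bar> \<partial>lborel)"
      unfolding conv_def abs_mult[symmetric] by (rule integral_abs_bound)
    then have "ennreal \<bar>conv F \<phi> x\<bar> \<le> ennreal (\<integral>y. \<bar>F y\<bar> * \<bar>\<phi> (x - y)\<bar> \<partial>lborel)" by (rule ennreal_leI)
    also have "\<dots> = (\<integral>\<^sup>+y. ennreal (\<bar>F y\<bar> * \<bar>\<phi> (x - y)\<bar>) \<partial>lborel)"
      using conv_integrable[OF F(1) \<phi>, of x] by (intro nn_integral_eq_integral[symmetric]) (auto simp: abs_mult[symmetric])
    finally show "ennreal \<bar>conv F \<phi> x\<bar> \<le> (\<integral>\<^sup>+y. ennreal (\<bar>F y\<bar> * \<bar>\<phi> (x - y)\<bar>) \<partial>lborel)" .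
  qed
  also have "\<dots> = (\<integral>\<^sup>+y. (\<integral>\<^sup>+x. ennreal (\<bar>F y\<bar> * \<bar>\<phi> (x - y)\<bar>) \<partial>lborel) \<partial>lborel)"
    by (rule lborel_pair.Fubini') measurable
  also have "\<dots> = (\<integral>\<^sup>+y. ennreal (\<bar>F y\<bar> * ?I) \<partial>lborel)"
  proof (rule nn_integral_cong)
    fix y
    have i: "integrable lborel (\<lambda>x. \<bar>\<phi> (x - y)\<bar>)"
      using lborel_integral_translation(4)[of "\<lambda>y. \<bar>\<phi> y\<bar>" "-y"] i\<phi> by simp
    have "(\<integral>\<^sup>+x. ennreal (\<bar>F y\<bar> * \<bar>\<phi> (x - y)\<bar>) \<partial>lborel) = ennreal (\<integral>x. \<bar>F y\<bar> * \<bar>\<phi> (x - y)\<bar> \<partial>lborel)"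
      using i by (intro nn_integral_eq_integral) auto
    also have "(\<integral>x. \<bar>F y\<bar> * \<bar>\<phi> (x - y)\<bar> \<partial>lborel) = \<bar>F y\<bar> * ?I"
      using lborel_integral_translation(1)[of "\<lambda>y. \<bar>\<phi> y\<bar>" "-y"] by simp
    finally show "(\<integral>\<^sup>+x. ennreal (\<bar>F y\<bar> * \<bar>\<phi> (x - y)\<bar>) \<partial>lborel) = ennreal (\<bar>F y\<bar> * ?I)" .
  qed
  also have "\<dots> = ennreal (\<integral>y. \<bar>F y\<bar> * ?I \<partial>lborel)"
    using F(1) by (intro nn_integral_eq_integral) (auto intro!: mult_nonneg_nonneg)
  finally have "(\<integral>x. \<bar>conv F \<phi> x\<bar> \<partial>lborel) \<le> (\<integral>y. \<bar>F y\<bar> * ?I \<partial>lborel)"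
    by (subst (asm) ennreal_le_iff) (auto intro!: integral_nonneg_AE)
  then show ?thesis by simp
qed

lemma conv_add:
  assumes "integrable lborel F" "csmooth R \<phi>" "csmooth R' \<psi>"
  shows "conv F (\<lambda>x. \<phi> x + \<psi> x) x = conv F \<phi> x + conv F \<psi> x"
  using conv_integrable[OF assms(1,2)] conv_integrable[OF assms(1,3)] by (simp add: conv_def distrib_left)

lemma conv_cmult: "conv F (\<lambda>x. c * \<phi> x) x = c * conv F \<phi> x"
  by (simp add: conv_def mult.left_commute)

lemma conv_sum:
  assumes "integrable lborel F" "\<And>l. l \<in> I \<Longrightarrow> csmooth R (\<phi> l)"
  shows "conv F (\<lambda>x. \<Sum>l\<in>I. \<phi> l x) x = (\<Sum>l\<in>I. conv F (\<phi> l) x)"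
  using conv_integrable[OF assms(1) assms(2)] by (simp add: conv_def sum_distrib_left)

lemma lap_conv:
  assumes "integrable lborel F" "csmooth R \<phi>"
  shows "lap (conv F \<phi>) x = conv F (lap \<phi>) x"
proof -
  have "conv F (lap \<phi>) x = (\<Sum>i\<in>UNIV. conv F (pd i (pd i \<phi>)) x)"
    unfolding lap_def by (rule conv_sum[where R=R, OF assms(1)]) (intro csmooth_pd assms)
  moreover have "pd i (pd i (conv F \<phi>)) = conv F (pd i (pd i \<phi>))" for i
    using pd_conv[OF assms] pd_conv[OF assms(1) csmooth_pd[OF assms(2)]] by metis
  ultimately show ?thesis by (simp add: lap_def)
qed

lemma csmooth_lap: "csmooth R \<phi> \<Longrightarrow> csmooth R (lap \<phi>)"
  unfolding lap_def by (intro csmooth_sum csmooth_pd)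

subsection \<open>The mollifier\<close>

lemma bump_alg_quadratic:
  assumes "continuous_on {1/4..1} q"
  shows "bump_alg (\<lambda>t (x::real^'n). bump k (1 - (x \<bullet> x) * q t))"
  unfolding inner_vec_def inner_real_def sum_distrib_right
  by (intro bump_alg.bump bump_alg_diff bump_alg_const bump_alg_sum bump_alg.mult bump_alg.coord bump_alg.param assms)

lemma bump_quadratic_pd:
  fixes x :: "real^'n" and p q :: real
  defines "s \<equiv> \<lambda>x::real^'n. 1 - (x \<bullet> x) * q"
  shows "pd i (\<lambda>x. p * bump k (s x)) x = - 2 * p * q * (bump (k + 2) (s x) - k * bump (k + 1) (s x)) * x $ i"
    and "pd i (\<lambda>x. p * bump k (s x) * x $ i) x
      = - 2 * p * q * (bump (k + 2) (s x) - k * bump (k + 1) (s x)) * (x $ i)\<^sup>2 + p * bump k (s x)"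
proof -
  let ?b = "bump (k + 2) (s x) - k * bump (k + 1) (s x)"
  have "(s has_derivative (\<lambda>h. - (2 * q * (x \<bullet> h)))) (at x)"
    unfolding s_def by (auto intro!: derivative_eq_intros simp: inner_commute algebra_simps)
  from diff_chain_at[OF this bump_has_derivative[of k "s x", unfolded has_field_derivative_def]]
  have "((\<lambda>x. bump k (s x)) has_derivative (\<lambda>h. ?b * - (2 * q * (x \<bullet> h)))) (at x)"
    by (simp add: o_def)
  from has_derivative_mult_right[OF this, of p]
  have D: "((\<lambda>x. p * bump k (s x)) has_derivative (\<lambda>h. p * (?b * - (2 * q * (x \<bullet> h))))) (at x)" .
  from pd_eqI[OF this, of i]
  show "pd i (\<lambda>x. p * bump k (s x)) x = - 2 * p * q * ?b * x $ i"
    by (simp add: inner_axis_one algebra_simps)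
  have "((\<lambda>x. x $ i) has_derivative (\<lambda>h. h $ i)) (at x)"
    by (intro bounded_linear_imp_has_derivative bounded_linear_vec_nth)
  from pd_eqI[OF has_derivative_mult[OF D this], of i]
  show "pd i (\<lambda>x. p * bump k (s x) * x $ i) x = - 2 * p * q * ?b * (x $ i)\<^sup>2 + p * bump k (s x)"
    by (simp add: inner_axis_one algebra_simps power2_eq_square)
qed

text \<open>With \<open>\<zeta> = bump 0 (1 - |x|\<^sup>2)\<close> one has \<open>x \<eta> = - \<nabla>\<zeta>\<close>, hence \<open>\<partial>\<^sub>t(t\<^sup>-\<^sup>n \<eta>(x/t)) = \<Delta>(t\<^bsup>1-n\<^esup> \<zeta>(x/t))\<close>; the potential
  \<open>\<psi>\<close> is the integral of \<open>t\<^bsup>1-n\<^esup> \<zeta>(x/t)\<close> over the scales between 1/4 and 1.\<close>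

lemma mollifier_unnormalized:
  defines "\<eta> \<equiv> \<lambda>x::real^'n. 2 * bump 2 (1 - x \<bullet> x)"
  obtains \<psi> where "csmooth 1 \<psi>" "\<And>x. lap \<psi> x = \<eta> x - 4 ^ CARD('n) * \<eta> (4 *\<^sub>R x)"
proof -
  \<comment> \<open>This is t^(1-n) \<zeta>(x/t), written with \<open>inverse t\<close> so that its
    coefficients are continuous in the parameter on 1/4..1.\<close>
  define f where "f = (\<lambda>t (x::real^'n). (t * inverse t ^ CARD('n)) * bump 0 (1 - (x \<bullet> x) * (inverse t)\<^sup>2))"
  have "bump_alg f" unfolding f_def
    by (intro bump_alg.mult bump_alg.param bump_alg_quadratic continuous_intros) auto
  define \<psi> where "\<psi> = (\<lambda>x. integral {1/4..1} (\<lambda>t. f t x))"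
  show ?thesis
  proof (rule that[of \<psi>])
    have "\<psi> x = 0" if "1 < norm x" for x
    proof -
      have "f t x = 0" if t: "t \<in> {1/4..1}" for t
      proof -
        have "1 \<le> inverse t" using t by (simp add: one_le_inverse_iff)
        then have "1 * 1 \<le> (x \<bullet> x) * (inverse t)\<^sup>2"
          using \<open>1 < norm x\<close> by (intro mult_mono) (auto simp: power2_norm_eq_inner[symmetric])
        then show ?thesis by (simp add: f_def bump_def)
      qed
      then have "integral {1/4..1} (\<lambda>t. f t x) = integral {1/4..1::real} (\<lambda>t. 0)" by (intro integral_cong) auto
      then show ?thesis by (simp add: \<psi>_def)
    qed
    then show "csmooth 1 \<psi>"
      using smooth_fun_integral_bump_alg[OF \<open>bump_alg f\<close>] by (simp add: csmooth_def \<psi>_def)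
    fix x
    note d1 = bump_alg_integral_derivative[OF \<open>bump_alg f\<close>]
    have "lap \<psi> x = (\<Sum>i\<in>UNIV. integral {1/4..1} (\<lambda>t. pd i (pd i (f t)) x))"
      unfolding lap_def
    proof (rule sum.cong[OF refl])
      fix i
      have "pd i \<psi> = (\<lambda>x. integral {1/4..1} (\<lambda>t. pd i (f t) x))"
        unfolding \<psi>_def using d1(2) by blast
      then show "pd i (pd i \<psi>) x = integral {1/4..1} (\<lambda>t. pd i (pd i (f t)) x)"
        using bump_alg_integral_derivative(2)[OF d1(3)[of i]] by simp
    qed
    also have "\<dots> = integral {1/4..1} (\<lambda>t. lap (f t) x)"
      unfolding lap_def
      by (rule integral_sum[symmetric])
         (auto intro: bump_alg_integral_derivative(4)[OF d1(3)[THEN bump_alg_integral_derivative(3)]])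
    also have "\<dots> = \<eta> x - 4 ^ CARD('n) * \<eta> (4 *\<^sub>R x)"
    proof -
      \<comment> \<open>\<open>E t\<close> is t^(-n) \<eta>(x/t) at the fixed point x. It is an
        antiderivative in t of the Laplacian of \<open>f t\<close>, so the integral is the
        difference of its values at 1 and 1/4.\<close>
      define E where "E t = inverse t ^ CARD('n) * (2 * bump 2 (1 - (x \<bullet> x) * (inverse t)\<^sup>2))" for t
      have "((\<lambda>t. lap (f t) x) has_integral (E 1 - E (1/4))) {1/4..1}"
      proof (rule fundamental_theorem_of_calculus)
        fix t :: real assume t: "t \<in> {1/4..1}"
        then have t0: "t > 0" by simp
        define r where "r = inverse t"
        have tr: "t * r = 1" using t0 by (simp add: r_def)
        let ?s = "1 - (x \<bullet> x) * r\<^sup>2"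
        let ?b = "bump 4 ?s - 2 * bump 3 ?s"
        have pdi: "pd i (f t) = (\<lambda>x. (- 2 * (t * r ^ CARD('n)) * r\<^sup>2) * bump 2 (1 - (x \<bullet> x) * r\<^sup>2) * x $ i)" for i
        proof
          fix y
          have "(0::nat) + 2 = 2" by simp
          then show "pd i (f t) y = (- 2 * (t * r ^ CARD('n)) * r\<^sup>2) * bump 2 (1 - (y \<bullet> y) * r\<^sup>2) * y $ i"
            using bump_quadratic_pd(1)[where k=0 and p="t * r ^ CARD('n)" and q="r\<^sup>2" and i=i and x=y]
            unfolding f_def r_def by (simp only: of_nat_0 mult_zero_left diff_zero)
        qed
        have pp: "pd i (pd i (f t)) x = 4 * (t * r) * r ^ CARD('n) * r * r\<^sup>2 * ?b * (x $ i)\<^sup>2 - 2 * (t * r) * r * r ^ CARD('n) * bump 2 ?s" for i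
        proof -
          have "(2::nat) + 2 = 4" "(2::nat) + 1 = 3" by simp_all
          then have e: "pd i (\<lambda>x. (- 2 * (t * r ^ CARD('n)) * r\<^sup>2) * bump 2 (1 - (x \<bullet> x) * r\<^sup>2) * x $ i) x
            = - 2 * (- 2 * (t * r ^ CARD('n)) * r\<^sup>2) * r\<^sup>2 * ?b * (x $ i)\<^sup>2 + (- 2 * (t * r ^ CARD('n)) * r\<^sup>2) * bump 2 ?s"
            using bump_quadratic_pd(2)[where k=2 and q="r\<^sup>2" and x=x and i=i and p="- 2 * (t * r ^ CARD('n)) * r\<^sup>2"]
            by (simp only: of_nat_numeral)
          show ?thesis unfolding pdi e by (simp add: algebra_simps power2_eq_square)
        qed
        have "lap (f t) x = 4 * r ^ CARD('n) * r * r\<^sup>2 * ?b * (x \<bullet> x) - 2 * CARD('n) * r * r ^ CARD('n) * bump 2 ?s"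
          unfolding lap_def pp tr by (simp add: sum_subtractf sum_distrib_left[symmetric] inner_vec_def power2_eq_square)
        moreover have "(E has_real_derivative (4 * r ^ CARD('n) * r * r\<^sup>2 * ?b * (x \<bullet> x) - 2 * CARD('n) * r * r ^ CARD('n) * bump 2 ?s)) (at t)"
        proof -
          have dr: "(inverse has_real_derivative - (r\<^sup>2)) (at t)"
            using DERIV_inverse[of t] t0 by (simp add: r_def power2_eq_square)
          have ds: "((\<lambda>t. 1 - (x \<bullet> x) * (inverse t)\<^sup>2) has_real_derivative 2 * (x \<bullet> x) * r * r\<^sup>2) (at t)"
            by (rule derivative_eq_intros dr refl | simp add: r_def[symmetric])+
          have db: "((\<lambda>t. bump 2 (1 - (x \<bullet> x) * (inverse t)\<^sup>2)) has_real_derivative ?b * (2 * (x \<bullet> x) * r * r\<^sup>2)) (at t)"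
            using DERIV_chain2[OF bump_has_derivative[of 2] ds] by (simp add: r_def)
          have dn: "((\<lambda>t. inverse t ^ CARD('n)) has_real_derivative - (CARD('n) * r * r ^ CARD('n))) (at t)"
          proof -
            have "r ^ CARD('n) = r * r ^ (CARD('n) - 1)"
              by (metis power_eq_if zero_less_card_finite less_numeral_extra(3))
            with DERIV_power[OF dr, of "CARD('n)"] show ?thesis
              by (simp add: r_def[symmetric] power2_eq_square algebra_simps)
          qed
          show ?thesis unfolding E_def
            using DERIV_mult[OF dn DERIV_cmult[OF db, of 2]]
            by (rule DERIV_cong) (simp add: r_def[symmetric] algebra_simps)
        qed
        ultimately show "(E has_vector_derivative lap (f t) x) (at t within {1/4..1})"
          by (metis has_real_derivative_iff_has_vector_derivative has_vector_derivative_at_within)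
      qed simp
      then have "integral {1/4..1} (\<lambda>t. lap (f t) x) = E 1 - E (1/4)" by (rule integral_unique)
      then show ?thesis by (simp add: E_def \<eta>_def power2_eq_square mult.commute)
    qed
    finally show "lap \<psi> x = \<eta> x - 4 ^ CARD('n) * \<eta> (4 *\<^sub>R x)" .
  qed
qed

text \<open>Dividing both functions by the mass of the unnormalised kernel preserves the linear
  relation between them. The mass is positive because the kernel is positive on the open unit
  ball.\<close>

lemma mollifier_exists:
  obtains \<eta> \<psi> :: "real^'n \<Rightarrow> real" where "csmooth 1 \<eta>" "csmooth 1 \<psi>" "\<And>x. \<eta> x \<ge> 0" "(\<integral>x. \<eta> x \<partial>lborel) = 1"
    "\<And>x. lap \<psi> x = \<eta> x - 4 ^ CARD('n) * \<eta> (4 *\<^sub>R x)"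
proof -
  define \<eta> where "\<eta> = (\<lambda>x::real^'n. 2 * bump 2 (1 - x \<bullet> x))"
  obtain \<psi> where \<psi>: "csmooth 1 \<psi>" "\<And>x. lap \<psi> x = \<eta> x - 4 ^ CARD('n) * \<eta> (4 *\<^sub>R x)"
    using mollifier_unnormalized unfolding \<eta>_def by blast
  have nn: "\<eta> x \<ge> 0" for x by (simp add: \<eta>_def bump_nonneg)
  have "smooth_fun \<eta>"
    using smooth_fun_cmult[OF smooth_fun_bump_alg[OF bump_alg_quadratic[of "\<lambda>_. 1" 2]], of 2]
    by (simp add: \<eta>_def)
  moreover have "\<eta> x = 0" if "1 < norm x" for x
  proof -
    have "1 < norm x ^ 2" using that by (simp add: one_less_power)
    then show ?thesis by (simp add: \<eta>_def bump_def power2_norm_eq_inner)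
  qed
  ultimately have \<eta>: "csmooth 1 \<eta>" by (simp add: csmooth_def)
  define c where "c = (\<integral>x. \<eta> x \<partial>lborel)"
  have "c > 0"
  proof (rule ccontr)
    assume "\<not> c > 0"
    then have "c = 0" using nn by (simp add: c_def order.antisym not_less)
    then have ae: "AE x in lborel. \<eta> x = 0"
      using integral_nonneg_eq_0_iff_AE[OF csmooth_integrable[OF \<eta>]] nn by (simp add: c_def)
    have "ball 0 1 \<subseteq> {x. \<eta> x \<noteq> 0}"
    proof
      fix x :: "real^'n" assume "x \<in> ball 0 1"
      then have "norm x ^ 2 < 1" by (simp add: power_less_one_iff)
      then show "x \<in> {x. \<eta> x \<noteq> 0}" by (simp add: \<eta>_def bump_def power2_norm_eq_inner)
    qed
    moreover have "{x. \<eta> x \<noteq> 0} \<in> null_sets lborel"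
      using ae csmooth_borel[OF \<eta>] by (subst (asm) AE_iff_null) auto
    ultimately have "ball 0 1 \<in> null_sets (lborel :: (real^'n) measure)"
      using null_sets_subset by (metis open_ball borel_open sets_lborel)
    then have "emeasure lborel (ball (0::real^'n) 1) = 0" by auto
    then show False
      using content_ball_pos[of 1 "0::real^'n"] by (simp add: measure_def)
  qed
  show ?thesis
  proof (rule that[of "\<lambda>x. (1 / c) * \<eta> x" "\<lambda>x. (1 / c) * \<psi> x"])
    show "(\<integral>x. 1 / c * \<eta> x \<partial>lborel) = 1" using \<open>c > 0\<close> by (simp add: c_def)
    fix x
    have "pd i (pd i (\<lambda>x. 1 / c * \<psi> x)) x = 1 / c * pd i (pd i \<psi>) x" for i
    proof -
      have "pd i (\<lambda>x. 1 / c * \<psi> x) = (\<lambda>x. 1 / c * pd i \<psi> x)"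
        by (intro ext pd_cmult csmooth_differentiable[OF \<psi>(1)])
      then show ?thesis using pd_cmult[OF csmooth_differentiable[OF csmooth_pd[OF \<psi>(1)]], where c="1/c"] by metis
    qed
    then have "lap (\<lambda>x. 1 / c * \<psi> x) x = 1 / c * lap \<psi> x" by (simp only: lap_def sum_distrib_left)
    then show "lap (\<lambda>x. 1 / c * \<psi> x) x = 1 / c * \<eta> x - 4 ^ CARD('n) * (1 / c * \<eta> (4 *\<^sub>R x))"
      by (simp add: \<psi>(2) algebra_simps)
  qed (use csmooth_cmult[OF \<eta>, of "1/c"] csmooth_cmult[OF \<psi>(1), of "1/c"] nn \<open>c > 0\<close> in auto)
qed

subsection \<open>The fundamental lemma of the calculus of variations\<close>

lemma AE_lborel_not_in_negligible: "negligible N \<Longrightarrow> AE x in lborel. x \<notin> N"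
  unfolding negligible_iff_null_sets null_sets_completion_iff2
  by (auto intro: AE_I' )

text \<open>Lebesgue differentiation: for almost every x the averages over small cubes with corner x
  tend to \<open>F x\<close>, and for cubes inside \<open>U\<close> they are nonpositive.\<close>

lemma AE_le_0_if_box_integrals_le_0:
  fixes F :: "'a::euclidean_space \<Rightarrow> real"
  assumes F: "integrable lborel F" and U: "open U"
    and box: "\<And>a b. cbox a b \<subseteq> U \<Longrightarrow> (\<integral>x. indicator (box a b) x * F x \<partial>lborel) \<le> 0"
  shows "AE x in lborel. x \<in> U \<longrightarrow> F x \<le> 0"
proof -
  have si: "set_integrable lborel S F" if "S \<in> sets borel" for S
    unfolding set_integrable_def using integrable_mult_indicator[OF _ F] that by simp
  have "F integrable_on cbox a b" for a b
    by (rule set_borel_integral_eq_integral(1)[OF si]) simp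
  from integrable_ccontinuous_explicit[OF this] obtain N where N: "negligible N"
    "\<And>x e. x \<notin> N \<Longrightarrow> 0 < e \<Longrightarrow> \<exists>d>0. \<forall>h. 0 < h \<and> h < d \<longrightarrow>
       norm (integral (cbox x (x + h *\<^sub>R One)) F /\<^sub>R h ^ DIM('a) - F x) < e" by metis
  have main: "F x \<le> 0" if x: "x \<notin> N" "x \<in> U" for x
  proof (rule ccontr)
    assume "\<not> F x \<le> 0"
    then obtain d where d: "d > 0" "\<And>h. 0 < h \<Longrightarrow> h < d \<Longrightarrow>
       norm (integral (cbox x (x + h *\<^sub>R One)) F /\<^sub>R h ^ DIM('a) - F x) < F x"
      using N(2)[OF x(1), of "F x"] by auto
    obtain r where r: "r > 0" "ball x r \<subseteq> U" using U x(2) openE by blast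
    \<comment> \<open>The first bound makes the average close to \<open>F x\<close>; the second
      keeps the cube inside \<open>ball x r\<close>, since its points have l1-distance at most h *
      DIM from x.\<close>
    define h where "h = min (d / 2) (r / (2 * DIM('a)))"
    have h: "0 < h" "h < d" "h * DIM('a) < r"
    proof -
      have "h * DIM('a) \<le> (r / (2 * DIM('a))) * DIM('a)" unfolding h_def by (intro mult_right_mono) auto
      also have "\<dots> < r" using r by simp
      finally show "h * DIM('a) < r" .
    qed (use d r in \<open>auto simp: h_def\<close>)
    have "cbox x (x + h *\<^sub>R One) \<subseteq> U"
    proof
      fix y assume y: "y \<in> cbox x (x + h *\<^sub>R One)"
      have "norm (y - x) \<le> (\<Sum>i\<in>Basis. \<bar>(y - x) \<bullet> i\<bar>)" by (rule norm_le_l1)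
      also have "\<dots> \<le> (\<Sum>i\<in>(Basis::'a set). h)"
        using y by (intro sum_mono) (auto simp: mem_box inner_diff_left inner_add_left abs_le_iff)
      also have "\<dots> < r" using h(3) by (simp add: mult.commute)
      finally show "y \<in> U" using r(2) by (auto simp: dist_norm norm_minus_commute)
    qed
    from box[OF this] have "integral (cbox x (x + h *\<^sub>R One)) F \<le> 0"
      using set_borel_integral_eq_integral(2)[OF si[of "box x (x + h *\<^sub>R One)"]]
      by (simp add: set_lebesgue_integral_def integral_open_interval)
    then have "integral (cbox x (x + h *\<^sub>R One)) F /\<^sub>R h ^ DIM('a) \<le> 0"
      using h(1) by (simp add: divide_simps mult_le_0_iff)
    then show False using d(2)[OF h(1,2)] by simp
  qed
  show ?thesis using AE_lborel_not_in_negligible[OF N(1)] by eventually_elim (use main in blast)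
qed

lemma test_fun_csmooth:
  assumes "test_fun U \<phi>" obtains R where "csmooth R \<phi>"
proof -
  have "bounded (closure {x. \<phi> x \<noteq> 0})" using assms compact_imp_bounded by (auto simp: test_fun_def)
  then obtain R where "\<And>x. x \<in> closure {x. \<phi> x \<noteq> 0} \<Longrightarrow> norm x \<le> R" unfolding bounded_iff by auto
  then have "csmooth R \<phi>"
    using assms closure_subset[of "{x. \<phi> x \<noteq> 0}"] by (force simp: csmooth_def test_fun_def)
  then show ?thesis using that by blast
qed

text \<open>The indicator of an open box is the bounded pointwise limit of test functions supported
  in the closed box, so dominated convergence reduces the claim to boxes.\<close>

lemma AE_le_0_if_test_integrals_le_0:
  fixes F :: "real^'n \<Rightarrow> real"
  assumes F: "integrable lborel F" and U: "open U"
    and test: "\<And>\<phi>. test_fun U \<phi> \<Longrightarrow> (\<And>x. 0 \<le> \<phi> x) \<Longrightarrow> (\<integral>x. F x * \<phi> x \<partial>lborel) \<le> 0"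
  shows "AE x in lborel. x \<in> U \<longrightarrow> F x \<le> 0"
proof (rule AE_le_0_if_box_integrals_le_0[OF F U])
  fix a b :: "real^'n" assume cb: "cbox a b \<subseteq> U"
  have [measurable]: "F \<in> borel_measurable borel" using F by auto
  show "(\<integral>x. indicator (box a b) x * F x \<partial>lborel) \<le> 0"
  proof (cases "box a b = {}")
    case False
    then have ab: "a $ i < b $ i" for i by (simp add: interval_ne_empty_cart)
    \<comment> \<open>Each factor is positive exactly where x lies strictly between a and b in that
      coordinate; the factor \<open>Suc k\<close> in the argument drives exp(-1/s) to 1
      there.\<close>
    define \<phi> where "\<phi> k x = (\<Prod>i\<in>UNIV. bump 0 (real (Suc k) * ((x $ i - a $ i) * (b $ i - x $ i))))" for k x
    have alg: "bump_alg (\<lambda>t. \<phi> k)" for k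
      unfolding \<phi>_def[abs_def]
      by (intro bump_alg_prod bump_alg.bump bump_alg.mult bump_alg_const bump_alg_diff bump_alg.coord)
    have sm: "smooth_fun (\<phi> k)" for k using smooth_fun_bump_alg[OF alg] .
    have [measurable]: "\<phi> k \<in> borel_measurable borel" for k
      using smooth_fun_continuous[OF sm] by (rule borel_measurable_continuous_onI)
    have b01: "bump 0 s \<le> 1" for s by (simp add: bump_def)
    have nn: "0 \<le> \<phi> k x" for k x by (simp add: \<phi>_def prod_nonneg bump_nonneg)
    have le1: "\<phi> k x \<le> 1" for k x by (auto simp: \<phi>_def bump_nonneg b01 intro!: prod_le_1)
    have out: "\<phi> k x = 0" if "x \<notin> box a b" for k x
    proof -
      have "\<exists>i. \<not> (a $ i < x $ i \<and> x $ i < b $ i)" using that by (auto simp: mem_box_cart)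
      then obtain i where "\<not> (a $ i < x $ i \<and> x $ i < b $ i)" by blast
      then have "(x $ i - a $ i) * (b $ i - x $ i) \<le> 0"
        using ab[of i] by (auto simp: mult_le_0_iff)
      then have "real (Suc k) * ((x $ i - a $ i) * (b $ i - x $ i)) \<le> 0"
        by (meson mult_nonneg_nonpos of_nat_0_le_iff)
      then have "bump 0 (real (Suc k) * ((x $ i - a $ i) * (b $ i - x $ i))) = 0" by (simp add: bump_def)
      then show ?thesis unfolding \<phi>_def by (intro prod_zero) auto
    qed
    have lim: "(\<lambda>k. \<phi> k x) \<longlonglongrightarrow> indicator (box a b) x" for x
    proof (cases "x \<in> box a b")
      case True
      have "(\<lambda>k. bump 0 (real (Suc k) * s)) \<longlonglongrightarrow> 1" if "s > 0" for s
      proof -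
        have "(\<lambda>k. exp (- (inverse (real (Suc k)) * (1 / s)))) \<longlonglongrightarrow> exp (- (0 * (1 / s)))"
          by (intro tendsto_intros LIMSEQ_inverse_real_of_nat)
        moreover have "bump 0 (real (Suc k) * s) = exp (- (inverse (real (Suc k)) * (1 / s)))" for k
          using that by (simp add: bump_def divide_simps del: of_nat_Suc)
        ultimately show ?thesis by simp
      qed
      then have "(\<lambda>k. \<phi> k x) \<longlonglongrightarrow> (\<Prod>i\<in>(UNIV::'n set). 1)"
        unfolding \<phi>_def by (rule tendsto_prod) (use True in \<open>auto simp: mem_box_cart\<close>)
      then show ?thesis using True by simp
    qed (simp add: out)
    have tf: "test_fun U (\<phi> k)" for k
    proof -
      have sub: "closure {x. \<phi> k x \<noteq> 0} \<subseteq> cbox a b"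
        by (rule closure_minimal) (use out[of _ k] box_subset_cbox[of a b] in auto)
      then have "compact (closure {x. \<phi> k x \<noteq> 0})"
        by (meson bounded_cbox bounded_subset closed_closure compact_eq_bounded_closed)
      with sub cb sm show ?thesis by (auto simp: test_fun_def)
    qed
    have "(\<lambda>k. \<integral>x. F x * \<phi> k x \<partial>lborel) \<longlonglongrightarrow> (\<integral>x. indicator (box a b) x * F x \<partial>lborel)"
    proof (rule integral_dominated_convergence[where w="\<lambda>x. \<bar>F x\<bar>"])
      show "AE x in lborel. (\<lambda>k. F x * \<phi> k x) \<longlonglongrightarrow> indicator (box a b) x * F x"
        using tendsto_mult_left[OF lim] by (simp add: mult.commute)
      show "AE x in lborel. norm (F x * \<phi> k x) \<le> \<bar>F x\<bar>" for k
        using nn le1 by (auto simp: abs_mult intro!: mult_left_le)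
    qed (use F in auto)
    then show ?thesis
      by (rule LIMSEQ_le_const2) (use test[OF tf nn] in auto)
  qed simp
qed

subsection \<open>Rademacher's theorem\<close>

text \<open>A bi-Lipschitz perturbation of the identity pulls Lebesgue measure back to an absolutely continuous
  measure, whose Radon-Nikodym density is the derivative.\<close>

lemma lipschitz_real_AE_right_derivative:
  fixes F :: "real \<Rightarrow> real"
  assumes F: "\<And>x y. \<bar>F x - F y\<bar> \<le> L * \<bar>x - y\<bar>"
  shows "AE t in lborel. convergent (\<lambda>n. real (Suc n) * (F (t + inverse (Suc n)) - F t))"
proof -
  \<comment> \<open>Adding (L + 1) x makes the increments at least those of the identity, so
    \<open>G\<close> is an increasing bijection; it stays Lipschitz and has convergent quotients
    wherever \<open>F\<close> has.\<close>
  define G where "G x = F x + (L + 1) * x" for x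
  have Gmono: "y - x \<le> G y - G x" if "x \<le> y" for x y
    using F[of y x] that by (simp add: G_def algebra_simps abs_le_iff)
  have Gstrict: "G x < G y \<longleftrightarrow> x < y" for x y
    using Gmono[of x y] Gmono[of y x] by (cases "x < y") auto
  then have Gle: "G x \<le> G y \<longleftrightarrow> x \<le> y" for x y by (metis not_less)
  have Gcont: "continuous_on S G" for S
  proof -
    have "F x - F y \<le> \<bar>L\<bar> * \<bar>x - y\<bar>" for x y
      using F[of x y] mult_right_mono[OF abs_ge_self[of L], of "\<bar>x - y\<bar>"] by linarith
    then have "\<bar>L\<bar>-lipschitz_on S F"
      by (intro lipschitz_onI) (auto simp: dist_real_def abs_le_iff, metis abs_minus_commute)
    then show ?thesis unfolding G_def
      by (intro continuous_intros lipschitz_on_continuous_on)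
  qed
  have "surj G"
    unfolding surj_def
  proof
    fix y
    define b where "b = \<bar>y - G 0\<bar>"
    have "G (- b) \<le> y" "y \<le> G b" using Gmono[of "-b" 0] Gmono[of 0 b] by (auto simp: b_def)
    then obtain x where "G x = y" using IVT'[of G "-b" y b] Gcont by (auto simp: b_def)
    then show "\<exists>x. y = G x" by blast
  qed
  have "inj G" by (rule injI) (metis Gle order_antisym order_refl)
  define H where "H = inv G"
  have GH: "G (H y) = y" for y using \<open>surj G\<close> by (simp add: H_def surj_f_inv_f)
  have HG: "H (G x) = x" for x using \<open>inj G\<close> by (simp add: H_def)
  have vim: "H -` A = G ` A" for A by (auto simp: HG) (metis GH image_eqI)
  have "mono H" by (rule monoI) (metis GH Gle)
  then have [measurable]: "H \<in> borel_measurable borel" by (rule borel_measurable_mono)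
  \<comment> \<open>\<open>\<mu> A\<close> is the Lebesgue measure of the image of \<open>A\<close>
    under \<open>G\<close>. Absolute continuity thus says that \<open>G\<close> maps null sets to
    null sets, as Lipschitz maps do.\<close>
  define \<mu> where "\<mu> = distr lborel borel H"
  have "absolutely_continuous lborel \<mu>"
    unfolding absolutely_continuous_def
  proof
    fix A assume A: "A \<in> null_sets (lborel::real measure)"
    then have "negligible A"
      by (simp add: negligible_iff_null_sets null_sets_completionI)
    moreover have "\<exists>T B. open T \<and> x \<in> T \<and> (\<forall>y\<in>A \<inter> T. norm (G y - G x) \<le> B * norm (y - x))" if "x \<in> A" for x
    proof (intro exI[of _ UNIV] exI[of _ "L + \<bar>L + 1\<bar>"] conjI ballI)
      fix y
      have "\<bar>G y - G x\<bar> \<le> \<bar>F y - F x\<bar> + \<bar>L + 1\<bar> * \<bar>y - x\<bar>"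
        unfolding abs_mult[symmetric] by (simp add: G_def algebra_simps)
      then show "norm (G y - G x) \<le> (L + \<bar>L + 1\<bar>) * norm (y - x)"
        using F[of y x] by (simp add: algebra_simps)
    qed auto
    ultimately have "negligible (G ` A)" by (intro negligible_locally_Lipschitz_image) auto
    moreover have "A \<in> sets borel" using A by auto
    then have "H -` A \<in> sets lborel" using measurable_sets[of H lborel borel A] by simp
    ultimately have "H -` A \<in> null_sets lborel"
      by (simp add: vim[symmetric] negligible_iff_null_sets null_sets_completion_iff)
    then show "A \<in> null_sets \<mu>"
      using A by (auto simp: \<mu>_def null_sets_def emeasure_distr)
  qed
  then obtain f where f [measurable]: "f \<in> borel_measurable lborel" and df: "density lborel f = \<mu>"
    using sigma_finite_measure.Radon_Nikodym[OF sigma_finite_lborel, of \<mu>] by (auto simp: \<mu>_def)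
  define g where "g = (\<lambda>x. enn2real (f x))"
  have [measurable]: "g \<in> borel_measurable borel" unfolding g_def by simp
  have hb: "has_bochner_integral lborel (\<lambda>x. indicator {a..b} x * g x) (G b - G a)" if "a \<le> b" for a b
  proof (rule has_bochner_integral_nn_integral)
    have "(\<integral>\<^sup>+x. f x * indicator {a..b} x \<partial>lborel) = emeasure \<mu> {a..b}"
      unfolding df[symmetric] by (subst emeasure_density) auto
    also have "\<dots> = emeasure lborel (H -` {a..b})" by (simp add: \<mu>_def emeasure_distr)
    also have "H -` {a..b} = {G a..G b}"
      by (auto simp: ) (metis GH Gle)+
    also have "emeasure lborel {G a..G b} = ennreal (G b - G a)" using Gle that by simp
    finally have I: "(\<integral>\<^sup>+x. f x * indicator {a..b} x \<partial>lborel) = ennreal (G b - G a)" .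
    then have "AE x in lborel. f x * indicator {a..b} x \<noteq> \<infinity>"
      by (intro nn_integral_noteq_infinite) auto
    then have "AE x in lborel. ennreal (indicator {a..b} x * g x) = f x * indicator {a..b} x"
    proof eventually_elim
      case (elim x)
      then show ?case by (cases "x \<in> {a..b}") (auto simp: g_def less_top)
    qed
    then show "(\<integral>\<^sup>+x. ennreal (indicator {a..b} x * g x) \<partial>lborel) = ennreal (G b - G a)"
      using I nn_integral_cong_AE by metis
    show "AE x in lborel. 0 \<le> indicator {a..b} x * g x" by (simp add: g_def)
    show "0 \<le> G b - G a" using Gle that by simp
  qed auto
  have int: "g integrable_on {a..b}" "integral {a..b} g = G b - G a" if "a \<le> b" for a b
  proof -
    have "set_integrable lborel {a..b} g" using hb[OF that] by (simp add: set_integrable_def has_bochner_integral_iff)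
    from set_borel_integral_eq_integral[OF this] hb[OF that]
    show "g integrable_on {a..b}" "integral {a..b} g = G b - G a"
      by (auto simp: set_lebesgue_integral_def has_bochner_integral_iff)
  qed
  have "g integrable_on cbox a b" for a b using int(1)[of a b] by (cases "a \<le> b") auto
  \<comment> \<open>Lebesgue differentiation of the density: off \<open>N\<close> the right
    difference quotients of \<open>G\<close> converge to \<open>g\<close>.\<close>
  from integrable_ccontinuous_explicit[OF this] obtain N where N: "negligible N"
    "\<And>x e. x \<notin> N \<Longrightarrow> 0 < e \<Longrightarrow> \<exists>d>0. \<forall>h. 0 < h \<and> h < d \<longrightarrow>
       norm (integral (cbox x (x + h *\<^sub>R One)) g /\<^sub>R h ^ DIM(real) - g x) < e" by metis
  have main: "convergent (\<lambda>n. real (Suc n) * (F (t + inverse (Suc n)) - F t))" if t: "t \<notin> N" for t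
  proof -
    have "(\<lambda>n. real (Suc n) * (G (t + inverse (Suc n)) - G t)) \<longlonglongrightarrow> g t"
    proof (rule LIMSEQ_I)
      fix e :: real assume "e > 0"
      then obtain d where d: "d > 0" "\<And>h. 0 < h \<Longrightarrow> h < d \<Longrightarrow> norm (integral {t..t + h} g / h - g t) < e"
        using N(2)[OF t \<open>e > 0\<close>] by (auto simp: inverse_eq_divide)
      obtain n0 where n0: "inverse (real (Suc n0)) < d" using reals_Archimedean d(1) by blast
      show "\<exists>n0. \<forall>n\<ge>n0. norm (real (Suc n) * (G (t + inverse (Suc n)) - G t) - g t) < e"
      proof (intro exI allI impI)
        fix n assume "n \<ge> n0"
        then have "inverse (real (Suc n)) < d"
          by (intro le_less_trans[OF _ n0] le_imp_inverse_le) auto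
        from d(2)[OF _ this] show "norm (real (Suc n) * (G (t + inverse (Suc n)) - G t) - g t) < e"
          using int(2)[of t "t + inverse (real (Suc n))"] by (simp add: divide_inverse mult.commute del: of_nat_Suc)
      qed
    qed
    from tendsto_diff[OF this tendsto_const[of "L + 1"]]
    have "(\<lambda>n. real (Suc n) * (G (t + inverse (Suc n)) - G t) - (L + 1)) \<longlonglongrightarrow> g t - (L + 1)" .
    moreover have "real (Suc n) * (G (t + inverse (Suc n)) - G t) - (L + 1) = real (Suc n) * (F (t + inverse (Suc n)) - F t)" for n
    proof -
      have "G (t + inverse (Suc n)) - G t = F (t + inverse (Suc n)) - F t + (L + 1) * inverse (Suc n)"
        by (simp add: G_def algebra_simps)
      moreover have "real (Suc n) * ((L + 1) * inverse (Suc n)) = L + 1" by simp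
      ultimately show ?thesis by (simp only: distrib_left add_diff_cancel_right')
    qed
    ultimately show ?thesis by (simp add: convergentI)
  qed
  show ?thesis using AE_lborel_not_in_negligible[OF N(1)] by eventually_elim (use main in blast)
qed

text \<open>Only the steps 1/(n+1) are sampled. The limit of such a sequence is a Borel function on
  the whole space, which provides measurable versions of partial derivatives; full differentiability
  is recovered from the Lipschitz bound.\<close>

definition dquot :: "(real^'n::finite \<Rightarrow> real) \<Rightarrow> real^'n \<Rightarrow> nat \<Rightarrow> real^'n \<Rightarrow> real" where
  "dquot F e n x = real (Suc n) * (F (x + inverse (real (Suc n)) *\<^sub>R e) - F x)"

lemma integrable_continuous_cball_support:
  fixes f :: "'a::euclidean_space \<Rightarrow> real"
  assumes "continuous_on UNIV f" "\<And>x. R < norm x \<Longrightarrow> f x = 0" shows "integrable lborel f"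
proof -
  have "integrable lborel (\<lambda>x. indicator (cball 0 R) x *\<^sub>R f x)"
    by (rule borel_integrable_compact) (auto intro: continuous_on_subset[OF assms(1)])
  moreover have "(\<lambda>x. indicator (cball 0 R) x *\<^sub>R f x) = f"
    using assms(2) by (force simp: indicator_def fun_eq_iff)
  ultimately show ?thesis by simp
qed

lemma AE_lborel_affine_iff:
  fixes P :: "'a::euclidean_space \<Rightarrow> bool"
  assumes "c \<noteq> 0" "AE x in lborel. P x" shows "AE x in lborel. P (t + c *\<^sub>R x)"
proof -
  obtain N where N: "N \<in> null_sets lborel" "{x. \<not> P x} \<subseteq> N"
    using assms(2) by (auto simp: eventually_ae_filter)
  have [measurable]: "N \<in> sets borel" using N(1) by auto
  have "AE x in density (distr lborel borel (\<lambda>x. t + c *\<^sub>R x)) (\<lambda>_. \<bar>c\<bar> ^ DIM('a)). x \<notin> N"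
    unfolding lborel_affine[OF assms(1), symmetric] by (rule AE_not_in[OF N(1)])
  then have "AE x in distr lborel borel (\<lambda>x. t + c *\<^sub>R x). x \<notin> N"
    using assms(1) by (subst (asm) AE_density) auto
  then have "AE x in lborel. t + c *\<^sub>R x \<notin> N" by (subst (asm) AE_distr_iff) auto
  then show ?thesis by eventually_elim (use N(2) in blast)
qed

section \<open>Rademacher's theorem for real functions of several variables\<close>

context
  fixes F :: "real^'n \<Rightarrow> real" and L :: real
  assumes lip: "\<And>x y. \<bar>F x - F y\<bar> \<le> L * norm (x - y)"
begin

lemma lipschitz_const_nonneg: "0 \<le> L"
  using lip[of "axis undefined 1" 0] by simp

lemma lipschitz_cont: "continuous_on S F"
  by (rule lipschitz_on_continuous_on[of L])
     (use lip lipschitz_const_nonneg in \<open>auto intro!: lipschitz_onI simp: dist_norm\<close>)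

lemma lipschitz_borel [measurable]: "F \<in> borel_measurable borel"
  by (rule borel_measurable_continuous_onI[OF lipschitz_cont])

lemma dquot_borel [measurable]: "dquot F e n \<in> borel_measurable borel"
  unfolding dquot_def[abs_def] by measurable

lemma dquot_bound: "\<bar>dquot F e n x\<bar> \<le> L * norm e"
proof -
  have "\<bar>dquot F e n x\<bar> = real (Suc n) * \<bar>F (x + inverse (real (Suc n)) *\<^sub>R e) - F x\<bar>"
    by (simp add: dquot_def abs_mult)
  also have "\<dots> \<le> real (Suc n) * (L * norm (inverse (real (Suc n)) *\<^sub>R e))"
    using lip[of "x + inverse (real (Suc n)) *\<^sub>R e" x] by (intro mult_left_mono) auto
  also have "\<dots> = L * norm e" by (simp add: field_simps del: of_nat_Suc)
  finally show ?thesis .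
qed

text \<open>The one-dimensional theorem settles almost every point of every line in direction
  \<open>e\<close>. Fubini exchanges the two quantifiers, and a single good translation, undone at
  the end, gives almost every x.\<close>

lemma lipschitz_AE_directional: "AE x in lborel. convergent (\<lambda>n. dquot F e n x)"
proof -
  \<comment> \<open>Cauchy in place of convergent: over the reals the two agree, and the
    measurability demanded by Fubini is automatic for this form.\<close>
  let ?P = "\<lambda>x. Cauchy (\<lambda>n. dquot F e n x)"
  have "AE t in lborel. ?P (x + t *\<^sub>R e)" for x
  proof -
    have "\<bar>F (x + s *\<^sub>R e) - F (x + t *\<^sub>R e)\<bar> \<le> (L * norm e) * \<bar>s - t\<bar>" for s t
      using lip[of "x + s *\<^sub>R e" "x + t *\<^sub>R e"]
      by (simp add: scaleR_diff_left[symmetric] mult.commute mult.left_commute)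
    from lipschitz_real_AE_right_derivative[OF this] show ?thesis
      by eventually_elim (simp add: dquot_def Cauchy_convergent_iff algebra_simps del: of_nat_Suc)
  qed
  then have "AE x in lborel. AE t in lborel. ?P (x + t *\<^sub>R e)" by simp
  moreover have "{z \<in> space (lborel \<Otimes>\<^sub>M lborel). ?P (fst z + snd z *\<^sub>R e)} \<in> sets (lborel \<Otimes>\<^sub>M (lborel::real measure))"
    by measurable
  ultimately have "AE t in (lborel::real measure). AE x in lborel. ?P (x + t *\<^sub>R e)"
    by (subst (asm) lborel_pair.AE_commute) auto
  moreover have "ae_filter (lborel::real measure) \<noteq> bot" by (simp add: ae_filter_eq_bot_iff)
  ultimately obtain t where "AE x in lborel. ?P (x + t *\<^sub>R e)" using eventually_happens by blast
  from AE_lborel_affine_iff[OF _ this, of 1 "- t *\<^sub>R e"] show ?thesis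
    by (simp add: Cauchy_convergent_iff)
qed

text \<open>The almost everywhere derivative of a Lipschitz function is also its weak derivative: a
  discrete integration by parts moves the difference quotient to \<phi>, and both sides converge by
  dominated convergence.\<close>

lemma integral_lim_dquot_mult:
  assumes \<phi>: "csmooth R \<phi>"
  shows "(\<integral>x. lim (\<lambda>n. dquot F e n x) * \<phi> x \<partial>lborel) = - (\<integral>x. F x * (grad \<phi> x \<bullet> e) \<partial>lborel)"
    and "integrable lborel (\<lambda>x. lim (\<lambda>n. dquot F e n x) * \<phi> x)"
    and "integrable lborel (\<lambda>x. F x * (grad \<phi> x \<bullet> e))"
proof -
  note [measurable] = csmooth_borel[OF \<phi>]
  obtain L' where L': "L' > 0" "\<And>x y. \<bar>\<phi> x - \<phi> y\<bar> \<le> L' * norm (x - y)" using csmooth_lipschitz[OF \<phi>] by blast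
  have cg: "continuous_on UNIV (grad \<phi>)"
    unfolding grad_def by (intro continuous_on_vec_lambda csmooth_continuous[OF csmooth_pd[OF \<phi>]])
  then have [measurable]: "grad \<phi> \<in> borel_measurable borel" by (rule borel_measurable_continuous_onI)
  have lims: "AE x in lborel. (\<lambda>n. dquot F e n x) \<longlonglongrightarrow> lim (\<lambda>n. dquot F e n x)"
    using lipschitz_AE_directional[of e] by eventually_elim (simp add: convergent_LIMSEQ_iff)
  have I\<phi>: "integrable lborel (\<lambda>x. L * norm e * \<bar>\<phi> x\<bar>)" using csmooth_integrable[OF \<phi>] by simp
  have A: "AE x in lborel. (\<lambda>n. dquot F e n x * \<phi> x) \<longlonglongrightarrow> lim (\<lambda>n. dquot F e n x) * \<phi> x"
    using lims by eventually_elim (rule tendsto_mult_right)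
  have B: "AE x in lborel. norm (dquot F e n x * \<phi> x) \<le> L * norm e * \<bar>\<phi> x\<bar>" for n
    using dquot_bound by (auto simp: abs_mult intro!: mult_right_mono)
  have c1: "(\<lambda>n. \<integral>x. dquot F e n x * \<phi> x \<partial>lborel) \<longlonglongrightarrow> (\<integral>x. lim (\<lambda>n. dquot F e n x) * \<phi> x \<partial>lborel)"
    by (rule integral_dominated_convergence[OF _ _ I\<phi> A B]) auto
  show "integrable lborel (\<lambda>x. lim (\<lambda>n. dquot F e n x) * \<phi> x)"
    by (rule integrable_dominated_convergence[OF _ _ I\<phi> A B]) auto
  \<comment> \<open>The steps have length at most \<open>norm e\<close>, hence this common support
    for all difference quotients of \<phi>.\<close>
  let ?w = "\<lambda>x. indicator (cball 0 (R + norm e)) x *\<^sub>R (\<bar>F x\<bar> * (L' * norm e))"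
  have w: "integrable lborel ?w"
    by (rule borel_integrable_compact) (auto intro!: continuous_intros lipschitz_cont)
  have A2: "AE x in lborel. (\<lambda>n. F x * dquot \<phi> (- e) n x) \<longlonglongrightarrow> F x * (- (grad \<phi> x \<bullet> e))"
  proof (intro AE_I2 tendsto_mult_left)
    fix x
    have "((\<lambda>s. x + s *\<^sub>R (- e)) has_derivative (\<lambda>h. h *\<^sub>R (- e))) (at 0)"
      by (auto intro!: derivative_eq_intros)
    then have "((\<lambda>s. \<phi> (x + s *\<^sub>R (- e))) has_derivative (\<lambda>h. grad \<phi> x \<bullet> (h *\<^sub>R (- e)))) (at 0)"
      using diff_chain_at[of "\<lambda>s. x + s *\<^sub>R (- e)" "\<lambda>h. h *\<^sub>R (- e)" 0 \<phi> "\<lambda>h. grad \<phi> x \<bullet> h"]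
        has_derivative_grad[OF csmooth_differentiable[OF \<phi>], of x] by (simp add: o_def)
    then have "((\<lambda>s. \<phi> (x + s *\<^sub>R (- e))) has_real_derivative - (grad \<phi> x \<bullet> e)) (at 0)"
      unfolding has_field_derivative_def by (rule has_derivative_eq_rhs) (simp add: fun_eq_iff)
    then have "(\<lambda>s. (\<phi> (x + s *\<^sub>R (- e)) - \<phi> x) / s) \<midarrow>0\<rightarrow> - (grad \<phi> x \<bullet> e)"
      by (simp add: DERIV_def)
    then have "(\<lambda>n. (\<phi> (x + inverse (real (Suc n)) *\<^sub>R (- e)) - \<phi> x) / inverse (real (Suc n))) \<longlonglongrightarrow> - (grad \<phi> x \<bullet> e)"
      unfolding LIMSEQ_SEQ_conv[symmetric] using LIMSEQ_inverse_real_of_nat by auto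
    then show "(\<lambda>n. dquot \<phi> (- e) n x) \<longlonglongrightarrow> - (grad \<phi> x \<bullet> e)"
      by (simp add: dquot_def divide_inverse mult.commute del: of_nat_Suc)
  qed
  have B2: "AE x in lborel. norm (F x * dquot \<phi> (- e) n x) \<le> ?w x" for n
  proof (rule AE_I2)
    fix x
    have "\<bar>dquot \<phi> (- e) n x\<bar> = real (Suc n) * \<bar>\<phi> (x + inverse (real (Suc n)) *\<^sub>R (- e)) - \<phi> x\<bar>"
      by (simp add: dquot_def abs_mult)
    also have "\<dots> \<le> real (Suc n) * (L' * norm (inverse (real (Suc n)) *\<^sub>R (- e)))"
      using L'(2)[of "x + inverse (real (Suc n)) *\<^sub>R (- e)" x] by (intro mult_left_mono) auto
    also have "\<dots> = L' * norm e" by (simp add: field_simps del: of_nat_Suc)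
    finally have b: "\<bar>dquot \<phi> (- e) n x\<bar> \<le> L' * norm e" .
    have z: "dquot \<phi> (- e) n x = 0" if "R + norm e < norm x"
    proof -
      have "inverse (real (Suc n)) * norm e \<le> 1 * norm e" by (intro mult_right_mono) (auto simp: inverse_le_1_iff)
      then have "R < norm (x - inverse (real (Suc n)) *\<^sub>R e)"
        using norm_triangle_ineq2[of x "inverse (real (Suc n)) *\<^sub>R e"] that by (simp del: of_nat_Suc)
      moreover have "R < norm x" using that norm_ge_zero[of e] by linarith
      ultimately show ?thesis using csmoothD(2)[OF \<phi>] by (simp add: dquot_def del: of_nat_Suc)
    qed
    show "norm (F x * dquot \<phi> (- e) n x) \<le> ?w x"
      using b z by (cases "norm x \<le> R + norm e") (auto simp: abs_mult intro!: mult_left_mono)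
  qed
  have m: "dquot \<phi> (- e) n \<in> borel_measurable borel" for n unfolding dquot_def[abs_def] by measurable
  have c2: "(\<lambda>n. \<integral>x. F x * dquot \<phi> (- e) n x \<partial>lborel) \<longlonglongrightarrow> (\<integral>x. F x * (- (grad \<phi> x \<bullet> e)) \<partial>lborel)"
    by (rule integral_dominated_convergence[OF _ _ w A2 B2]) (use m in auto)
  have "integrable lborel (\<lambda>x. F x * (- (grad \<phi> x \<bullet> e)))"
    by (rule integrable_dominated_convergence[OF _ _ w A2 B2]) (use m in auto)
  then show "integrable lborel (\<lambda>x. F x * (grad \<phi> x \<bullet> e))" by simp
  have eq: "(\<integral>x. dquot F e n x * \<phi> x \<partial>lborel) = (\<integral>x. F x * dquot \<phi> (- e) n x \<partial>lborel)" for n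
  proof -
    let ?t = "inverse (real (Suc n)) *\<^sub>R e"
    have i1: "integrable lborel (\<lambda>x. F x * \<phi> x)"
      by (rule integrable_continuous_cball_support[of _ R])
         (use csmoothD(2)[OF \<phi>] in \<open>auto intro!: continuous_intros lipschitz_cont csmooth_continuous[OF \<phi>]\<close>)
    have i2: "integrable lborel (\<lambda>x. F (x + ?t) * \<phi> x)"
      by (rule integrable_continuous_cball_support[of _ R])
         (use csmoothD(2)[OF \<phi>] in \<open>auto intro!: continuous_intros continuous_on_compose2[OF lipschitz_cont[of UNIV]] csmooth_continuous[OF \<phi>]\<close>)
    have i3: "integrable lborel (\<lambda>x. F x * \<phi> (x - ?t))"
      using i2 lborel_integral_translation(4)[of "\<lambda>x. F x * \<phi> (x - ?t)" ?t] by simp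
    have "(\<integral>x. dquot F e n x * \<phi> x \<partial>lborel) = (\<integral>x. real (Suc n) * (F (x + ?t) * \<phi> x - F x * \<phi> x) \<partial>lborel)"
      by (simp add: dquot_def algebra_simps del: of_nat_Suc)
    also have "\<dots> = real (Suc n) * ((\<integral>x. F (x + ?t) * \<phi> x \<partial>lborel) - (\<integral>x. F x * \<phi> x \<partial>lborel))"
      using i1 i2 by (simp del: of_nat_Suc)
    also have "(\<integral>x. F (x + ?t) * \<phi> x \<partial>lborel) = (\<integral>x. F x * \<phi> (x - ?t) \<partial>lborel)"
      using lborel_integral_translation(1)[of "\<lambda>x. F x * \<phi> (x - ?t)" ?t] by simp
    also have "real (Suc n) * ((\<integral>x. F x * \<phi> (x - ?t) \<partial>lborel) - (\<integral>x. F x * \<phi> x \<partial>lborel))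
       = (\<integral>x. real (Suc n) * (F x * \<phi> (x - ?t) - F x * \<phi> x) \<partial>lborel)"
      using i1 i3 by (simp del: of_nat_Suc)
    also have "\<dots> = (\<integral>x. F x * dquot \<phi> (- e) n x \<partial>lborel)"
      by (simp add: dquot_def algebra_simps del: of_nat_Suc)
    finally show ?thesis .
  qed
  show "(\<integral>x. lim (\<lambda>n. dquot F e n x) * \<phi> x \<partial>lborel) = - (\<integral>x. F x * (grad \<phi> x \<bullet> e) \<partial>lborel)"
    using LIMSEQ_unique[OF c1[unfolded eq] c2] by simp
qed

text \<open>Weak derivatives are linear in the direction. The defect \<open>d\<close> therefore
  integrates to zero against all test functions, and the fundamental lemma, applied with both signs
  on balls, makes it vanish.\<close>

lemma lim_dquot_linear:
  "AE x in lborel. lim (\<lambda>n. dquot F e n x) = (\<Sum>i\<in>UNIV. e $ i * lim (\<lambda>n. dquot F (axis i 1) n x))"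
proof -
  let ?D = "\<lambda>e x. lim (\<lambda>n. dquot F e n x)"
  define d where "d x = ?D e x - (\<Sum>i\<in>UNIV. e $ i * ?D (axis i 1) x)" for x
  have [measurable]: "?D e \<in> borel_measurable borel" for e by measurable
  have dm: "d \<in> borel_measurable borel" unfolding d_def[abs_def] by measurable
  have bd: "AE x in lborel. \<bar>?D e x\<bar> \<le> L * norm e" for e
    using lipschitz_AE_directional[of e]
  proof eventually_elim
    case (elim x)
    then have "(\<lambda>n. dquot F e n x) \<longlonglongrightarrow> ?D e x" by (simp add: convergent_LIMSEQ_iff)
    from tendsto_rabs[OF this] show ?case by (rule LIMSEQ_le_const2) (use dquot_bound in auto)
  qed
  have "AE x in lborel. \<forall>i. \<bar>?D (axis i 1) x\<bar> \<le> L"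
    using bd[of "axis _ 1"] by (subst AE_all_countable) simp
  then have dbd: "AE x in lborel. \<bar>d x\<bar> \<le> L * norm e + (\<Sum>i\<in>UNIV. \<bar>e $ i\<bar> * L)"
    using bd[of e]
  proof eventually_elim
    case (elim x)
    have "\<bar>\<Sum>i\<in>UNIV. e $ i * ?D (axis i 1) x\<bar> \<le> (\<Sum>i\<in>UNIV. \<bar>e $ i\<bar> * L)"
      using elim(1) by (intro order_trans[OF sum_abs] sum_mono) (auto simp: abs_mult intro!: mult_left_mono)
    with elim(2) show ?case unfolding d_def by linarith
  qed
  let ?K = "L * norm e + (\<Sum>i\<in>UNIV. \<bar>e $ i\<bar> * L)"
  have int0: "(\<integral>x. d x * \<phi> x \<partial>lborel) = 0" if \<phi>: "csmooth R \<phi>" for \<phi> R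
  proof -
    note I = integral_lim_dquot_mult[OF \<phi>]
    have "(\<integral>x. d x * \<phi> x \<partial>lborel) = (\<integral>x. ?D e x * \<phi> x - (\<Sum>i\<in>UNIV. e $ i * (?D (axis i 1) x * \<phi> x)) \<partial>lborel)"
      by (simp add: d_def left_diff_distrib sum_distrib_right mult.assoc)
    also have "\<dots> = (\<integral>x. ?D e x * \<phi> x \<partial>lborel) - (\<Sum>i\<in>UNIV. e $ i * (\<integral>x. ?D (axis i 1) x * \<phi> x \<partial>lborel))"
      using I(2) by simp
    also have "\<dots> = - (\<integral>x. F x * (grad \<phi> x \<bullet> e) \<partial>lborel) + (\<Sum>i\<in>UNIV. e $ i * (\<integral>x. F x * (grad \<phi> x \<bullet> axis i 1) \<partial>lborel))"
      by (simp add: I(1) sum_negf)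
    also have "(\<Sum>i\<in>UNIV. e $ i * (\<integral>x. F x * (grad \<phi> x \<bullet> axis i 1) \<partial>lborel)) = (\<integral>x. (\<Sum>i\<in>UNIV. e $ i * (F x * (grad \<phi> x \<bullet> axis i 1))) \<partial>lborel)"
      using I(3) by simp
    also have "\<dots> = (\<integral>x. F x * (grad \<phi> x \<bullet> e) \<partial>lborel)"
    proof -
      have "(\<Sum>i\<in>UNIV. e $ i * (F x * (grad \<phi> x \<bullet> axis i 1))) = F x * (grad \<phi> x \<bullet> e)" for x
        by (simp only: inner_axis_one) (simp add: inner_vec_def sum_distrib_left mult_ac)
      then show ?thesis by (simp only:)
    qed
    finally show ?thesis by simp
  qed
  have z: "AE x in lborel. x \<in> ball 0 (real R) \<longrightarrow> d x = 0" for R :: nat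
  proof -
    let ?F = "\<lambda>x. indicator (ball 0 (real R)) x * d x"
    have iF: "integrable lborel ?F"
    proof (rule Bochner_Integration.integrable_bound[where f="\<lambda>x. ?K * indicator (ball 0 (real R)) x"])
      show "integrable lborel (\<lambda>x::real^'n. ?K * indicator (ball 0 (real R)) x)"
        by (intro integrable_mult_right integrable_real_indicator)
           (auto intro: emeasure_bounded_finite[unfolded infinity_ennreal_def])
      show "AE x in lborel. norm (?F x) \<le> norm (?K * indicator (ball 0 (real R)) x)"
        using dbd by eventually_elim (auto simp: indicator_def)
      show "?F \<in> borel_measurable lborel"
        using borel_measurable_times[OF borel_measurable_indicator dm, of "ball 0 (real R)"] by simp
    qed
    have t: "(\<integral>x. ?F x * \<phi> x \<partial>lborel) = 0" if "test_fun (ball 0 (real R)) \<phi>" for \<phi>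
    proof -
      have "\<phi> x = 0" if "x \<notin> ball 0 (real R)" for x
        using \<open>test_fun _ \<phi>\<close> closure_subset[of "{x. \<phi> x \<noteq> 0}"] that by (auto simp: test_fun_def)
      then have "?F x * \<phi> x = d x * \<phi> x" for x by (cases "x \<in> ball 0 (real R)") auto
      then have "(\<integral>x. ?F x * \<phi> x \<partial>lborel) = (\<integral>x. d x * \<phi> x \<partial>lborel)" by (simp only:)
      then show ?thesis using test_fun_csmooth[OF that] int0 by metis
    qed
    have "AE x in lborel. x \<in> ball 0 (real R) \<longrightarrow> ?F x \<le> 0"
      by (rule AE_le_0_if_test_integrals_le_0[OF iF]) (auto simp: t)
    moreover have "AE x in lborel. x \<in> ball 0 (real R) \<longrightarrow> - ?F x \<le> 0"
      by (rule AE_le_0_if_test_integrals_le_0[OF integrable_minus[OF iF]]) (use t in auto)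
    ultimately show ?thesis by eventually_elim (auto simp: indicator_def)
  qed
  then have "AE x in lborel. \<forall>R::nat. x \<in> ball 0 (real R) \<longrightarrow> d x = 0" by (subst AE_all_countable) auto
  then show ?thesis
  proof eventually_elim
    case (elim x)
    obtain R :: nat where "norm x < real R" using reals_Archimedean2 by blast
    then show ?case using elim[rule_format, of R] by (simp add: d_def)
  qed
qed

text \<open>Compactness of the unit ball leaves finitely many directions, on which the convergence
  is uniform; any other direction is replaced by a nearby one at the cost of the Lipschitz
  constant.\<close>

lemma has_derivative_from_dense_directions:
  assumes dense: "\<And>X. open X \<Longrightarrow> X \<noteq> {} \<Longrightarrow> \<exists>q\<in>Q. q \<in> X"
    and lim: "\<And>q. q \<in> Q \<Longrightarrow> (\<lambda>n. dquot F q n x) \<longlonglongrightarrow> p \<bullet> q"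
  shows "(F has_derivative (\<lambda>h. p \<bullet> h)) (at x)"
  unfolding has_derivative_at_alt
proof (intro conjI bounded_linear_inner_right allI impI)
  fix \<epsilon> :: real assume "\<epsilon> > 0"
  \<comment> \<open>Replacing a direction within \<delta> costs at most \<epsilon>/4, for
    \<open>F\<close> and for the linear map together.\<close>
  define \<delta> where "\<delta> = \<epsilon> / (4 * (L + norm p + 1))"
  have Lp: "L + norm p + 1 > 0" using lipschitz_const_nonneg norm_ge_zero[of p] by linarith
  then have "\<delta> > 0" using \<open>\<epsilon> > 0\<close> by (simp add: \<delta>_def)
  have \<delta>le: "L * \<delta> + norm p * \<delta> \<le> \<epsilon> / 4"
  proof -
    have "(L + norm p) * \<delta> \<le> (L + norm p + 1) * \<delta>" using \<open>\<delta> > 0\<close> by (intro mult_right_mono) auto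
    also have "\<dots> = \<epsilon> / 4" using Lp by (simp add: \<delta>_def field_simps)
    finally show ?thesis by (simp add: distrib_right)
  qed
  have "cball 0 1 \<subseteq> (\<Union>q\<in>Q. ball q \<delta>)"
  proof
    fix y :: "real^'n"
    obtain q where "q \<in> Q" "q \<in> ball y \<delta>" using dense[of "ball y \<delta>"] \<open>\<delta> > 0\<close> by auto
    then show "y \<in> (\<Union>q\<in>Q. ball q \<delta>)" by (auto simp: dist_commute)
  qed
  then obtain K where K: "K \<subseteq> Q" "finite K" "cball 0 1 \<subseteq> (\<Union>q\<in>K. ball q \<delta>)"
    using compactE_image[of "cball (0::real^'n) 1" Q "\<lambda>q. ball q \<delta>"] compact_cball by (metis open_ball)
  have "\<forall>q\<in>K. \<forall>\<^sub>F n in sequentially. \<bar>dquot F q n x - p \<bullet> q\<bar> < \<epsilon> / 4"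
    using lim K(1) \<open>\<epsilon> > 0\<close> unfolding tendsto_iff dist_real_def by (meson in_mono zero_less_divide_iff zero_less_numeral)
  then have "\<forall>\<^sub>F n in sequentially. \<forall>q\<in>K. \<bar>dquot F q n x - p \<bullet> q\<bar> < \<epsilon> / 4"
    using K(2) by (simp add: eventually_ball_finite)
  then obtain N where N: "\<And>n q. n \<ge> N \<Longrightarrow> q \<in> K \<Longrightarrow> \<bar>dquot F q n x - p \<bullet> q\<bar> < \<epsilon> / 4"
    unfolding eventually_sequentially by blast
  show "\<exists>d>0. \<forall>y. norm (y - x) < d \<longrightarrow> norm (F y - F x - p \<bullet> (y - x)) \<le> \<epsilon> * norm (y - x)"
  proof (intro exI conjI allI impI)
    show "(0::real) < inverse (Suc N)" by simp
    fix y assume y: "norm (y - x) < inverse (Suc N)"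
    define h where "h = y - x"
    show "norm (F y - F x - p \<bullet> (y - x)) \<le> \<epsilon> * norm (y - x)"
    proof (cases "h = 0")
      case False
      then have h0: "norm h > 0" by simp
      \<comment> \<open>Quotients are sampled at the steps 1/m only, so the increment h is rescaled
        by an integer: m h lies in the unit ball, and 1/m is at most 2 |h|.\<close>
      define m where "m = nat \<lfloor>1 / norm h\<rfloor>"
      have hN: "real (Suc N) < 1 / norm h"
        using y h0 by (simp add: h_def[symmetric] field_simps)
      then have "int (Suc N) \<le> \<lfloor>1 / norm h\<rfloor>" by (simp add: le_floor_iff del: of_nat_Suc)
      then have mN: "m \<ge> Suc N" unfolding m_def by linarith
      have m: "real m \<le> 1 / norm h" "1 / norm h < real m + 1"
        using mN hN unfolding m_def by (auto simp: of_nat_nat)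
      obtain n where n: "m = Suc n" "n \<ge> N" using mN by (cases m) auto
      have m1: "real m \<ge> 1" using n by simp
      have "norm (real m *\<^sub>R h) \<le> 1" using m(1) h0 by (simp add: field_simps)
      then obtain q where q: "q \<in> K" "norm (real m *\<^sub>R h - q) < \<delta>"
        using K(3) by (force simp: dist_norm norm_minus_commute subset_eq)
      let ?q = "inverse (real m) *\<^sub>R q"
      have hq: "norm (h - ?q) \<le> \<delta> * inverse (real m)"
      proof -
        have "h - ?q = inverse (real m) *\<^sub>R (real m *\<^sub>R h - q)" using m1 by (simp add: scaleR_diff_right)
        then show ?thesis using q(2) m1 by (simp add: divide_simps mult.commute)
      qed
      have a: "\<bar>F y - F (x + ?q)\<bar> \<le> L * (\<delta> * inverse (real m))"
      proof -
        have "\<bar>F y - F (x + ?q)\<bar> \<le> L * norm (h - ?q)" using lip[of y "x + ?q"] by (simp add: h_def algebra_simps)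
        also have "\<dots> \<le> L * (\<delta> * inverse (real m))" by (intro mult_left_mono hq lipschitz_const_nonneg)
        finally show ?thesis .
      qed
      have b: "\<bar>F (x + ?q) - F x - p \<bullet> ?q\<bar> \<le> \<epsilon> / 4 * inverse (real m)"
      proof -
        have "\<bar>dquot F q n x - p \<bullet> q\<bar> * inverse (real m) \<le> \<epsilon> / 4 * inverse (real m)"
          using N[OF n(2) q(1)] by (intro mult_right_mono) auto
        moreover have "F (x + ?q) - F x - p \<bullet> ?q = (dquot F q n x - p \<bullet> q) * inverse (real m)"
          using m1 by (simp add: dquot_def n(1)[symmetric] field_simps)
        ultimately show ?thesis by (simp add: abs_mult)
      qed
      have c: "\<bar>p \<bullet> ?q - p \<bullet> h\<bar> \<le> norm p * (\<delta> * inverse (real m))"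
      proof -
        have "\<bar>p \<bullet> (?q - h)\<bar> \<le> norm p * norm (?q - h)" by (rule Cauchy_Schwarz_ineq2)
        also have "\<dots> \<le> norm p * (\<delta> * inverse (real m))"
          using hq by (intro mult_left_mono) (auto simp: norm_minus_commute)
        finally show ?thesis by (simp add: inner_diff_right)
      qed
      have "\<bar>F y - F x - p \<bullet> h\<bar> \<le> L * (\<delta> * inverse (real m)) + \<epsilon> / 4 * inverse (real m) + norm p * (\<delta> * inverse (real m))"
        using a b c by linarith
      also have "\<dots> = (L * \<delta> + norm p * \<delta> + \<epsilon> / 4) * inverse (real m)" by (simp add: algebra_simps)
      also have "\<dots> \<le> (\<epsilon> / 2) * inverse (real m)"
        using \<delta>le m1 by (intro mult_right_mono) auto
      also have "\<dots> \<le> (\<epsilon> / 2) * (2 * norm h)"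
      proof (rule mult_left_mono)
        have "1 / norm h \<le> 2 * real m" using m(2) m1 by linarith
        then show "inverse (real m) \<le> 2 * norm h" using h0 m1 by (simp add: field_simps)
      qed (use \<open>\<epsilon> > 0\<close> in auto)
      finally show ?thesis by (simp add: h_def)
    qed (simp add: h_def)
  qed
qed

text \<open>With countably many dense directions one null set serves for all of them.\<close>

lemma rademacher: "AE x in lborel. F differentiable (at x)"
proof -
  obtain Q :: "(real^'n) set" where Q: "countable Q" "\<And>X. open X \<Longrightarrow> X \<noteq> {} \<Longrightarrow> \<exists>q\<in>Q. q \<in> X"
    using countable_dense_setE by blast
  have "AE x in lborel. \<forall>q\<in>Q. convergent (\<lambda>n. dquot F q n x) \<and>
     lim (\<lambda>n. dquot F q n x) = (\<Sum>i\<in>UNIV. q $ i * lim (\<lambda>n. dquot F (axis i 1) n x))"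
    by (subst AE_ball_countable[OF Q(1)]) (auto intro: lipschitz_AE_directional lim_dquot_linear)
  then show ?thesis
  proof eventually_elim
    case (elim x)
    have "(F has_derivative (\<lambda>h. (\<chi> i. lim (\<lambda>n. dquot F (axis i 1) n x)) \<bullet> h)) (at x)"
    proof (rule has_derivative_from_dense_directions[OF Q(2)])
      fix q assume "q \<in> Q"
      then show "(\<lambda>n. dquot F q n x) \<longlonglongrightarrow> (\<chi> i. lim (\<lambda>n. dquot F (axis i 1) n x)) \<bullet> q"
        using elim by (auto simp: convergent_LIMSEQ_iff inner_vec_def mult.commute)
    qed
    then show ?case unfolding differentiable_def by blast
  qed
qed

end

subsection \<open>Lipschitz gradients and the essential supremum of the Hessian\<close>

lemma dquot_tendsto:
  fixes F :: "real^'n \<Rightarrow> real"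
  assumes "(F has_derivative (\<lambda>h. D \<bullet> h)) (at x)"
  shows "(\<lambda>n. dquot F e n x) \<longlonglongrightarrow> D \<bullet> e"
proof -
  have "((\<lambda>s. x + s *\<^sub>R e) has_derivative (\<lambda>h. h *\<^sub>R e)) (at 0)"
    by (auto intro!: derivative_eq_intros)
  then have "((\<lambda>s. F (x + s *\<^sub>R e)) has_derivative (\<lambda>h. D \<bullet> (h *\<^sub>R e))) (at 0)"
    using diff_chain_at[of "\<lambda>s. x + s *\<^sub>R e" "\<lambda>h. h *\<^sub>R e" 0 F "\<lambda>h. D \<bullet> h"] assms by (simp add: o_def)
  then have "((\<lambda>s. F (x + s *\<^sub>R e)) has_real_derivative D \<bullet> e) (at 0)"
    unfolding has_field_derivative_def by (rule has_derivative_eq_rhs) (simp add: fun_eq_iff)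
  then have "(\<lambda>s. (F (x + s *\<^sub>R e) - F x) / s) \<midarrow>0\<rightarrow> D \<bullet> e"
    by (simp add: DERIV_def)
  then have "(\<lambda>n. (F (x + inverse (real (Suc n)) *\<^sub>R e) - F x) / inverse (real (Suc n))) \<longlonglongrightarrow> D \<bullet> e"
    unfolding LIMSEQ_SEQ_conv[symmetric] using LIMSEQ_inverse_real_of_nat by auto
  then show ?thesis by (simp add: dquot_def divide_inverse mult.commute del: of_nat_Suc)
qed

lemma has_derivative_norm_le_local_lipschitz:
  assumes D: "(f has_derivative D) (at x)" and S: "open S" "x \<in> S"
    and lip: "\<And>y. y \<in> S \<Longrightarrow> norm (f y - f x) \<le> B * norm (y - x)"
  shows "norm (D h) \<le> B * norm h"
proof (cases "h = 0")
  case True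
  then show ?thesis using has_derivative_bounded_linear[OF D] by (simp add: linear_simps)
next
  case False
  then have h: "norm h > 0" by simp
  interpret D: bounded_linear D by (rule has_derivative_bounded_linear[OF D])
  have "norm (D h) \<le> (B + e) * norm h" if "e > 0" for e
  proof -
    obtain d where d: "d > 0" "\<And>y. norm (y - x) < d \<Longrightarrow> norm (f y - f x - D (y - x)) \<le> e * norm (y - x)"
      using D \<open>e > 0\<close> unfolding has_derivative_at_alt by blast
    obtain r where r: "r > 0" "ball x r \<subseteq> S" using S openE by blast
    define s where "s = min d r / (2 * norm h)"
    have s: "s > 0" using d(1) r(1) h by (simp add: s_def)
    have "s * norm h < d" "s * norm h < r" using h d(1) r(1) by (auto simp: s_def)
    then have "norm (f (x + s *\<^sub>R h) - f x - D (s *\<^sub>R h)) \<le> e * norm (s *\<^sub>R h)"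
      "norm (f (x + s *\<^sub>R h) - f x) \<le> B * norm (s *\<^sub>R h)"
      using d(2)[of "x + s *\<^sub>R h"] lip[of "x + s *\<^sub>R h"] s r(2) by (auto simp: dist_norm subset_eq)
    then have "norm (D (s *\<^sub>R h)) \<le> (B + e) * norm (s *\<^sub>R h)"
      using norm_triangle_ineq4[of "f (x + s *\<^sub>R h) - f x" "f (x + s *\<^sub>R h) - f x - D (s *\<^sub>R h)"]
      by (simp add: distrib_right)
    then have "s * norm (D h) \<le> s * ((B + e) * norm h)" using s by (simp add: D.scaleR mult.left_commute)
    then show ?thesis using s by simp
  qed
  note * = this
  have "norm (D h) \<le> B * norm h + e" if "e > 0" for e
    using *[of "e / norm h"] that h by (simp add: distrib_right)
  then show ?thesis by (rule field_le_epsilon)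
qed

text \<open>Nearest-point projection onto a closed ball. Composition with this 1-Lipschitz map
  extends a function from the ball to the whole space without enlarging its Lipschitz
  constant.\<close>

definition clip :: "real \<Rightarrow> real^'n::finite \<Rightarrow> real^'n" where
  "clip r = closest_point (cball 0 r)"

lemma clip_props:
  assumes "r \<ge> 0"
  shows "clip r x \<in> cball 0 r" "norm (clip r x - clip r y) \<le> norm (x - y)" "x \<in> cball 0 r \<Longrightarrow> clip r x = x"
  using assms closest_point_in_set[of "cball 0 r" x] closest_point_lipschitz[of "cball 0 r" x y]
  by (auto simp: clip_def closest_point_self dist_norm)

lemma lipschitz_clip:
  assumes lip: "\<And>x y. x \<in> ball 0 \<rho> \<Longrightarrow> y \<in> ball 0 \<rho> \<Longrightarrow> \<bar>F x - F y\<bar> \<le> L * norm (x - y)"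
    and r: "0 \<le> r" "r < \<rho>" and L: "0 \<le> L"
  shows "\<bar>F (clip r x) - F (clip r y)\<bar> \<le> L * norm (x - y)"
proof -
  have "\<bar>F (clip r x) - F (clip r y)\<bar> \<le> L * norm (clip r x - clip r y)"
    using clip_props(1)[OF r(1), of x] clip_props(1)[OF r(1), of y] r by (intro lip) auto
  also have "\<dots> \<le> L * norm (x - y)" by (intro mult_left_mono clip_props(2) r L)
  finally show ?thesis .
qed

text \<open>The projection takes a closed ball inside the open one, so the ball is exhausted by the
  radii \<rho> (1 - 1/(n+2)).\<close>

lemma rademacher_ball:
  fixes F :: "real^'n \<Rightarrow> real"
  assumes lip: "\<And>x y. x \<in> ball 0 \<rho> \<Longrightarrow> y \<in> ball 0 \<rho> \<Longrightarrow> \<bar>F x - F y\<bar> \<le> L * norm (x - y)"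
    and L: "0 \<le> L"
  shows "AE x in lborel. x \<in> ball 0 \<rho> \<longrightarrow> F differentiable (at x)"
proof (cases "\<rho> > 0")
  case True
  let ?r = "\<lambda>n. \<rho> * (1 - inverse (real (Suc (Suc n))))"
  have r: "0 \<le> ?r n" "?r n < \<rho>" for n
  proof -
    have "inverse (real (Suc (Suc n))) < 1" "inverse (real (Suc (Suc n))) > 0" by (auto simp: field_simps)
    then show "0 \<le> ?r n" "?r n < \<rho>" using True by (auto simp del: of_nat_Suc)
  qed
  have cl: "\<bar>F (clip (?r n) x) - F (clip (?r n) y)\<bar> \<le> L * norm (x - y)" for n x y
    by (rule lipschitz_clip[OF lip r L])
  have "AE x in lborel. x \<in> ball 0 (?r n) \<longrightarrow> F differentiable (at x)" for n
    using rademacher[OF cl[of n]]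
  proof eventually_elim
    case (elim x)
    show ?case
    proof
      assume x: "x \<in> ball 0 (?r n)"
      from elim obtain D where "((\<lambda>x. F (clip (?r n) x)) has_derivative D) (at x)"
        unfolding differentiable_def by blast
      then have "(F has_derivative D) (at x)"
        by (rule has_derivative_transform_within_open[of _ _ _ _ "ball 0 (?r n)"])
           (use x in \<open>auto intro!: arg_cong[where f=F] clip_props(3)[OF r(1)] simp del: of_nat_Suc\<close>)
      then show "F differentiable (at x)" unfolding differentiable_def by blast
    qed
  qed
  then have "AE x in lborel. \<forall>n. x \<in> ball 0 (?r n) \<longrightarrow> F differentiable (at x)"
    by (subst AE_all_countable) blast
  then show ?thesis
  proof eventually_elim
    case (elim x)
    show ?case
    proof
      assume "x \<in> ball 0 \<rho>"
      then have "1 - norm x / \<rho> > 0" using True by simp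
      then obtain n where n: "inverse (real (Suc n)) < 1 - norm x / \<rho>" using reals_Archimedean by blast
      have "inverse (real (Suc (Suc n))) \<le> inverse (real (Suc n))" by (intro le_imp_inverse_le) auto
      with n have "norm x / \<rho> < 1 - inverse (real (Suc (Suc n)))" by linarith
      then have "x \<in> ball 0 (?r n)" using True by (simp add: pos_divide_less_eq mult.commute del: of_nat_Suc)
      then show "F differentiable (at x)" using elim by blast
    qed
  qed
next
  case False
  then have "ball (0::real^'n) \<rho> = {}" by simp
  then show ?thesis by (simp only: empty_iff simp_thms eventually_True)
qed

text \<open>An average of small translates has gradient at most \<open>M\<close> everywhere, hence
  is M-Lipschitz, and is within \<open>L * s\<close> of \<open>F\<close>. Thus \<open>L\<close>
  controls the errors and the majorants, while \<open>M\<close> is the constant that survives as s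
  tends to 0.\<close>

lemma lipschitz_ball_if_AE_gradient_le:
  fixes F :: "real^'n \<Rightarrow> real"
  assumes lip: "\<And>x y. x \<in> ball 0 \<rho> \<Longrightarrow> y \<in> ball 0 \<rho> \<Longrightarrow> \<bar>F x - F y\<bar> \<le> L * norm (x - y)"
    and L: "0 \<le> L"
    and grad: "AE x in lborel. x \<in> ball 0 \<rho> \<longrightarrow> (\<exists>D. (F has_derivative (\<lambda>h. D \<bullet> h)) (at x) \<and> norm D \<le> M)"
    and xy: "x \<in> ball 0 \<rho>" "y \<in> ball 0 \<rho>"
  shows "\<bar>F x - F y\<bar> \<le> M * norm (x - y)"
proof -
  obtain \<eta> \<psi> :: "real^'n \<Rightarrow> real" where \<eta>: "csmooth 1 \<eta>" "\<And>x. \<eta> x \<ge> 0" "(\<integral>x. \<eta> x \<partial>lborel) = 1"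
    using mollifier_exists by metis
  note [measurable] = csmooth_borel[OF \<eta>(1)]
  \<comment> \<open>\<open>r\<close> encloses both points, and \<open>r'\<close> leaves room for
    translations of length s < r' - r while staying strictly inside the ball.\<close>
  define r where "r = (max (norm x) (norm y) + \<rho>) / 2"
  have r: "norm x < r" "norm y < r" "r < \<rho>" using xy by (auto simp: r_def)
  then have r0: "0 \<le> r" by (meson norm_ge_zero order_trans less_imp_le)
  define r' where "r' = (r + \<rho>) / 2"
  have r': "r < r'" "r' < \<rho>" "0 \<le> r'" using r r0 by (auto simp: r'_def)
  define E where "E = (\<lambda>x. F (clip r' x))"
  have Elip: "\<bar>E x - E y\<bar> \<le> L * norm (x - y)" for x y
    unfolding E_def by (rule lipschitz_clip[OF lip r'(3,2) L])
  have EF: "E z = F z" if "z \<in> ball 0 r'" for z using that clip_props(3)[OF r'(3), of z] by (simp add: E_def)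
  note [measurable] = lipschitz_borel[OF Elip]
  \<comment> \<open>A Borel version of the gradient of \<open>E\<close>: the derivatives supplied by
    the hypothesis come without measurability.\<close>
  define gE where "gE x = (\<chi> i. lim (\<lambda>n. dquot E (axis i 1) n x))" for x
  have Eder: "AE z in lborel. z \<in> ball 0 r' \<longrightarrow> (E has_derivative (\<lambda>h. gE z \<bullet> h)) (at z) \<and> norm (gE z) \<le> M"
    using grad
  proof eventually_elim
    case (elim z)
    show ?case
    proof
      assume z: "z \<in> ball 0 r'"
      then obtain D where D: "(F has_derivative (\<lambda>h. D \<bullet> h)) (at z)" "norm D \<le> M" using elim r'(2) by auto
      have DE: "(E has_derivative (\<lambda>h. D \<bullet> h)) (at z)"
        by (rule has_derivative_transform_within_open[OF D(1), of "ball 0 r'"]) (use z EF in auto)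
      have "gE z = D"
        unfolding gE_def by (simp add: vec_eq_iff limI[OF dquot_tendsto[OF DE]] inner_axis_one)
      with DE D(2) show "(E has_derivative (\<lambda>h. gE z \<bullet> h)) (at z) \<and> norm (gE z) \<le> M" by simp
    qed
  qed
  have [measurable]: "gE \<in> borel_measurable borel"
  proof -
    have "(\<lambda>x. gE x $ i) \<in> borel_measurable borel" for i
      unfolding gE_def using dquot_borel[OF Elip] by simp
    then show ?thesis
      by (subst borel_measurable_euclidean_space) (auto simp: Basis_vec_def inner_axis)
  qed
  have M: "\<bar>F x - F y\<bar> \<le> M * norm (x - y) + 2 * L * s" if s: "0 < s" "s < r' - r" for s
  proof -
    \<comment> \<open>The kernel is kept fixed and \<open>E\<close> is translated, so that the
      gradient of the average is an average of gradients of \<open>E\<close> and inherits their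
      bound.\<close>
    define Fs where "Fs z = (\<integral>\<omega>. \<eta> \<omega> * E (z - s *\<^sub>R \<omega>) \<partial>lborel)" for z
    have int: "integrable lborel (\<lambda>\<omega>. \<eta> \<omega> * E (z - s *\<^sub>R \<omega>))" for z
      by (rule integrable_continuous_cball_support[of _ 1])
         (use csmoothD(2)[OF \<eta>(1)] in \<open>auto intro!: continuous_intros csmooth_continuous[OF \<eta>(1)] continuous_on_compose2[OF lipschitz_cont[OF Elip, of UNIV]]\<close>)
    have in_ball: "z - s *\<^sub>R \<omega> \<in> ball 0 r'" if "z \<in> ball 0 r" "norm \<omega> \<le> 1" for z \<omega>
    proof -
      have "norm (z - s *\<^sub>R \<omega>) \<le> norm z + s * norm \<omega>"
        using norm_triangle_ineq4[of z "s *\<^sub>R \<omega>"] s by simp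
      also have "\<dots> < r + s" using that s by (simp add: add_less_le_mono)
      finally show ?thesis using s by simp
    qed
    have der: "\<exists>G. (Fs has_derivative (\<lambda>h. G \<bullet> h)) (at z) \<and> norm G \<le> M" if z: "z \<in> ball 0 r" for z
    proof -
      let ?G = "\<lambda>\<omega>. \<eta> \<omega> *\<^sub>R gE (z - s *\<^sub>R \<omega>)"
      have AE1: "AE \<omega> in lborel. z - s *\<^sub>R \<omega> \<in> ball 0 r' \<longrightarrow> (E has_derivative (\<lambda>h. gE (z - s *\<^sub>R \<omega>) \<bullet> h)) (at (z - s *\<^sub>R \<omega>)) \<and> norm (gE (z - s *\<^sub>R \<omega>)) \<le> M"
        using AE_lborel_affine_iff[OF _ Eder, of "- s" z] s by simp
      have d: "AE \<omega> in lborel. ((\<lambda>z. \<eta> \<omega> * E (z - s *\<^sub>R \<omega>)) has_derivative (\<lambda>h. ?G \<omega> \<bullet> h)) (at z)"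
        using AE1
      proof eventually_elim
        case (elim \<omega>)
        show ?case
        proof (cases "norm \<omega> \<le> 1")
          case True
          have t: "((\<lambda>z. z - s *\<^sub>R \<omega>) has_derivative (\<lambda>h. h)) (at z)" by (auto intro!: derivative_eq_intros)
          have "((\<lambda>z. E (z - s *\<^sub>R \<omega>)) has_derivative (\<lambda>h. gE (z - s *\<^sub>R \<omega>) \<bullet> h)) (at z)"
            using diff_chain_at[OF t, of E "\<lambda>h. gE (z - s *\<^sub>R \<omega>) \<bullet> h"] elim in_ball[OF z True] by (simp add: o_def)
          from has_derivative_mult_right[OF this, of "\<eta> \<omega>"] show ?thesis by simp
        next
          case False
          then show ?thesis using csmoothD(2)[OF \<eta>(1)] by simp
        qed
      qed
      have gi: "integrable lborel (\<lambda>\<omega>. \<eta> \<omega> * L)" using csmooth_integrable[OF \<eta>(1)] by simp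
      have ll: "AE \<omega> in lborel. \<forall>y. \<bar>\<eta> \<omega> * E (y - s *\<^sub>R \<omega>) - \<eta> \<omega> * E (z - s *\<^sub>R \<omega>)\<bar> \<le> \<eta> \<omega> * L * norm (y - z)"
      proof (intro AE_I2 allI)
        fix \<omega> y
        have "\<bar>\<eta> \<omega> * E (y - s *\<^sub>R \<omega>) - \<eta> \<omega> * E (z - s *\<^sub>R \<omega>)\<bar> = \<eta> \<omega> * \<bar>E (y - s *\<^sub>R \<omega>) - E (z - s *\<^sub>R \<omega>)\<bar>"
          using \<eta>(2)[of \<omega>] by (simp add: right_diff_distrib[symmetric] abs_mult)
        also have "\<dots> \<le> \<eta> \<omega> * (L * norm (y - z))"
          using Elip[of "y - s *\<^sub>R \<omega>" "z - s *\<^sub>R \<omega>"] \<eta>(2) by (intro mult_left_mono) auto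
        finally show "\<bar>\<eta> \<omega> * E (y - s *\<^sub>R \<omega>) - \<eta> \<omega> * E (z - s *\<^sub>R \<omega>)\<bar> \<le> \<eta> \<omega> * L * norm (y - z)" by simp
      qed
      have Gm: "?G \<in> borel_measurable lborel" by measurable
      have "(Fs has_derivative (\<lambda>h. (\<integral>\<omega>. ?G \<omega> \<partial>lborel) \<bullet> h)) (at z)"
        unfolding Fs_def[abs_def] by (rule has_derivative_integral_param(2)[OF int Gm gi ll d])
      moreover have "norm (\<integral>\<omega>. ?G \<omega> \<partial>lborel) \<le> M"
      proof -
        have Gi: "integrable lborel ?G" by (rule has_derivative_integral_param(1)[OF int Gm gi ll d])
        have "norm (\<integral>\<omega>. ?G \<omega> \<partial>lborel) \<le> (\<integral>\<omega>. norm (?G \<omega>) \<partial>lborel)" by (rule integral_norm_bound)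
        also have "\<dots> \<le> (\<integral>\<omega>. \<eta> \<omega> * M \<partial>lborel)"
        proof (rule integral_mono_AE)
          show "AE \<omega> in lborel. norm (?G \<omega>) \<le> \<eta> \<omega> * M"
            using AE1
          proof eventually_elim
            case (elim \<omega>)
            show ?case
            proof (cases "norm \<omega> \<le> 1")
              case True
              then show ?thesis using elim in_ball[OF z True] \<eta>(2)[of \<omega>] by (auto intro!: mult_left_mono)
            next
              case False
              then show ?thesis using csmoothD(2)[OF \<eta>(1)] by simp
            qed
          qed
        qed (use csmooth_integrable[OF \<eta>(1)] integrable_norm[OF Gi] in auto)
        also have "\<dots> = M" using \<eta>(3) by simp
        finally show ?thesis .
      qed
      ultimately show ?thesis by blast
    qed
    then obtain G where G: "\<And>z. z \<in> ball 0 r \<Longrightarrow> (Fs has_derivative (\<lambda>h. G z \<bullet> h)) (at z)"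
      "\<And>z. z \<in> ball 0 r \<Longrightarrow> norm (G z) \<le> M" by metis
    have lipFs: "norm (Fs x - Fs y) \<le> M * norm (x - y)"
    proof (rule differentiable_bound[where f'="\<lambda>z h. G z \<bullet> h" and S="ball 0 r"])
      fix z :: "real^'n" assume z: "z \<in> ball 0 r"
      show "(Fs has_derivative (\<bullet>) (G z)) (at z within ball 0 r)"
        using G(1)[OF z] has_derivative_at_withinI by blast
      show "onorm ((\<bullet>) (G z)) \<le> M"
      proof (rule onorm_le)
        fix h
        have "norm (G z \<bullet> h) \<le> norm (G z) * norm h" using Cauchy_Schwarz_ineq2 by simp
        also have "\<dots> \<le> M * norm h" by (intro mult_right_mono G(2) z) auto
        finally show "norm (G z \<bullet> h) \<le> M * norm h" .
      qed
    qed (use r in auto)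
    have near: "\<bar>Fs z - F z\<bar> \<le> L * s" if z: "z \<in> ball 0 r" for z
    proof -
      have "Fs z - F z = (\<integral>\<omega>. \<eta> \<omega> * E (z - s *\<^sub>R \<omega>) - \<eta> \<omega> * E z \<partial>lborel)"
        using int csmooth_integrable[OF \<eta>(1)] \<eta>(3) EF[of z] z r'(1) by (simp add: Fs_def)
      also have "\<bar>\<dots>\<bar> \<le> (\<integral>\<omega>. \<eta> \<omega> * (L * s) \<partial>lborel)"
      proof (rule order_trans[OF integral_abs_bound integral_mono])
        show "integrable lborel (\<lambda>\<omega>. \<bar>\<eta> \<omega> * E (z - s *\<^sub>R \<omega>) - \<eta> \<omega> * E z\<bar>)"
          using int csmooth_integrable[OF \<eta>(1)] by simp
        show "integrable lborel (\<lambda>\<omega>. \<eta> \<omega> * (L * s))" using csmooth_integrable[OF \<eta>(1)] by simp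
        fix \<omega>
        show "\<bar>\<eta> \<omega> * E (z - s *\<^sub>R \<omega>) - \<eta> \<omega> * E z\<bar> \<le> \<eta> \<omega> * (L * s)"
        proof (cases "norm \<omega> \<le> 1")
          case True
          have "\<bar>E (z - s *\<^sub>R \<omega>) - E z\<bar> \<le> L * (s * norm \<omega>)" using Elip[of "z - s *\<^sub>R \<omega>" z] s by simp
          also have "\<dots> \<le> L * (s * 1)" using True s L by (intro mult_left_mono) auto
          finally have "\<eta> \<omega> * \<bar>E (z - s *\<^sub>R \<omega>) - E z\<bar> \<le> \<eta> \<omega> * (L * s)"
            using \<eta>(2) by (intro mult_left_mono) auto
          then show ?thesis using \<eta>(2)[of \<omega>] by (simp add: right_diff_distrib[symmetric] abs_mult)
        next
          case False
          then show ?thesis using csmoothD(2)[OF \<eta>(1)] by simp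
        qed
      qed
      also have "\<dots> = L * s" using \<eta>(3) by simp
      finally show ?thesis .
    qed
    have "\<bar>Fs x - F x\<bar> \<le> L * s" "\<bar>Fs y - F y\<bar> \<le> L * s" using r by (auto intro!: near)
    with lipFs show ?thesis unfolding real_norm_def by linarith
  qed
  have lim: "((\<lambda>s. M * norm (x - y) + 2 * L * s) \<longlongrightarrow> M * norm (x - y) + 2 * L * 0) (at_right 0)"
    by (intro tendsto_intros)
  have "\<forall>\<^sub>F s in at_right 0. \<bar>F x - F y\<bar> \<le> M * norm (x - y) + 2 * L * s"
    unfolding eventually_at_right_field using M r'(1) by (metis diff_gt_0_iff_gt)
  from tendsto_lowerbound[OF lim this] show ?thesis by simp
qed

section \<open>Vector-valued maps and the Hessian\<close>

lemma has_derivative_vec_nth_iff: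
  fixes G :: "'a::real_normed_vector \<Rightarrow> real^'n"
  shows "(G has_derivative D) (at x) \<longleftrightarrow> (\<forall>i. ((\<lambda>x. G x $ i) has_derivative (\<lambda>h. D h $ i)) (at x))"
  using has_derivative_componentwise_within[of G D x UNIV]
  by (auto simp: Basis_vec_def inner_axis)

lemma differentiable_vec_nth_iff:
  fixes G :: "'a::real_normed_vector \<Rightarrow> real^'n"
  shows "G differentiable (at x) \<longleftrightarrow> (\<forall>i. (\<lambda>x. G x $ i) differentiable (at x))"
proof
  assume "\<forall>i. (\<lambda>x. G x $ i) differentiable (at x)"
  then obtain D where "\<And>i. ((\<lambda>x. G x $ i) has_derivative D i) (at x)" unfolding differentiable_def by metis
  then have "(G has_derivative (\<lambda>h. \<chi> i. D i h)) (at x)" by (simp add: has_derivative_vec_nth_iff)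
  then show "G differentiable (at x)" unfolding differentiable_def by blast
qed (auto simp: differentiable_def has_derivative_vec_nth_iff)

lemma rademacher_ball_vec:
  fixes G :: "real^'n \<Rightarrow> real^'m"
  assumes lip: "\<And>x y. x \<in> ball 0 \<rho> \<Longrightarrow> y \<in> ball 0 \<rho> \<Longrightarrow> norm (G x - G y) \<le> K * norm (x - y)"
    and K: "0 \<le> K"
  shows "AE x in lborel. x \<in> ball 0 \<rho> \<longrightarrow> G differentiable (at x)"
proof -
  have "AE x in lborel. x \<in> ball 0 \<rho> \<longrightarrow> (\<lambda>x. G x $ i) differentiable (at x)" for i
  proof (rule rademacher_ball[OF _ K])
    fix x y :: "real^'n" assume "x \<in> ball 0 \<rho>" "y \<in> ball 0 \<rho>"
    from lip[OF this] show "\<bar>G x $ i - G y $ i\<bar> \<le> K * norm (x - y)"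
      using component_le_norm_cart[of "G x - G y" i] by simp
  qed
  then have "AE x in lborel. \<forall>i. x \<in> ball 0 \<rho> \<longrightarrow> (\<lambda>x. G x $ i) differentiable (at x)"
    by (subst AE_all_countable) blast
  then show ?thesis by eventually_elim (auto simp: differentiable_vec_nth_iff)
qed

text \<open>The essential supremum of a non-measurable function is infinite by definition, so measurability of the
  operator norm of the Hessian matters.\<close>

lemma borel_measurable_onorm_matrix:
  fixes A :: "'m::finite \<Rightarrow> 'n::finite \<Rightarrow> 'w \<Rightarrow> real"
  assumes [measurable]: "\<And>i j. A i j \<in> borel_measurable M"
  shows "(\<lambda>x. onorm (\<lambda>h::real^'n. (\<chi> i. \<Sum>j\<in>UNIV. A i j x * h $ j) :: real^'m)) \<in> borel_measurable M"
  unfolding borel_measurable_iff_le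
proof
  fix a :: real
  let ?A = "\<lambda>x h. (\<chi> i. \<Sum>j\<in>UNIV. A i j x * h $ j) :: real^'m"
  obtain Q :: "(real^'n) set" where Q: "countable Q" "\<And>X. open X \<Longrightarrow> X \<noteq> {} \<Longrightarrow> \<exists>q\<in>Q. q \<in> X"
    using countable_dense_setE by blast
  have cont: "continuous_on UNIV (?A x)" for x
    by (intro continuous_intros)
  have bl: "bounded_linear (?A x)" for x
    by (intro linear_conv_bounded_linear[THEN iffD1] linearI)
       (auto simp: vec_eq_iff sum.distrib distrib_left sum_distrib_left mult_ac)
  have "onorm (?A x) \<le> a \<longleftrightarrow> (\<forall>h\<in>Q. norm (?A x h) \<le> a * norm h)" for x
  proof
    assume "onorm (?A x) \<le> a"
    then show "\<forall>h\<in>Q. norm (?A x h) \<le> a * norm h"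
      using onorm[OF bl] by (meson mult_right_mono norm_ge_zero order_trans)
  next
    assume R: "\<forall>h\<in>Q. norm (?A x h) \<le> a * norm h"
    have "open {h. a * norm h < norm (?A x h)}"
      by (intro open_Collect_less continuous_intros)
    then have "{h. a * norm h < norm (?A x h)} = {}"
      using Q(2) R by (metis (mono_tags, lifting) mem_Collect_eq not_less)
    then show "onorm (?A x) \<le> a" by (intro onorm_le) (auto simp: not_less)
  qed
  then have "{x \<in> space M. onorm (?A x) \<le> a} = {x \<in> space M. \<forall>h\<in>Q. norm (?A x h) \<le> a * norm h}" by simp
  also have "\<dots> \<in> sets M"
  proof -
    have "Measurable.pred M (\<lambda>x. norm (?A x h) \<le> a * norm h)" for h
    proof -
      have "(\<lambda>x. ?A x h $ i) \<in> borel_measurable M" for i by simp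
      then have [measurable]: "(\<lambda>x. ?A x h) \<in> borel_measurable M"
        by (subst borel_measurable_euclidean_space) (auto simp: Basis_vec_def inner_axis)
      show ?thesis by measurable
    qed
    then have "Measurable.pred M (\<lambda>x. \<forall>n. norm (?A x (from_nat_into Q n)) \<le> a * norm (from_nat_into Q n))"
      by (intro pred_intros_countable)
    moreover have "Q \<noteq> {}" using Q(2)[of UNIV] by auto
    then have "(\<forall>h\<in>Q. P h) \<longleftrightarrow> (\<forall>n. P (from_nat_into Q n))" for P
      using from_nat_into[of Q] from_nat_into_surj[OF Q(1)] by metis
    ultimately have "Measurable.pred M (\<lambda>x. \<forall>h\<in>Q. norm (?A x h) \<le> a * norm h)" by simp
    then show ?thesis by (simp add: pred_def)
  qed
  finally show "{x \<in> space M. onorm (?A x) \<le> a} \<in> sets M" .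
qed

text \<open>Rademacher's theorem gives the Hessian almost everywhere and the Lipschitz constant
  bounds it. The work lies in identifying its operator norm almost everywhere with the measurable
  function \<open>N\<close>.\<close>

lemma hess_Linf_le:
  fixes w :: "real^'n \<Rightarrow> real"
  assumes lip: "\<And>x y. x \<in> ball 0 \<rho> \<Longrightarrow> y \<in> ball 0 \<rho> \<Longrightarrow> norm (grad w x - grad w y) \<le> K * norm (x - y)"
    and K: "0 \<le> K"
  shows "hess_Linf (ball 0 \<rho>) w \<le> ereal K"
proof -
  let ?B = "ball (0::real^'n) \<rho>"
  \<comment> \<open>Second derivatives as limits of difference quotients; the indicator is there
    because \<open>grad w\<close> is known to be continuous on the ball only.\<close>
  define A where "A i j x = lim (\<lambda>n. dquot (\<lambda>y. indicator ?B y * grad w y $ i) (axis j 1) n x)" for i j x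
  have cG: "continuous_on ?B (grad w)"
    by (rule lipschitz_on_continuous_on[of K]) (use lip K in \<open>auto intro!: lipschitz_onI simp: dist_norm\<close>)
  have m1: "(\<lambda>y. indicator ?B y * grad w y $ i) \<in> borel_measurable borel" for i
    using borel_measurable_continuous_on_indicator[of ?B "\<lambda>y. grad w y $ i"] cG
    by (auto intro!: continuous_intros)
  have Am [measurable]: "A i j \<in> borel_measurable borel" for i j
    unfolding A_def dquot_def using m1[of i, measurable] by measurable
  define N where "N x = onorm (\<lambda>h::real^'n. (\<chi> i. \<Sum>j\<in>UNIV. A i j x * h $ j) :: real^'n)" for x
  have Nm: "N \<in> borel_measurable borel" unfolding N_def by (rule borel_measurable_onorm_matrix) measurable
  have rad: "AE x in lborel. x \<in> ?B \<longrightarrow> grad w differentiable (at x)"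
    by (rule rademacher_ball_vec[OF lip K])
  have main: "AE x in lborel. x \<in> ?B \<longrightarrow> onorm (hess w x) = N x \<and> onorm (hess w x) \<le> K"
    using rad
  proof eventually_elim
    case (elim x)
    show ?case
    proof
      assume x: "x \<in> ?B"
      have D: "(grad w has_derivative hess w x) (at x)"
        using elim x unfolding hess_def frechet_derivative_works[symmetric] by blast
      have "onorm (hess w x) \<le> K"
      proof (rule onorm_le)
        fix h show "norm (hess w x h) \<le> K * norm h"
          by (rule has_derivative_norm_le_local_lipschitz[OF D open_ball x]) (use lip x in auto)
      qed
      moreover have "hess w x h $ i = (\<Sum>j\<in>UNIV. A i j x * h $ j)" for h i
      proof -
        define d where "d = (\<chi> j. hess w x (axis j 1) $ i)"
        have Di: "((\<lambda>x. grad w x $ i) has_derivative (\<lambda>h. hess w x h $ i)) (at x)"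
          using D by (simp add: has_derivative_vec_nth_iff)
        have eq: "hess w x h $ i = d \<bullet> h" for h
          unfolding d_def by (rule linear_eq_sum_axis[OF has_derivative_linear[OF Di]])
        have "((\<lambda>y. indicator ?B y * grad w y $ i) has_derivative (\<lambda>h. d \<bullet> h)) (at x)"
          using Di unfolding eq
          by (rule has_derivative_transform_within_open[of _ _ _ _ ?B]) (use x in auto)
        from limI[OF dquot_tendsto[OF this]] have "A i j x = d $ j" for j
          by (simp add: A_def inner_axis_one)
        then show ?thesis by (simp add: eq inner_vec_def)
      qed
      then have "hess w x = (\<lambda>h. \<chi> i. \<Sum>j\<in>UNIV. A i j x * h $ j)"
        by (simp add: fun_eq_iff vec_eq_iff)
      ultimately show "onorm (hess w x) = N x \<and> onorm (hess w x) \<le> K" by (simp add: N_def)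
    qed
  qed
  then have mainL: "AE x in lebesgue. x \<in> ?B \<longrightarrow> onorm (hess w x) = N x \<and> onorm (hess w x) \<le> K"
    by (rule AE_completion)
  have "(\<lambda>x. if x \<in> ?B then onorm (hess w x) else N x) \<in> borel_measurable lebesgue"
  proof (rule borel_measurable_AE)
    show "N \<in> borel_measurable lebesgue" using Nm by (simp add: measurable_completion)
    show "AE x in lebesgue. N x = (if x \<in> ?B then onorm (hess w x) else N x)"
      using mainL by eventually_elim auto
  qed
  then have "(\<lambda>x. if x \<in> ?B then onorm (hess w x) else N x) \<in> borel_measurable (lebesgue_on ?B)"
    by (rule measurable_restrict_space1)
  then have "(\<lambda>x. onorm (hess w x)) \<in> borel_measurable (lebesgue_on ?B)"
    by (rule measurable_cong[THEN iffD1, rotated]) (auto simp: space_restrict_space)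
  then have meas: "(\<lambda>x. ereal (onorm (hess w x))) \<in> borel_measurable (lebesgue_on ?B)" by simp
  have "AE x in lebesgue_on ?B. ereal (onorm (hess w x)) \<le> ereal K"
    by (subst AE_restrict_space_iff) (use mainL in \<open>auto elim: eventually_mono\<close>)
  with meas show ?thesis unfolding hess_Linf_def by (rule esssup_I)
qed

text \<open>The scalar estimate is applied to the component of \<open>grad v\<close> along the
  vector p = grad v x - grad v y, with gradient bound |p| M. At \<open>x\<close> and
  \<open>y\<close> it says that the square of |p| is at most |p| M |x - y|. The constant
  \<open>K\<close> supplies differentiability, \<open>M\<close> the bound.\<close>

lemma grad_lipschitz_hess_Linf:
  fixes v :: "real^'n \<Rightarrow> real"
  assumes lip: "\<And>x y. x \<in> ball 0 \<rho> \<Longrightarrow> y \<in> ball 0 \<rho> \<Longrightarrow> norm (grad v x - grad v y) \<le> K * norm (x - y)"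
    and K: "0 \<le> K" and M: "hess_Linf (ball 0 \<rho>) v \<le> ereal M"
    and xy: "x \<in> ball 0 \<rho>" "y \<in> ball 0 \<rho>"
  shows "norm (grad v x - grad v y) \<le> M * norm (x - y)"
proof -
  have rad: "AE x in lborel. x \<in> ball 0 \<rho> \<longrightarrow> grad v differentiable (at x)"
    by (rule rademacher_ball_vec[OF lip K])
  have "AE x in lebesgue_on (ball 0 \<rho>). ereal (onorm (hess v x)) \<le> ereal M"
    using esssup_AE[of "\<lambda>x. ereal (onorm (hess v x))" "lebesgue_on (ball 0 \<rho>)"]
    by eventually_elim (rule order_trans[OF _ M[unfolded hess_Linf_def]])
  then have "AE x in lebesgue. x \<in> ball 0 \<rho> \<longrightarrow> onorm (hess v x) \<le> M"
    by (subst (asm) AE_restrict_space_iff) auto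
  then have bd: "AE x in lborel. x \<in> ball 0 \<rho> \<longrightarrow> onorm (hess v x) \<le> M"
    unfolding AE_completion_iff .
  let ?p = "grad v x - grad v y"
  have "\<bar>?p \<bullet> grad v x - ?p \<bullet> grad v y\<bar> \<le> norm ?p * M * norm (x - y)"
  proof (rule lipschitz_ball_if_AE_gradient_le[where \<rho>=\<rho> and L="norm ?p * K"])
    show "\<bar>?p \<bullet> grad v z - ?p \<bullet> grad v w\<bar> \<le> norm ?p * K * norm (z - w)" if "z \<in> ball 0 \<rho>" "w \<in> ball 0 \<rho>" for z w
    proof -
      have "\<bar>?p \<bullet> (grad v z - grad v w)\<bar> \<le> norm ?p * norm (grad v z - grad v w)" by (rule Cauchy_Schwarz_ineq2)
      also have "\<dots> \<le> norm ?p * (K * norm (z - w))" by (intro mult_left_mono lip that) auto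
      finally show ?thesis by (simp add: inner_diff_right)
    qed
    show "AE z in lborel. z \<in> ball 0 \<rho> \<longrightarrow> (\<exists>D. ((\<lambda>x. ?p \<bullet> grad v x) has_derivative (\<lambda>h. D \<bullet> h)) (at z) \<and> norm D \<le> norm ?p * M)"
      using rad bd
    proof eventually_elim
      case (elim z)
      show ?case
      proof
        assume z: "z \<in> ball 0 \<rho>"
        have D: "(grad v has_derivative hess v z) (at z)"
          using elim(1) z unfolding hess_def frechet_derivative_works[symmetric] by blast
        have "((\<lambda>x. ?p \<bullet> grad v x) has_derivative (\<lambda>h. ?p \<bullet> hess v z h)) (at z)"
          by (rule has_derivative_inner_right[OF D])
        moreover have "linear (\<lambda>h. ?p \<bullet> hess v z h)"
          using calculation by (rule has_derivative_linear)
        from linear_eq_sum_axis[OF this] obtain d where d: "\<And>h. ?p \<bullet> hess v z h = d \<bullet> h" by blast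
        have "norm d \<le> norm ?p * M"
        proof -
          have "norm d * norm d = ?p \<bullet> hess v z d" by (simp add: d power2_norm_eq_inner[symmetric] power2_eq_square)
          also have "\<dots> \<le> norm ?p * norm (hess v z d)" by (rule norm_cauchy_schwarz)
          also have "\<dots> \<le> norm ?p * (M * norm d)"
          proof (rule mult_left_mono)
            have "onorm (hess v z) * norm d \<le> M * norm d" using elim(2) z by (intro mult_right_mono) auto
            then show "norm (hess v z d) \<le> M * norm d"
              using onorm[OF has_derivative_bounded_linear[OF D], of d] by linarith
          qed simp
          finally have "norm d * norm d \<le> (norm ?p * M) * norm d" by simp
          moreover have "0 \<le> M"
            using elim(2) z onorm_pos_le[OF has_derivative_bounded_linear[OF D]] by linarith
          ultimately show ?thesis by (cases "d = 0") auto
        qed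
        ultimately show "\<exists>D. ((\<lambda>x. ?p \<bullet> grad v x) has_derivative (\<lambda>h. D \<bullet> h)) (at z) \<and> norm D \<le> norm ?p * M"
          unfolding d by blast
      qed
    qed
  qed (use xy K in auto)
  then have "norm ?p * norm ?p \<le> norm ?p * (M * norm (x - y))"
    by (simp add: inner_diff_right[symmetric] power2_norm_eq_inner[symmetric] power2_eq_square mult.assoc)
  \<comment> \<open>For negative \<open>M\<close> the operator norms would be negative almost
    everywhere on a ball of positive measure. The sign settles the case p = 0.\<close>
  moreover have "0 \<le> M" 
  proof (rule ccontr)
    assume "\<not> 0 \<le> M"
    have "AE z in lborel. z \<notin> ball (0::real^'n) \<rho>"
      using rad bd
    proof eventually_elim
      case (elim z)
      show ?case
      proof
        assume z: "z \<in> ball 0 \<rho>"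
        have D: "(grad v has_derivative hess v z) (at z)"
          using elim(1) z unfolding hess_def frechet_derivative_works[symmetric] by blast
        then show False using elim(2) z onorm_pos_le[OF has_derivative_bounded_linear[OF D]] \<open>\<not> 0 \<le> M\<close> by linarith
      qed
    qed
    then have "ball (0::real^'n) \<rho> \<in> null_sets lborel" by (rule AE_iff_null_sets[THEN iffD2, rotated]) simp
    then have "emeasure lborel (ball (0::real^'n) \<rho>) = 0" by auto
    moreover have "\<rho> > 0" using xy(1) by (auto intro: le_less_trans[OF norm_ge_zero])
    ultimately show False using content_ball_pos[of \<rho> "0::real^'n"] by (simp add: measure_def)
  qed
  ultimately show ?thesis by (cases "?p = 0") auto
qed

subsection \<open>Rescaled kernels\<close>

definition scl :: "real \<Rightarrow> real \<Rightarrow> (real^'n::finite \<Rightarrow> real) \<Rightarrow> real^'n \<Rightarrow> real" where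
  "scl a c \<phi> x = a * \<phi> (c *\<^sub>R x)"

lemma csmooth_scl:
  assumes "csmooth 1 \<phi>" "c > 0" shows "csmooth (1 / c) (scl a c \<phi>)"
  using csmooth_cmult[OF csmooth_scale[OF assms], of a] by (simp add: scl_def[abs_def])

lemma pd_scl:
  assumes "csmooth R \<phi>" shows "pd i (scl a c \<phi>) = scl (a * c) c (pd i \<phi>)"
proof
  fix x
  note d = pd_affine[OF csmooth_differentiable[OF assms], where a=0 and c=c and x=x]
  have "pd i (\<lambda>x. a * \<phi> (0 + c *\<^sub>R x)) x = a * pd i (\<lambda>x. \<phi> (0 + c *\<^sub>R x)) x"
    by (rule pd_cmult[OF d(1)])
  also have "\<dots> = scl (a * c) c (pd i \<phi>) x" unfolding d(2) by (simp add: scl_def)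
  finally show "pd i (scl a c \<phi>) x = scl (a * c) c (pd i \<phi>) x" by (simp add: scl_def[abs_def])
qed

lemma scl_bound: "(\<And>x. \<bar>\<phi> x\<bar> \<le> C) \<Longrightarrow> \<bar>scl a c \<phi> x\<bar> \<le> \<bar>a\<bar> * C"
  by (auto simp: scl_def abs_mult intro!: mult_left_mono)

text \<open>One constant covers all derivatives that occur: those of \<psi> up to order two for the
  change of values, gradients and Hessians between scales, order three for the variation of a
  Hessian in space, and those of \<eta> for the coarsest scale.\<close>

locale mollifier =
  fixes \<eta> \<psi> :: "real^'n \<Rightarrow> real" and Cm :: real
  assumes \<eta>: "csmooth 1 \<eta>" and \<psi>: "csmooth 1 \<psi>" and \<eta>_nonneg: "\<And>x. 0 \<le> \<eta> x"
    and \<eta>_integral: "(\<integral>x. \<eta> x \<partial>lborel) = 1"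
    and lap_\<psi>: "\<And>x. lap \<psi> x = \<eta> x - 4 ^ CARD('n) * \<eta> (4 *\<^sub>R x)"
    and \<psi>_bounds: "\<And>x. \<bar>\<psi> x\<bar> \<le> Cm" "\<And>i x. \<bar>pd i \<psi> x\<bar> \<le> Cm" "\<And>i j x. \<bar>pd j (pd i \<psi>) x\<bar> \<le> Cm"
      "\<And>i j k x. \<bar>pd k (pd j (pd i \<psi>)) x\<bar> \<le> Cm"
    and \<eta>_bounds: "\<And>i j x. \<bar>pd j (pd i \<eta>) x\<bar> \<le> Cm" "\<And>i j k x. \<bar>pd k (pd j (pd i \<eta>)) x\<bar> \<le> Cm"
begin

lemma Cm_nonneg: "0 \<le> Cm"
  using \<psi>_bounds(1)[of 0] by linarith

definition etaS :: "real \<Rightarrow> real^'n \<Rightarrow> real" where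
  "etaS r = scl ((1 / r) ^ CARD('n)) (1 / r) \<eta>"

text \<open>The extra factor r^2 compensates the two derivatives of the Laplacian, so that
  \<open>lap_psiS\<close> compares kernels of mass one.\<close>

definition psiS :: "real \<Rightarrow> real^'n \<Rightarrow> real" where
  "psiS r = scl (r\<^sup>2 * (1 / r) ^ CARD('n)) (1 / r) \<psi>"

lemma csmooth_etaS: "r > 0 \<Longrightarrow> csmooth r (etaS r)"
  unfolding etaS_def using csmooth_scl[OF \<eta>, of "1 / r"] by simp

lemma csmooth_psiS: "r > 0 \<Longrightarrow> csmooth r (psiS r)"
  unfolding psiS_def using csmooth_scl[OF \<psi>, of "1 / r"] by simp

lemma etaS_nonneg: "r > 0 \<Longrightarrow> 0 \<le> etaS r x"
  by (simp add: etaS_def scl_def \<eta>_nonneg)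

lemma etaS_integral: assumes "r > 0" shows "(\<integral>x. etaS r x \<partial>lborel) = 1"
proof -
  have "1 = \<bar>1 / r\<bar> ^ CARD('n) * (\<integral>x. \<eta> (0 + (1 / r) *\<^sub>R x) \<partial>lborel)"
    using lborel_integral_affine(1)[of "1 / r" \<eta> 0] csmooth_borel[OF \<eta>] assms \<eta>_integral by simp
  then show ?thesis using assms by (simp add: etaS_def scl_def)
qed

lemma etaS_abs_integral: assumes "r > 0" shows "(\<integral>x. \<bar>etaS r x\<bar> \<partial>lborel) = 1"
  using etaS_integral[OF assms] etaS_nonneg[OF assms] by simp

lemma lap_psiS: assumes "r > 0" shows "lap (psiS r) x = etaS r x - etaS (r / 4) x"
proof -
  have "pd i (pd i (psiS r)) x = scl ((1 / r) ^ CARD('n)) (1 / r) (pd i (pd i \<psi>)) x" for i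
    unfolding psiS_def pd_scl[OF \<psi>] pd_scl[OF csmooth_pd[OF \<psi>]] using assms
    by (simp add: scl_def power2_eq_square)
  then have "lap (psiS r) x = (1 / r) ^ CARD('n) * lap \<psi> ((1 / r) *\<^sub>R x)"
    by (simp add: lap_def scl_def sum_distrib_left)
  then show ?thesis
    using assms by (simp add: lap_\<psi> etaS_def scl_def right_diff_distrib power_divide power_mult_distrib)
qed

lemma psiS_bounds:
  assumes "r > 0"
  shows "\<bar>psiS r x\<bar> \<le> r\<^sup>2 * (1 / r) ^ CARD('n) * Cm"
    and "\<bar>pd i (psiS r) x\<bar> \<le> r * (1 / r) ^ CARD('n) * Cm"
    and "\<bar>pd j (pd i (psiS r)) x\<bar> \<le> (1 / r) ^ CARD('n) * Cm"
    and "\<bar>pd k (pd j (pd i (psiS r))) x\<bar> \<le> (1 / r) * (1 / r) ^ CARD('n) * Cm"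
proof -
  note sc = pd_scl[OF \<psi>] pd_scl[OF csmooth_pd[OF \<psi>]] pd_scl[OF csmooth_pd[OF csmooth_pd[OF \<psi>]]]
  have e: "r\<^sup>2 * (1 / r) ^ CARD('n) * (1 / r) = r * (1 / r) ^ CARD('n)"
    "r * (1 / r) ^ CARD('n) * (1 / r) = (1 / r) ^ CARD('n)"
    "(1 / r) ^ CARD('n) * (1 / r) = (1 / r) * (1 / r) ^ CARD('n)"
    using assms by (auto simp: power2_eq_square)
  show "\<bar>psiS r x\<bar> \<le> r\<^sup>2 * (1 / r) ^ CARD('n) * Cm"
    unfolding psiS_def using scl_bound[OF \<psi>_bounds(1), of "r\<^sup>2 * (1 / r) ^ CARD('n)"] assms by simp
  show "\<bar>pd i (psiS r) x\<bar> \<le> r * (1 / r) ^ CARD('n) * Cm"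
    unfolding psiS_def sc e using scl_bound[OF \<psi>_bounds(2), of "r * (1 / r) ^ CARD('n)"] assms by simp
  show "\<bar>pd j (pd i (psiS r)) x\<bar> \<le> (1 / r) ^ CARD('n) * Cm"
    unfolding psiS_def sc e using scl_bound[OF \<psi>_bounds(3), of "(1 / r) ^ CARD('n)"] assms by simp
  show "\<bar>pd k (pd j (pd i (psiS r))) x\<bar> \<le> (1 / r) * (1 / r) ^ CARD('n) * Cm"
    unfolding psiS_def sc e using scl_bound[OF \<psi>_bounds(4), of "(1 / r) * (1 / r) ^ CARD('n)"] assms by simp
qed

lemma etaS_bounds:
  assumes "r > 0"
  shows "\<bar>pd j (pd i (etaS r)) x\<bar> \<le> (1 / r) ^ (CARD('n) + 2) * Cm"
    and "\<bar>pd k (pd j (pd i (etaS r))) x\<bar> \<le> (1 / r) ^ (CARD('n) + 3) * Cm"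
proof -
  note sc = pd_scl[OF \<eta>] pd_scl[OF csmooth_pd[OF \<eta>]] pd_scl[OF csmooth_pd[OF csmooth_pd[OF \<eta>]]]
  have e: "(1 / r) ^ CARD('n) * (1 / r) * (1 / r) = (1 / r) ^ (CARD('n) + 2)"
    "(1 / r) ^ (CARD('n) + 2) * (1 / r) = (1 / r) ^ (CARD('n) + 3)"
    by (simp_all add: power_add power2_eq_square power3_eq_cube)
  show "\<bar>pd j (pd i (etaS r)) x\<bar> \<le> (1 / r) ^ (CARD('n) + 2) * Cm"
    unfolding etaS_def sc e using scl_bound[OF \<eta>_bounds(1), of "(1 / r) ^ (CARD('n) + 2)"] assms by simp
  show "\<bar>pd k (pd j (pd i (etaS r))) x\<bar> \<le> (1 / r) ^ (CARD('n) + 3) * Cm"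
    unfolding etaS_def sc e using scl_bound[OF \<eta>_bounds(2), of "(1 / r) ^ (CARD('n) + 3)"] assms by simp
qed

end

section \<open>Scales, and the mollifications of a function with bounded Laplacian\<close>

definition unit_vol :: "'n::finite itself \<Rightarrow> real" where
  "unit_vol _ = measure lborel (cball (0::real^'n) 1)"

lemma unit_vol_nonneg: "0 \<le> unit_vol t"
  by (simp add: unit_vol_def)

lemma measure_cball_scale:
  fixes x :: "real^'n"
  assumes "r \<ge> 0" shows "measure lborel (cball x r) = r ^ CARD('n) * unit_vol TYPE('n)"
  using assms content_cball[of r x] content_cball[of 1 "0::real^'n"] by (simp add: unit_vol_def mult.commute)

text \<open>The ratio 4 is that of the two kernels in \<open>lap_psiS\<close>. Starting at 1/16
  keeps the balls and mean value points that arise around points of the half ball inside the ball of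
  radius 3/4.\<close>

definition rad :: "nat \<Rightarrow> real" where "rad k = (1 / 4) ^ k / 16"

lemma rad_pos: "rad k > 0" and rad_Suc: "rad (Suc k) = rad k / 4" and rad_le: "rad k \<le> 1 / 16"
  and rad_0: "rad 0 = 1 / 16"
  by (simp_all add: rad_def power_le_one)

lemma rad_antimono: "k \<le> m \<Longrightarrow> rad m \<le> rad k"
  unfolding rad_def by (simp add: power_decreasing)

lemma rad_tendsto_0: "rad \<longlonglongrightarrow> 0"
  unfolding rad_def by (intro tendsto_eq_intros LIMSEQ_power_zero) auto

text \<open>By \<open>weak\<close> the Laplacian of \<open>h\<close> is \<open>g\<close> in the unit
  ball. One number \<open>A\<close> dominates both the right-hand side and the L1 norm of
  \<open>h\<close>, so the estimates scale with it.\<close>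

locale potential_pair = mollifier \<eta> \<psi> Cm for \<eta> \<psi> :: "real^'n \<Rightarrow> real" and Cm +
  fixes h g :: "real^'n \<Rightarrow> real" and \<Lambda> :: "(real^'n) set" and A :: real
  assumes h: "integrable lborel h" and g: "integrable lborel g" and A: "A > 0"
    and g_le: "\<And>y. \<bar>g y\<bar> \<le> A" and \<Lambda> [measurable]: "\<Lambda> \<in> sets borel" and g_supp: "\<And>y. y \<notin> \<Lambda> \<Longrightarrow> g y = 0"
    and weak: "\<And>\<phi>. test_fun (ball 0 1) \<phi> \<Longrightarrow> (\<integral>y. h y * lap \<phi> y \<partial>lborel) = (\<integral>y. g y * \<phi> y \<partial>lborel)"
    and h_le: "(\<integral>y. \<bar>h y\<bar> \<partial>lborel) \<le> A"
begin

abbreviation S :: "(real^'n) set" where "S \<equiv> ball 0 (3/4)"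

definition hk :: "nat \<Rightarrow> real^'n \<Rightarrow> real" where "hk k = conv h (etaS (rad k))"

definition mu :: "real \<Rightarrow> real^'n \<Rightarrow> real" where "mu r x = measure lborel (\<Lambda> \<inter> cball x r)"

lemma mu_le: "r \<ge> 0 \<Longrightarrow> mu r x \<le> r ^ CARD('n) * unit_vol TYPE('n)"
  unfolding mu_def measure_cball_scale[symmetric, where x=x]
  by (rule measure_mono_fmeasurable) (auto intro!: fmeasurableI emeasure_bounded_finite[unfolded infinity_ennreal_def])

lemma mu_nonneg: "0 \<le> mu r x" by (simp add: mu_def)

lemma integral_g_le: "(\<integral>y. indicator (cball x r) y * \<bar>g y\<bar> \<partial>lborel) \<le> A * mu r x"
proof -
  have fin: "emeasure lborel (\<Lambda> \<inter> cball x r) < \<infinity>"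
    by (rule emeasure_bounded_finite) (auto intro: bounded_subset[OF bounded_cball])
  have "(\<integral>y. indicator (cball x r) y * \<bar>g y\<bar> \<partial>lborel) \<le> (\<integral>y. A * indicator (\<Lambda> \<inter> cball x r) y \<partial>lborel)"
  proof (rule integral_mono)
    show "integrable lborel (\<lambda>y. indicator (cball x r) y * \<bar>g y\<bar>)"
      using integrable_mult_indicator[of "cball x r" lborel "\<lambda>y. \<bar>g y\<bar>"] g by simp
    show "integrable lborel (\<lambda>y. A * indicator (\<Lambda> \<inter> cball x r) y)"
      using fin by (intro integrable_mult_right integrable_real_indicator) auto
    show "indicator (cball x r) y * \<bar>g y\<bar> \<le> A * indicator (\<Lambda> \<inter> cball x r) y" for y
      using g_le[of y] g_supp[of y] A by (auto simp: indicator_def)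
  qed
  then show ?thesis by (simp add: mu_def)
qed

lemma hk_smooth: "smooth_fun (hk k)"
  unfolding hk_def by (rule smooth_fun_conv[OF h csmooth_etaS[OF rad_pos]])

lemma hk_pd: "pd i (hk k) = conv h (pd i (etaS (rad k)))"
  "pd j (pd i (hk k)) = conv h (pd j (pd i (etaS (rad k))))"
  "pd l (pd j (pd i (hk k))) = conv h (pd l (pd j (pd i (etaS (rad k)))))"
  unfolding hk_def
  using pd_conv[OF h csmooth_etaS[OF rad_pos]] pd_conv[OF h csmooth_pd[OF csmooth_etaS[OF rad_pos]]]
    pd_conv[OF h csmooth_pd[OF csmooth_pd[OF csmooth_etaS[OF rad_pos]]]]
  by metis+

text \<open>The weak equation is tested with the reflected kernel; around a point of
  \<open>S\<close> a kernel of radius at most 1/4 stays inside the unit ball.\<close>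

lemma conv_lap:
  assumes "csmooth r \<phi>" "x \<in> S" "r \<le> 1/4"
  shows "conv h (lap \<phi>) x = conv g \<phi> x"
proof -
  have "cball x r \<subseteq> ball 0 1"
  proof
    fix y assume "y \<in> cball x r"
    then have "norm (y - x) \<le> r" by (simp add: dist_norm norm_minus_commute)
    then show "y \<in> ball 0 1" using norm_triangle_ineq[of x "y - x"] assms(2,3) by simp
  qed
  from weak[OF test_fun_reflect[OF assms(1) this]] show ?thesis
    by (simp add: conv_def lap_reflect[OF assms(1)])
qed

lemma hk_diff: "x \<in> S \<Longrightarrow> hk k x - hk (Suc k) x = conv g (psiS (rad k)) x"
proof -
  assume x: "x \<in> S"
  have "hk k x - hk (Suc k) x = conv h (lap (psiS (rad k))) x"
  proof -
    have "lap (psiS (rad k)) = (\<lambda>x. etaS (rad k) x + (-1) * etaS (rad (Suc k)) x)"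
      using lap_psiS[OF rad_pos] by (simp add: fun_eq_iff rad_Suc)
    then show ?thesis
      using conv_add[OF h csmooth_etaS[OF rad_pos] csmooth_cmult[OF csmooth_etaS[OF rad_pos]], of k "-1" "Suc k" x]
      by (simp only: conv_cmult hk_def)
  qed
  also have "\<dots> = conv g (psiS (rad k)) x"
    by (rule conv_lap[OF csmooth_psiS[OF rad_pos] x]) (use rad_le[of k] in simp)
  finally show ?thesis .
qed

lemma pd_diff_on_S:
  assumes "\<And>x. x \<in> S \<Longrightarrow> f x - f' x = p x" "smooth_fun f" "smooth_fun f'" "x \<in> S"
  shows "pd i f x - pd i f' x = pd i p x"
proof -
  have "pd i p x = pd i (\<lambda>x. f x + (-1) * f' x) x"
    by (rule pd_cong_open[of S]) (use assms(1,4) in auto)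
  also have "\<dots> = pd i f x + pd i (\<lambda>x. (-1) * f' x) x"
    by (intro pd_add smooth_fun_differentiable assms(2) smooth_fun_cmult assms(3))
  also have "pd i (\<lambda>x. (-1) * f' x) x = (-1) * pd i f' x"
    using assms(3) by (intro pd_cmult smooth_fun_differentiable)
  finally show ?thesis by simp
qed

lemma hk_pd_diff:
  assumes x: "x \<in> S"
  shows "pd i (hk k) x - pd i (hk (Suc k)) x = conv g (pd i (psiS (rad k))) x"
    and "pd j (pd i (hk k)) x - pd j (pd i (hk (Suc k))) x = conv g (pd j (pd i (psiS (rad k)))) x"
    and "pd l (pd j (pd i (hk k))) x - pd l (pd j (pd i (hk (Suc k)))) x = conv g (pd l (pd j (pd i (psiS (rad k))))) x"
proof -
  note cs = csmooth_psiS[OF rad_pos[of k]]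
  have 1: "pd i (hk k) x - pd i (hk (Suc k)) x = conv g (pd i (psiS (rad k))) x" if "x \<in> S" for x i
    unfolding pd_conv[OF g cs, symmetric]
    by (rule pd_diff_on_S) (use that hk_diff hk_smooth in auto)
  have 2: "pd j (pd i (hk k)) x - pd j (pd i (hk (Suc k))) x = conv g (pd j (pd i (psiS (rad k)))) x" if "x \<in> S" for x i j
    unfolding pd_conv[OF g csmooth_pd[OF cs], symmetric]
    by (rule pd_diff_on_S) (use that 1 in \<open>auto intro: hk_smooth smooth_fun_pd\<close>)
  have 3: "pd l (pd j (pd i (hk k))) x - pd l (pd j (pd i (hk (Suc k)))) x = conv g (pd l (pd j (pd i (psiS (rad k))))) x" if "x \<in> S" for x i j l
    unfolding pd_conv[OF g csmooth_pd[OF csmooth_pd[OF cs]], symmetric]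
    by (rule pd_diff_on_S) (use that 2 in \<open>auto intro: hk_smooth smooth_fun_pd\<close>)
  show "pd i (hk k) x - pd i (hk (Suc k)) x = conv g (pd i (psiS (rad k))) x"
    "pd j (pd i (hk k)) x - pd j (pd i (hk (Suc k))) x = conv g (pd j (pd i (psiS (rad k)))) x"
    "pd l (pd j (pd i (hk k))) x - pd l (pd j (pd i (hk (Suc k)))) x = conv g (pd l (pd j (pd i (psiS (rad k))))) x"
    using 1 2 3 x by blast+
qed

lemma conv_g_bound:
  assumes "csmooth (rad k) \<phi>" "\<And>x. \<bar>\<phi> x\<bar> \<le> c * (1 / rad k) ^ CARD('n) * Cm" "0 \<le> c"
  shows "\<bar>conv g \<phi> x\<bar> \<le> c * (Cm * A) * ((1 / rad k) ^ CARD('n) * mu (rad k) x)"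
proof -
  have "\<bar>conv g \<phi> x\<bar> \<le> c * (1 / rad k) ^ CARD('n) * Cm * (\<integral>y. indicator (cball x (rad k)) y * \<bar>g y\<bar> \<partial>lborel)"
    by (rule conv_bound_local[OF g assms(1,2)])
  also have "\<dots> \<le> c * (1 / rad k) ^ CARD('n) * Cm * (A * mu (rad k) x)"
    using assms(3) Cm_nonneg rad_pos[of k] by (intro mult_left_mono integral_g_le) auto
  finally show ?thesis by (simp add: mult_ac)
qed

definition C0 :: real where "C0 = Cm * unit_vol TYPE('n)"

lemma C0_nonneg: "0 \<le> C0" by (simp add: C0_def Cm_nonneg unit_vol_nonneg)

text \<open>The crude form: the measure of \<Lambda> is replaced by that of the whole ball, and the
  powers of the radius cancel.\<close>

lemma conv_g_bound':
  assumes "csmooth (rad k) \<phi>" "\<And>x. \<bar>\<phi> x\<bar> \<le> c * (1 / rad k) ^ CARD('n) * Cm" "0 \<le> c"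
  shows "\<bar>conv g \<phi> x\<bar> \<le> c * (C0 * A)"
proof -
  have "\<bar>conv g \<phi> x\<bar> \<le> c * (Cm * A) * ((1 / rad k) ^ CARD('n) * mu (rad k) x)"
    by (rule conv_g_bound[OF assms])
  also have "\<dots> \<le> c * (Cm * A) * unit_vol TYPE('n)"
  proof (rule mult_left_mono)
    have "(1 / rad k) ^ CARD('n) * mu (rad k) x \<le> (1 / rad k) ^ CARD('n) * (rad k ^ CARD('n) * unit_vol TYPE('n))"
      using rad_pos[of k] by (intro mult_left_mono mu_le) auto
    also have "\<dots> = unit_vol TYPE('n)" using rad_pos[of k] by (simp add: power_divide)
    finally show "(1 / rad k) ^ CARD('n) * mu (rad k) x \<le> unit_vol TYPE('n)" .
  qed (use assms(3) Cm_nonneg A in auto)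
  finally show ?thesis by (simp add: C0_def mult_ac)
qed

text \<open>The powers of the radius decide what follows. Values and gradients have summable
  increments and third derivatives grow like 1/r; second derivatives sit in between with no power at
  all, so the density of \<Lambda> is retained for them.\<close>

lemma hk_diff_bounds:
  assumes x: "x \<in> S"
  shows "\<bar>hk k x - hk (Suc k) x\<bar> \<le> (rad k)\<^sup>2 * (C0 * A)"
    and "\<bar>pd i (hk k) x - pd i (hk (Suc k)) x\<bar> \<le> rad k * (C0 * A)"
    and "\<bar>pd j (pd i (hk k)) x - pd j (pd i (hk (Suc k))) x\<bar> \<le> (Cm * A) * ((1 / rad k) ^ CARD('n) * mu (rad k) x)"
    and "\<bar>pd l (pd j (pd i (hk k))) x - pd l (pd j (pd i (hk (Suc k)))) x\<bar> \<le> (1 / rad k) * (C0 * A)"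
proof -
  note cs = csmooth_psiS[OF rad_pos[of k]] note b = psiS_bounds[OF rad_pos[of k]]
  show "\<bar>hk k x - hk (Suc k) x\<bar> \<le> (rad k)\<^sup>2 * (C0 * A)"
    unfolding hk_diff[OF x] by (rule conv_g_bound'[OF cs]) (use b in auto)
  show "\<bar>pd i (hk k) x - pd i (hk (Suc k)) x\<bar> \<le> rad k * (C0 * A)"
    unfolding hk_pd_diff[OF x] by (rule conv_g_bound'[OF csmooth_pd[OF cs]]) (use b rad_pos[of k] in auto)
  show "\<bar>pd j (pd i (hk k)) x - pd j (pd i (hk (Suc k))) x\<bar> \<le> (Cm * A) * ((1 / rad k) ^ CARD('n) * mu (rad k) x)"
    unfolding hk_pd_diff[OF x] using conv_g_bound[OF csmooth_pd[OF csmooth_pd[OF cs]], where c=1] b by simp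
  show "\<bar>pd l (pd j (pd i (hk k))) x - pd l (pd j (pd i (hk (Suc k)))) x\<bar> \<le> (1 / rad k) * (C0 * A)"
    unfolding hk_pd_diff[OF x] by (rule conv_g_bound'[OF csmooth_pd[OF csmooth_pd[OF csmooth_pd[OF cs]]]]) (use b rad_pos[of k] in auto)
qed

text \<open>16 is \<open>1 / rad 0\<close>, so the first summand bounds the third derivatives of the
  coarsest kernel; \<open>C0\<close> is added to cover each change of scale.\<close>

definition C1 :: real where "C1 = 16 ^ (CARD('n) + 3) * Cm + C0"

lemma C1_nonneg: "0 \<le> C1" by (simp add: C1_def C0_nonneg Cm_nonneg)

lemma conv_h_bound:
  assumes "csmooth r \<phi>" "\<And>x. \<bar>\<phi> x\<bar> \<le> c" shows "\<bar>conv h \<phi> x\<bar> \<le> c * A"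
proof -
  have c: "0 \<le> c" using assms(2)[of 0] by linarith
  have "\<bar>conv h \<phi> x\<bar> \<le> c * (\<integral>y. indicator (cball x r) y * \<bar>h y\<bar> \<partial>lborel)"
    by (rule conv_bound_local[OF h assms])
  also have "(\<integral>y. indicator (cball x r) y * \<bar>h y\<bar> \<partial>lborel) \<le> (\<integral>y. \<bar>h y\<bar> \<partial>lborel)"
    using integrable_mult_indicator[of "cball x r" lborel "\<lambda>y. \<bar>h y\<bar>"] h
    by (intro integral_mono) (auto simp: indicator_def)
  finally show ?thesis using c h_le by (meson mult_left_mono order_trans)
qed

lemma hk_0_bounds:
  "\<bar>pd j (pd i (hk 0)) x\<bar> \<le> C1 * A" "\<bar>pd l (pd j (pd i (hk 0))) x\<bar> \<le> C1 * A"
proof -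
  note cs = csmooth_etaS[OF rad_pos[of 0]]
  have b: "\<bar>pd j (pd i (etaS (rad 0))) x\<bar> \<le> C1" "\<bar>pd l (pd j (pd i (etaS (rad 0)))) x\<bar> \<le> C1" for x
  proof -
    have "\<bar>pd j (pd i (etaS (rad 0))) x\<bar> \<le> 16 ^ (CARD('n) + 2) * Cm"
      using etaS_bounds(1)[OF rad_pos[of 0]] by (simp add: rad_0)
    also have "\<dots> \<le> 16 ^ (CARD('n) + 3) * Cm"
      using Cm_nonneg by (intro mult_right_mono power_increasing) auto
    finally show "\<bar>pd j (pd i (etaS (rad 0))) x\<bar> \<le> C1" using C0_nonneg by (simp add: C1_def)
    show "\<bar>pd l (pd j (pd i (etaS (rad 0)))) x\<bar> \<le> C1"
      using etaS_bounds(2)[OF rad_pos[of 0]] C0_nonneg by (simp add: rad_0 C1_def add_increasing2)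
  qed
  show "\<bar>pd j (pd i (hk 0)) x\<bar> \<le> C1 * A"
    unfolding hk_pd(2) by (rule conv_h_bound[OF csmooth_pd[OF csmooth_pd[OF cs]] b(1)])
  show "\<bar>pd l (pd j (pd i (hk 0))) x\<bar> \<le> C1 * A"
    unfolding hk_pd(3) by (rule conv_h_bound[OF csmooth_pd[OF csmooth_pd[OF csmooth_pd[OF cs]]] b(2)])
qed

text \<open>One step adds at most C1 A / r, which doubles the bound at worst, whereas passing to r /
  4 allows a factor 4.\<close>

lemma hk_third_bound:
  assumes x: "x \<in> S"
  shows "\<bar>pd l (pd j (pd i (hk k))) x\<bar> \<le> C1 * A / rad k"
proof (induction k)
  case 0
  have "C1 * A \<le> C1 * A / rad 0" using C1_nonneg A by (simp add: rad_0)
  then show ?case using hk_0_bounds(2)[where l=l and j=j and i=i and x=x] by linarith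
next
  case (Suc k)
  have "\<bar>pd l (pd j (pd i (hk (Suc k)))) x\<bar> \<le> C1 * A / rad k + (1 / rad k) * (C0 * A)"
    using Suc hk_diff_bounds(4)[OF x, where l=l and j=j and i=i and k=k] by linarith
  also have "\<dots> \<le> C1 * A / rad k + C1 * A / rad k"
  proof -
    have "C0 * A \<le> C1 * A" using A Cm_nonneg by (intro mult_right_mono) (auto simp: C1_def)
    then have "(1 / rad k) * (C0 * A) \<le> (1 / rad k) * (C1 * A)"
      using rad_pos[of k] by (intro mult_left_mono) auto
    moreover have "(1 / rad k) * (C1 * A) = C1 * A / rad k" by simp
    ultimately show ?thesis by linarith
  qed
  also have "\<dots> \<le> C1 * A / rad (Suc k)"
    using C1_nonneg A rad_pos[of k] by (simp add: rad_Suc field_simps)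
  finally show ?case .
qed

text \<open>Over distances comparable to \<open>rad k\<close> this is a fixed multiple of
  \<open>A\<close>: the Hessian at scale k is constant on such balls up to that error.\<close>

lemma hk_second_lipschitz:
  assumes "x \<in> S" "y \<in> S"
  shows "\<bar>pd j (pd i (hk k)) x - pd j (pd i (hk k)) y\<bar> \<le> CARD('n) * (C1 * A / rad k) * norm (x - y)"
  by (rule lipschitz_on_convex_pd[where S=S])
     (use assms hk_third_bound in \<open>auto intro!: smooth_fun_differentiable smooth_fun_pd hk_smooth\<close>)

end

subsection \<open>The limit of the mollifications\<close>

text \<open>The ratio 1/4 gives the tail factor 4/3, rounded up to 2.\<close>

lemma telescoping_bound:
  fixes s b :: "nat \<Rightarrow> real"
  assumes s: "\<And>k. \<bar>s k - s (Suc k)\<bar> \<le> b k" and b: "\<And>k. b (Suc k) \<le> b k / 4" and b0: "b \<longlonglongrightarrow> 0"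
  shows "k \<le> m \<Longrightarrow> \<bar>s k - s m\<bar> \<le> 2 * b k" "convergent s" "\<bar>s k - lim s\<bar> \<le> 2 * b k"
proof -
  have bn: "0 \<le> b k" for k using s[of k] by linarith
  \<comment> \<open>The sharp form, cleared of denominators and with the remaining tail
    \<open>4 * b m\<close> still subtracted, is the one that induction on m can carry.\<close>
  have *: "3 * \<bar>s k - s m\<bar> \<le> 4 * b k - 4 * b m" if "k \<le> m" for k m
    using that
  proof (induction m rule: dec_induct)
    case (step m)
    have "\<bar>s k - s (Suc m)\<bar> \<le> \<bar>s k - s m\<bar> + \<bar>s m - s (Suc m)\<bar>" by simp
    moreover have "p \<le> q + r \<Longrightarrow> 3 * q \<le> X - 4 * y \<Longrightarrow> r \<le> y \<Longrightarrow> y' \<le> y / 4 \<Longrightarrow> 3 * p \<le> X - 4 * y'"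
      for p q r X y y' :: real by linarith
    ultimately show ?case using step.IH s[of m] b[of m] by blast
  qed simp
  have 1: "\<bar>s k - s m\<bar> \<le> 2 * b k" if "k \<le> m" for k m
    using *[OF that] bn[of m] bn[of k] by simp
  have "Cauchy s"
  proof (rule CauchyI')
    fix e :: real assume "e > 0"
    then have "\<forall>\<^sub>F k in sequentially. dist (b k) 0 < e / 2" using b0 by (intro tendstoD) auto
    then obtain k where k: "\<And>m. m \<ge> k \<Longrightarrow> \<bar>b m\<bar> < e / 2" by (auto simp: eventually_sequentially)
    show "\<exists>M. \<forall>m\<ge>M. \<forall>n>m. dist (s m) (s n) < e"
    proof (intro exI[of _ k] allI impI)
      fix m n assume "k \<le> m" "m < n"
      then show "dist (s m) (s n) < e" using 1[of m n] k[of m] by (simp add: dist_real_def)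
    qed
  qed
  then show conv: "convergent s" by (rule Cauchy_convergent)
  then have "s \<longlonglongrightarrow> lim s" by (simp add: convergent_LIMSEQ_iff)
  then have "(\<lambda>m. \<bar>s k - s m\<bar>) \<longlonglongrightarrow> \<bar>s k - lim s\<bar>" by (intro tendsto_intros)
  then show "\<bar>s k - lim s\<bar> \<le> 2 * b k"
    by (rule LIMSEQ_le_const2) (use 1 in blast)
  show "k \<le> m \<Longrightarrow> \<bar>s k - s m\<bar> \<le> 2 * b k" by (rule 1)
qed

text \<open>With T closed inside \<open>E\<close> and U open around it, small shifts carry the
  compact set T into U. A point that leaves \<open>E\<close> thus lies in E - T or lands in U - E,
  both of small measure. This yields configurations of shifted points inside the coincidence
  set.\<close>

lemma measure_translation_diff_tendsto_0:
  fixes E :: "'a::euclidean_space set"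
  assumes E: "E \<in> sets borel" "bounded E" and a: "a \<longlonglongrightarrow> 0"
  shows "(\<lambda>n. measure lborel {z \<in> E. z + a n \<notin> E}) \<longlonglongrightarrow> 0"
proof (rule LIMSEQ_I)
  fix e :: real assume "e > 0"
  then have e2: "0 < e / 2" by simp
  have EL: "E \<in> sets lebesgue" using E(1) by simp
  obtain T where T: "closed T" "T \<subseteq> E" "E - T \<in> lmeasurable" "emeasure lebesgue (E - T) < ennreal (e / 2)"
    by (rule sets_lebesgue_inner_closed[OF EL e2])
  obtain U where U: "open U" "E \<subseteq> U" "U - E \<in> lmeasurable" "emeasure lebesgue (U - E) < ennreal (e / 2)"
    by (rule sets_lebesgue_outer_open[OF EL e2])
  have "compact T" using T E(2) by (meson bounded_subset compact_eq_bounded_closed)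
  then obtain d where d: "d > 0" "\<And>x y. x \<in> T \<Longrightarrow> dist x y < d \<Longrightarrow> y \<in> U"
  proof (cases "T = {} \<or> U = UNIV")
    case False
    then obtain d where "d > 0" "\<forall>x\<in>T. \<forall>y\<in>- U. d \<le> dist x y"
      using separate_compact_closed[OF \<open>compact T\<close>, of "- U"] U(1,2) T(2) by auto
    then show ?thesis using that[of d] by force
  qed (use that[of 1] in auto)
  have [measurable]: "E \<in> sets borel" "T \<in> sets borel" "U \<in> sets borel" using E T U by auto
  have mTU: "measure lborel (E - T) < e / 2" "measure lborel (U - E) < e / 2"
    "emeasure lborel (E - T) < \<infinity>" "emeasure lborel (U - E) < \<infinity>"
  proof -
    have 1: "emeasure lborel (E - T) < ennreal (e / 2)" "emeasure lborel (U - E) < ennreal (e / 2)" using T(4) U(4) by auto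
    then show "emeasure lborel (E - T) < \<infinity>" "emeasure lborel (U - E) < \<infinity>"
      by (auto intro: less_trans[OF _ ennreal_less_top])
    then show "measure lborel (E - T) < e / 2" "measure lborel (U - E) < e / 2"
      using 1 by (auto simp: emeasure_eq_ennreal_measure less_top[symmetric] ennreal_less_iff simp del: less_divide_eq_numeral1)
  qed
  from a d(1) obtain n0 where n0: "\<And>n. n \<ge> n0 \<Longrightarrow> norm (a n) < d" by (metis LIMSEQ_D diff_zero)
  show "\<exists>n0. \<forall>n\<ge>n0. norm (measure lborel {z \<in> E. z + a n \<notin> E} - 0) < e"
  proof (intro exI allI impI)
    fix n assume n: "n \<ge> n0"
    let ?V = "(\<lambda>z. z + a n) -` (U - E)"
    have sub: "{z \<in> E. z + a n \<notin> E} \<subseteq> (E - T) \<union> ?V"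
      using d(2) n0[OF n] by (auto simp: dist_norm)
    have mV: "?V \<in> sets borel" "emeasure lborel ?V = emeasure lborel (U - E)"
    proof -
      have m: "(\<lambda>z. z + a n) \<in> borel \<rightarrow>\<^sub>M borel" by simp
      from measurable_sets[OF this, of "U - E"] show "?V \<in> sets borel" by simp
      have "emeasure lborel (U - E) = emeasure (distr lborel borel ((+) (a n))) (U - E)" by (simp add: lborel_distr_plus)
      also have "\<dots> = emeasure lborel ((+) (a n) -` (U - E) \<inter> space lborel)" by (rule emeasure_distr) auto
      also have "(+) (a n) -` (U - E) \<inter> space lborel = ?V" by (auto simp: add.commute)
      finally show "emeasure lborel ?V = emeasure lborel (U - E)" by simp
    qed
    have "measure lborel {z \<in> E. z + a n \<notin> E} \<le> measure lborel ((E - T) \<union> ?V)"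
    proof (rule measure_mono_fmeasurable[OF sub])
      show "{z \<in> E. z + a n \<notin> E} \<in> sets lborel"
      proof -
        have "{z \<in> E. z + a n \<notin> E} = E \<inter> (\<lambda>z. z + a n) -` (- E)" by auto
        moreover have "(\<lambda>z. z + a n) -` (- E) \<in> sets borel"
          using measurable_sets[of "\<lambda>z. z + a n" borel borel "- E"] by simp
        ultimately show ?thesis by simp
      qed
      show "(E - T) \<union> ?V \<in> fmeasurable lborel"
        using mTU mV by (intro fmeasurable.Un fmeasurableI) auto
    qed
    also have "\<dots> \<le> measure lborel (E - T) + measure lborel ?V"
      using mV by (intro measure_Un_le) auto
    also have "measure lborel ?V = measure lborel (U - E)" using mV by (simp add: measure_def)
    finally show "norm (measure lborel {z \<in> E. z + a n \<notin> E} - 0) < e" using mTU by simp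
  qed
qed

context potential_pair
begin

text \<open>On \<open>S\<close> this is the continuous representative of \<open>h\<close>, which the
  weak equation determines only up to null sets.\<close>

definition w :: "real^'n \<Rightarrow> real" where "w x = lim (\<lambda>k. hk k x)"

definition W :: "real^'n \<Rightarrow> real^'n" where "W x = (\<chi> i. lim (\<lambda>k. pd i (hk k) x))"

lemma rad_sq_tendsto: "(\<lambda>k. (rad k)\<^sup>2 * c) \<longlonglongrightarrow> 0" and rad_mult_tendsto: "(\<lambda>k. rad k * c) \<longlonglongrightarrow> 0"
  by (rule tendsto_eq_intros rad_tendsto_0 refl | simp)+

lemma hk_tendsto:
  assumes x: "x \<in> S"
  shows "(\<lambda>k. hk k x) \<longlonglongrightarrow> w x" "\<bar>hk k x - w x\<bar> \<le> 2 * ((rad k)\<^sup>2 * (C0 * A))" "\<bar>hk k x - hk 0 x\<bar> \<le> C0 * A"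
proof -
  have b: "(rad (Suc k))\<^sup>2 * (C0 * A) \<le> (rad k)\<^sup>2 * (C0 * A) / 4" for k
  proof -
    have "(rad (Suc k))\<^sup>2 * (C0 * A) = ((rad k)\<^sup>2 * (C0 * A)) / 16" by (simp add: rad_Suc power2_eq_square)
    moreover have "0 \<le> (rad k)\<^sup>2 * (C0 * A)" using C0_nonneg A by simp
    ultimately show ?thesis by linarith
  qed
  note t = telescoping_bound[where s="\<lambda>k. hk k x", OF hk_diff_bounds(1)[OF x] b rad_sq_tendsto]
  show "(\<lambda>k. hk k x) \<longlonglongrightarrow> w x" using t(2) by (simp add: w_def convergent_LIMSEQ_iff)
  show "\<bar>hk k x - w x\<bar> \<le> 2 * ((rad k)\<^sup>2 * (C0 * A))" using t(3) by (simp add: w_def)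
  have "\<bar>hk 0 x - hk k x\<bar> \<le> 2 * ((rad 0)\<^sup>2 * (C0 * A))" by (rule t(1)) simp
  also have "\<dots> \<le> C0 * A" using C0_nonneg A by (simp add: rad_0 power2_eq_square)
  finally show "\<bar>hk k x - hk 0 x\<bar> \<le> C0 * A" by simp
qed

lemma pd_hk_tendsto:
  assumes x: "x \<in> S"
  shows "(\<lambda>k. pd i (hk k) x) \<longlonglongrightarrow> W x $ i" "\<bar>pd i (hk k) x - W x $ i\<bar> \<le> 2 * (rad k * (C0 * A))"
proof -
  have b: "rad (Suc k) * (C0 * A) \<le> rad k * (C0 * A) / 4" for k by (simp add: rad_Suc)
  note t = telescoping_bound[where s="\<lambda>k. pd i (hk k) x", OF hk_diff_bounds(2)[OF x] b rad_mult_tendsto]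
  show "(\<lambda>k. pd i (hk k) x) \<longlonglongrightarrow> W x $ i" using t(2) by (simp add: W_def convergent_LIMSEQ_iff)
  show "\<bar>pd i (hk k) x - W x $ i\<bar> \<le> 2 * (rad k * (C0 * A))" using t(3) by (simp add: W_def)
qed

text \<open>The gradients converge uniformly on \<open>S\<close> with rate \<open>rad k\<close>, so
  limit and derivative commute.\<close>

lemma w_has_derivative:
  assumes x: "x \<in> S" shows "(w has_derivative (\<lambda>h. W x \<bullet> h)) (at x)"
proof -
  have "\<exists>f. \<forall>x\<in>S. (\<lambda>n. hk n x) \<longlonglongrightarrow> f x \<and> (f has_derivative (\<lambda>h. W x \<bullet> h)) (at x within S)"
  proof (rule has_derivative_sequence[where f'="\<lambda>n x h. grad (hk n) x \<bullet> h" and ?x0.0=x])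
    show "(hk n has_derivative (\<bullet>) (grad (hk n) x)) (at x within S)" for n x
      by (rule has_derivative_at_withinI[OF has_derivative_grad[OF smooth_fun_differentiable[OF hk_smooth]]])
    fix e :: real assume e: "e > 0"
    have "(\<lambda>k. rad k * (2 * CARD('n) * (C0 * A))) \<longlonglongrightarrow> 0" by (rule rad_mult_tendsto)
    from tendstoD[OF this e]
    show "\<forall>\<^sub>F n in sequentially. \<forall>x\<in>S. \<forall>h. norm (grad (hk n) x \<bullet> h - W x \<bullet> h) \<le> e * norm h"
    proof eventually_elim
      case (elim k)
      show ?case
      proof (intro ballI allI)
        fix x h :: "real^'n" assume x: "x \<in> S"
        have "norm (grad (hk k) x - W x) \<le> (\<Sum>i\<in>UNIV. \<bar>(grad (hk k) x - W x) $ i\<bar>)" by (rule norm_le_l1_cart)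
        also have "\<dots> \<le> (\<Sum>i\<in>(UNIV::'n set). 2 * (rad k * (C0 * A)))"
          by (rule sum_mono) (use pd_hk_tendsto(2)[OF x] in \<open>simp add: grad_def\<close>)
        also have "\<dots> = rad k * (2 * CARD('n) * (C0 * A))" by simp
        also have "\<dots> \<le> e" using elim abs_ge_self order_trans less_imp_le unfolding dist_real_def diff_zero by metis
        finally have "norm (grad (hk k) x - W x) * norm h \<le> e * norm h" by (intro mult_right_mono) auto
        moreover have "norm (grad (hk k) x \<bullet> h - W x \<bullet> h) \<le> norm (grad (hk k) x - W x) * norm h"
          using Cauchy_Schwarz_ineq2[of "grad (hk k) x - W x" h] by (simp add: inner_diff_left)
        ultimately show "norm (grad (hk k) x \<bullet> h - W x \<bullet> h) \<le> e * norm h" by linarith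
      qed
    qed
  qed (use x hk_tendsto(1)[OF x] in auto)
  then obtain f where f0: "\<forall>x\<in>S. (\<lambda>n. hk n x) \<longlonglongrightarrow> f x \<and> (f has_derivative (\<lambda>h. W x \<bullet> h)) (at x within S)"
    by blast
  have f: "(\<lambda>n. hk n x) \<longlonglongrightarrow> f x" "(f has_derivative (\<lambda>h. W x \<bullet> h)) (at x within S)" if "x \<in> S" for x
    using bspec[OF f0 that] by simp_all
  have eq: "f y = w y" if "y \<in> S" for y using LIMSEQ_unique[OF f(1)[OF that] hk_tendsto(1)[OF that]] .
  have D: "(f has_derivative (\<lambda>h. W x \<bullet> h)) (at x)" using f(2)[OF x] unfolding at_within_open[OF x open_ball] .
  show ?thesis by (rule has_derivative_transform_within_open[OF D open_ball x eq])
qed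

lemma w_borel [measurable]: "w \<in> borel_measurable borel"
proof -
  have "hk k \<in> borel_measurable borel" for k
    by (rule borel_measurable_continuous_onI[OF smooth_fun_continuous[OF hk_smooth]])
  then show ?thesis unfolding w_def[abs_def] by measurable
qed

lemma hk_0_bounded: obtains B where "\<And>x. \<bar>hk 0 x\<bar> \<le> B"
proof -
  obtain C where "\<And>x. \<bar>etaS (rad 0) x\<bar> \<le> C" using csmooth_bounded[OF csmooth_etaS[OF rad_pos]] by metis
  then show ?thesis using that conv_h_bound[OF csmooth_etaS[OF rad_pos]] unfolding hk_def by blast
qed

text \<open>Fubini moves the mollifier to \<phi>, whose averages \<open>K k\<close> converge to it
  uniformly with rate \<open>L * rad k\<close>.\<close>

lemma integral_hk_mult_tendsto:
  assumes \<phi>: "csmooth R \<phi>"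
  shows "(\<lambda>k. \<integral>x. hk k x * \<phi> x \<partial>lborel) \<longlonglongrightarrow> (\<integral>y. h y * \<phi> y \<partial>lborel)"
proof -
  note [measurable] = csmooth_borel[OF \<phi>]
  have [measurable]: "h \<in> borel_measurable borel" using h by auto
  obtain L where L: "L > 0" "\<And>x y. \<bar>\<phi> x - \<phi> y\<bar> \<le> L * norm (x - y)" using csmooth_lipschitz[OF \<phi>] by blast
  obtain C where C: "C > 0" "\<And>x. \<bar>\<phi> x\<bar> \<le> C" using csmooth_bounded[OF \<phi>] by blast
  define K where "K k y = (\<integral>x. etaS (rad k) (x - y) * \<phi> x \<partial>lborel)" for k y
  have swap: "(\<integral>x. hk k x * \<phi> x \<partial>lborel) = (\<integral>y. h y * K k y \<partial>lborel)" for k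
  proof -
    note cs = csmooth_etaS[OF rad_pos[of k]]
    note [measurable] = csmooth_borel[OF cs]
    let ?f = "\<lambda>x y. h y * etaS (rad k) (x - y) * \<phi> x"
    have ha: "integrable lborel (\<lambda>y. \<bar>h y\<bar>)" using h by simp
    have int: "integrable (lborel \<Otimes>\<^sub>M lborel) (case_prod ?f)"
    proof (rule lborel_pair.Fubini_integrable)
      show "case_prod ?f \<in> borel_measurable (lborel \<Otimes>\<^sub>M lborel)" by measurable
      have "(\<integral>y. norm (case_prod ?f (x, y)) \<partial>lborel) = conv (\<lambda>y. \<bar>h y\<bar>) (etaS (rad k)) x * \<bar>\<phi> x\<bar>" for x
        using etaS_nonneg[OF rad_pos[of k]] by (simp add: conv_def abs_mult)
      moreover have "integrable lborel (\<lambda>x. conv (\<lambda>y. \<bar>h y\<bar>) (etaS (rad k)) x * \<bar>\<phi> x\<bar>)"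
      proof -
        have "integrable lborel (\<lambda>x. \<phi> x * conv (\<lambda>y. \<bar>h y\<bar>) (etaS (rad k)) x)"
          by (rule csmooth_mult_integrable[OF \<phi> smooth_fun_conv[OF ha cs]])
        moreover have "0 \<le> conv (\<lambda>y. \<bar>h y\<bar>) (etaS (rad k)) x" for x
          unfolding conv_def using etaS_nonneg[OF rad_pos[of k]] by (intro integral_nonneg_AE AE_I2) auto
        ultimately show ?thesis
          using integrable_abs[of lborel "\<lambda>x. \<phi> x * conv (\<lambda>y. \<bar>h y\<bar>) (etaS (rad k)) x"]
          by (simp add: abs_mult mult.commute)
      qed
      ultimately show "integrable lborel (\<lambda>x. \<integral>y. norm (case_prod ?f (x, y)) \<partial>lborel)" by simp
      show "AE x in lborel. integrable lborel (\<lambda>y. case_prod ?f (x, y))"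
        using conv_integrable[OF h cs] by simp
    qed
    have "(\<integral>x. hk k x * \<phi> x \<partial>lborel) = (\<integral>x. (\<integral>y. ?f x y \<partial>lborel) \<partial>lborel)"
      by (simp add: hk_def conv_def)
    also have "\<dots> = (\<integral>y. (\<integral>x. ?f x y \<partial>lborel) \<partial>lborel)"
      by (rule lborel_pair.Fubini_integral[OF int, symmetric])
    finally show ?thesis by (simp add: K_def mult.assoc)
  qed
  have K: "\<bar>K k y - \<phi> y\<bar> \<le> L * rad k" for k y
  proof -
    note cs = csmooth_etaS[OF rad_pos[of k]]
    note [measurable] = csmooth_borel[OF cs]
    have ei: "integrable lborel (\<lambda>x. etaS (rad k) (x - y))"
      using lborel_integral_translation(4)[of "etaS (rad k)" "- y"] csmooth_integrable[OF cs] by simp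
    have e1: "(\<integral>x. etaS (rad k) (x - y) \<partial>lborel) = 1"
      using lborel_integral_translation(1)[of "etaS (rad k)" "- y"] etaS_integral[OF rad_pos[of k]] by simp
    have ep: "integrable lborel (\<lambda>x. etaS (rad k) (x - y) * \<phi> x)"
      by (rule Bochner_Integration.integrable_bound[where f="\<lambda>x. C * etaS (rad k) (x - y)"])
         (use ei C etaS_nonneg[OF rad_pos[of k]] in \<open>auto simp: abs_mult mult.commute[of C] intro!: mult_left_mono\<close>)
    have "K k y - \<phi> y = (\<integral>x. etaS (rad k) (x - y) * \<phi> x - etaS (rad k) (x - y) * \<phi> y \<partial>lborel)"
      using ei ep e1 by (simp add: K_def)
    also have "\<bar>\<dots>\<bar> \<le> (\<integral>x. etaS (rad k) (x - y) * (L * rad k) \<partial>lborel)"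
    proof (rule order_trans[OF integral_abs_bound integral_mono])
      fix x
      show "\<bar>etaS (rad k) (x - y) * \<phi> x - etaS (rad k) (x - y) * \<phi> y\<bar> \<le> etaS (rad k) (x - y) * (L * rad k)"
      proof (cases "norm (x - y) \<le> rad k")
        case True
        have "\<bar>\<phi> x - \<phi> y\<bar> \<le> L * rad k" using L True by (meson mult_left_mono order_trans less_imp_le)
        then have "etaS (rad k) (x - y) * \<bar>\<phi> x - \<phi> y\<bar> \<le> etaS (rad k) (x - y) * (L * rad k)"
          by (intro mult_left_mono etaS_nonneg rad_pos)
        then show ?thesis using etaS_nonneg[OF rad_pos[of k]] by (simp add: right_diff_distrib[symmetric] abs_mult)
      next
        case False
        then show ?thesis using csmoothD(2)[OF cs, of "x - y"] by simp
      qed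
    qed (use ei ep in auto)
    also have "\<dots> = L * rad k" using e1 by simp
    finally show ?thesis .
  qed
  have Km [measurable]: "K k \<in> borel_measurable borel" for k
  proof -
    note [measurable] = csmooth_borel[OF csmooth_etaS[OF rad_pos[of k]]]
    show ?thesis unfolding K_def[abs_def] by measurable
  qed
  have "(\<lambda>k. \<integral>y. h y * K k y \<partial>lborel) \<longlonglongrightarrow> (\<integral>y. h y * \<phi> y \<partial>lborel)"
  proof (rule integral_dominated_convergence[where w="\<lambda>y. \<bar>h y\<bar> * (C + L)"])
    show "AE y in lborel. (\<lambda>k. h y * K k y) \<longlonglongrightarrow> h y * \<phi> y"
    proof (intro AE_I2 tendsto_mult_left)
      fix y
      have "(\<lambda>k. K k y - \<phi> y) \<longlonglongrightarrow> 0"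
        by (rule Lim_null_comparison[OF _ rad_mult_tendsto[of L]]) (use K in \<open>simp add: mult.commute\<close>)
      then show "(\<lambda>k. K k y) \<longlonglongrightarrow> \<phi> y" by (simp add: LIM_zero_cancel)
    qed
    show "AE y in lborel. norm (h y * K k y) \<le> \<bar>h y\<bar> * (C + L)" for k
    proof (rule AE_I2)
      fix y
      have "L * rad k \<le> L * 1" using L(1) rad_le[of k] by (intro mult_left_mono) auto
      then have "\<bar>K k y\<bar> \<le> C + L" using K[of k y] C(2)[of y] by linarith
      then show "norm (h y * K k y) \<le> \<bar>h y\<bar> * (C + L)" by (auto simp: abs_mult intro!: mult_left_mono)
    qed
  qed (use h in auto)
  then show ?thesis unfolding swap .
qed

text \<open>On \<open>S\<close> both functions are limits of the mollifications, \<open>w\<close>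
  pointwise and \<open>h\<close> weakly against test functions; the fundamental lemma with either
  sign identifies them.\<close>

lemma w_eq_h: "AE x in lborel. x \<in> S \<longrightarrow> w x = h x"
proof -
  have [measurable]: "h \<in> borel_measurable borel" using h by auto
  obtain B where B: "\<And>x. \<bar>hk 0 x\<bar> \<le> B" using hk_0_bounded by blast
  have hkB: "\<bar>hk k x\<bar> \<le> B + C0 * A" if "x \<in> S" for k x
    using B[of x] hk_tendsto(3)[OF that, of k] by linarith
  have wB: "\<bar>w x\<bar> \<le> B + C0 * A" if "x \<in> S" for x
    using tendsto_rabs[OF hk_tendsto(1)[OF that]] by (rule LIMSEQ_le_const2) (use hkB[OF that] in auto)
  let ?F = "\<lambda>x. indicator S x * (w x - h x)"
  have wi: "integrable lborel (\<lambda>x. indicator S x * w x)"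
  proof (rule Bochner_Integration.integrable_bound[where f="\<lambda>x. (B + C0 * A) * indicator S x"])
    show "integrable lborel (\<lambda>x. (B + C0 * A) * indicator S x)"
      by (intro integrable_mult_right integrable_real_indicator)
         (auto intro: emeasure_bounded_finite[unfolded infinity_ennreal_def])
    show "AE x in lborel. norm (indicator S x * w x) \<le> norm ((B + C0 * A) * indicator S x)"
    proof (rule AE_I2)
      fix x show "norm (indicator S x * w x) \<le> norm ((B + C0 * A) * indicator S x)"
        using wB[of x] by (cases "x \<in> S") auto
    qed
    show "(\<lambda>x. indicator S x * w x) \<in> borel_measurable lborel"
      using borel_measurable_times[OF borel_measurable_indicator w_borel, of S] by simp
  qed
  have hi: "integrable lborel (\<lambda>x. indicator S x * h x)"
    using integrable_mult_indicator[of S lborel h] h by simp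
  have iF: "integrable lborel ?F" using Bochner_Integration.integrable_diff[OF wi hi] by (simp add: right_diff_distrib)
  have z: "(\<integral>x. ?F x * \<phi> x \<partial>lborel) = 0" if t: "test_fun S \<phi>" for \<phi>
  proof -
    obtain R where \<phi>: "csmooth R \<phi>" using test_fun_csmooth[OF t] by blast
    note [measurable] = csmooth_borel[OF \<phi>]
    obtain C where C: "C > 0" "\<And>x. \<bar>\<phi> x\<bar> \<le> C" using csmooth_bounded[OF \<phi>] by blast
    have out: "\<phi> x = 0" if "x \<notin> S" for x
      using t closure_subset[of "{x. \<phi> x \<noteq> 0}"] that by (auto simp: test_fun_def)
    have hkm: "hk k \<in> borel_measurable borel" for k
      by (rule borel_measurable_continuous_onI[OF smooth_fun_continuous[OF hk_smooth]])
    have "(\<lambda>k. \<integral>x. hk k x * \<phi> x \<partial>lborel) \<longlonglongrightarrow> (\<integral>x. w x * \<phi> x \<partial>lborel)"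
    proof (rule integral_dominated_convergence[where w="\<lambda>x. (B + C0 * A) * \<bar>\<phi> x\<bar>"])
      show "AE x in lborel. (\<lambda>k. hk k x * \<phi> x) \<longlonglongrightarrow> w x * \<phi> x"
      proof (rule AE_I2)
        fix x show "(\<lambda>k. hk k x * \<phi> x) \<longlonglongrightarrow> w x * \<phi> x"
          using out[of x] hk_tendsto(1)[of x] by (cases "x \<in> S") (auto intro: tendsto_mult_right)
      qed
      show "AE x in lborel. norm (hk k x * \<phi> x) \<le> (B + C0 * A) * \<bar>\<phi> x\<bar>" for k
      proof (rule AE_I2)
        fix x show "norm (hk k x * \<phi> x) \<le> (B + C0 * A) * \<bar>\<phi> x\<bar>"
          using out[of x] hkB[of x k] by (cases "x \<in> S") (auto simp: abs_mult intro!: mult_right_mono)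
      qed
    qed (use csmooth_integrable[OF \<phi>] hkm in auto)
    from LIMSEQ_unique[OF this integral_hk_mult_tendsto[OF \<phi>]]
    have eq: "(\<integral>x. w x * \<phi> x \<partial>lborel) = (\<integral>x. h x * \<phi> x \<partial>lborel)" .
    have ind: "?F x * \<phi> x = (indicator S x * w x) * \<phi> x - (indicator S x * h x) * \<phi> x"
      "(indicator S x * w x) * \<phi> x = w x * \<phi> x" "(indicator S x * h x) * \<phi> x = h x * \<phi> x" for x
      using out[of x] by (cases "x \<in> S"; simp add: algebra_simps)+
    have ib: "integrable lborel (\<lambda>x. f x * \<phi> x)" if "integrable lborel f" for f
      by (rule Bochner_Integration.integrable_bound[where f="\<lambda>x. C * f x"])
         (use that C in \<open>auto simp: abs_mult mult.commute[of C] intro!: mult_left_mono\<close>)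
    show ?thesis
      unfolding ind(1) using ib[OF wi] ib[OF hi] eq unfolding ind(2,3) by simp
  qed
  have "AE x in lborel. x \<in> S \<longrightarrow> ?F x \<le> 0"
    by (rule AE_le_0_if_test_integrals_le_0[OF iF]) (auto simp: z)
  moreover have "AE x in lborel. x \<in> S \<longrightarrow> - ?F x \<le> 0"
    by (rule AE_le_0_if_test_integrals_le_0[OF integrable_minus[OF iF]]) (use z in auto)
  ultimately show ?thesis by eventually_elim auto
qed

end

subsection \<open>Decay of the coincidence set\<close>

text \<open>These constants are built outside the locale from \<open>Cm\<close> and the dimension,
  so that the final bound cannot depend on \<open>h\<close>, \<open>g\<close> or \<open>A\<close>.
  Here 1 is the second difference of the obstacle, 8 stands for the error 2 C0 at four points, and
  the last summand pays for moving by two steps to the given point.\<close>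

definition flat_const :: "real \<Rightarrow> 'n::finite itself \<Rightarrow> real" where
  "flat_const Cm _ = 1 + 8 * (Cm * unit_vol TYPE('n)) +
    2 * CARD('n) * (16 ^ (CARD('n) + 3) * Cm + Cm * unit_vol TYPE('n))"

text \<open>Twice the errors, so that half of the threshold survives their subtraction; the summand
  \<open>32 * 4 ^ CARD('n)\<close> is what halving the density takes.\<close>

definition decay_const :: "real \<Rightarrow> 'n::finite itself \<Rightarrow> real" where
  "decay_const Cm _ = 2 * (flat_const Cm TYPE('n) + CARD('n) * (16 ^ (CARD('n) + 3) * Cm + Cm * unit_vol TYPE('n)))
    + 32 * 4 ^ CARD('n)"

text \<open>The bound at the coarsest scale, the threshold, and three full increments: one for the
  step across the threshold, two for the density term carried by the induction.\<close>

definition hess_const :: "real \<Rightarrow> 'n::finite itself \<Rightarrow> real" where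
  "hess_const Cm _ = 16 ^ (CARD('n) + 3) * Cm + Cm * unit_vol TYPE('n) + decay_const Cm TYPE('n)
    + 3 * Cm * (2 ^ CARD('n) * unit_vol TYPE('n))"

text \<open>The coincidence set enters only through the last assumption: at four points of it the second difference
  of the solution vanishes, so the one of \<open>h\<close> is controlled by that of the obstacle.\<close>

locale flat_pair = potential_pair \<eta> \<psi> Cm h g \<Lambda> A
  for \<eta> \<psi> :: "real^'n \<Rightarrow> real" and Cm h g \<Lambda> A +
  assumes flat: "\<And>z t i j. 0 < t \<Longrightarrow> z \<in> \<Lambda> \<Longrightarrow> z + t *\<^sub>R axis i 1 \<in> \<Lambda> \<Longrightarrow> z + t *\<^sub>R axis j 1 \<in> \<Lambda> \<Longrightarrow>
    z + t *\<^sub>R axis i 1 + t *\<^sub>R axis j 1 \<in> \<Lambda> \<Longrightarrow>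
    \<bar>h (z + t *\<^sub>R axis i 1 + t *\<^sub>R axis j 1) - h (z + t *\<^sub>R axis i 1) - h (z + t *\<^sub>R axis j 1) + h z\<bar> \<le> A * t\<^sup>2"
begin

text \<open>Flatness speaks of the values of \<open>h\<close>, whereas the mollifications converge
  to \<open>w\<close>; asking for both removes only a null set from \<Lambda> inside
  \<open>S\<close>.\<close>

definition \<Lambda>' :: "(real^'n) set" where "\<Lambda>' = {x \<in> \<Lambda>. x \<in> S \<and> w x = h x}"

lemma \<Lambda>'_borel: "\<Lambda>' \<in> sets borel"
proof -
  have [measurable]: "h \<in> borel_measurable borel" using h by auto
  have "{x. w x = h x} \<in> sets borel" by measurable
  moreover have "\<Lambda>' = \<Lambda> \<inter> S \<inter> {x. w x = h x}" by (auto simp: \<Lambda>'_def)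
  ultimately show ?thesis using \<Lambda> by simp
qed

definition CF :: real where "CF = flat_const Cm TYPE('n)"
definition CD :: real where "CD = decay_const Cm TYPE('n)"
definition CH :: real where "CH = hess_const Cm TYPE('n)"

lemma flat_const_eq: "CF = 1 + 8 * C0 + 2 * CARD('n) * C1"
  by (simp add: CF_def flat_const_def C0_def C1_def)

lemma decay_const_eq: "CD = 2 * (CF + CARD('n) * C1) + 32 * 4 ^ CARD('n)"
  by (simp add: CD_def CF_def decay_const_def C0_def C1_def)

lemma hess_const_eq: "CH = C1 + CD + 3 * Cm * (2 ^ CARD('n) * unit_vol TYPE('n))"
  by (simp add: CH_def CD_def hess_const_def C0_def C1_def)

lemma CF_nonneg: "0 \<le> CF" using C0_nonneg C1_nonneg by (simp add: flat_const_eq)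

lemma CD_ge: "32 * 4 ^ CARD('n) \<le> CD" using CF_nonneg C1_nonneg by (simp add: decay_const_eq)

text \<open>At scale t = \<open>rad m\<close> the function \<open>hk m\<close> is within 2 t^2 C0 A
  of \<open>h\<close> at the four points, so its second difference is of order A t^2. It equals t^2
  times a Hessian entry at distance at most 2t, and moving back to \<open>z\<close> costs another
  multiple of \<open>A\<close>.\<close>

lemma flat_hessian_bound:
  assumes z: "norm z < 5/8" and "z \<in> \<Lambda>'" "z + rad m *\<^sub>R axis i 1 \<in> \<Lambda>'" "z + rad m *\<^sub>R axis j 1 \<in> \<Lambda>'"
    "z + rad m *\<^sub>R axis i 1 + rad m *\<^sub>R axis j 1 \<in> \<Lambda>'"
  shows "\<bar>pd j (pd i (hk m)) z\<bar> \<le> CF * A"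
proof -
  define t where "t = rad m"
  have t: "t > 0" "t \<le> 1/16" using rad_pos[of m] rad_le[of m] by (auto simp: t_def)
  let ?p = "z + t *\<^sub>R axis i 1 + t *\<^sub>R axis j 1" and ?q = "z + t *\<^sub>R axis i 1" and ?r = "z + t *\<^sub>R axis j 1"
  have pts: "y \<in> \<Lambda>" "w y = h y" "\<bar>hk m y - w y\<bar> \<le> 2 * (t\<^sup>2 * (C0 * A))" if "y \<in> {z, ?p, ?q, ?r}" for y
    using that assms(2-) hk_tendsto(2)[of y m] by (auto simp: \<Lambda>'_def t_def)
  have fl: "\<bar>h ?p - h ?q - h ?r + h z\<bar> \<le> A * t\<^sup>2"
    by (rule flat) (use t pts(1) in auto)
  obtain \<xi> where \<xi>: "norm (\<xi> - z) \<le> 2 * t" "hk m ?p - hk m ?q - hk m ?r + hk m z = t\<^sup>2 * pd j (pd i (hk m)) \<xi>"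
    by (rule second_difference_mvt[of "hk m" i t z j])
       (use t(1) in \<open>auto intro!: smooth_fun_differentiable smooth_fun_pd hk_smooth\<close>)
  have "\<bar>hk m ?p - hk m ?q - hk m ?r + hk m z\<bar> \<le> A * t\<^sup>2 + 8 * (t\<^sup>2 * (C0 * A))"
    using fl pts(2,3)[of z] pts(2,3)[of ?p] pts(2,3)[of ?q] pts(2,3)[of ?r] unfolding abs_le_iff by simp
  then have "t\<^sup>2 * \<bar>pd j (pd i (hk m)) \<xi>\<bar> \<le> t\<^sup>2 * ((1 + 8 * C0) * A)"
    unfolding \<xi>(2) by (simp add: abs_mult algebra_simps)
  then have 1: "\<bar>pd j (pd i (hk m)) \<xi>\<bar> \<le> (1 + 8 * C0) * A" using t(1) by simp
  have "norm \<xi> < 3/4" using norm_triangle_ineq[of z "\<xi> - z"] \<xi>(1) z t by simp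
  then have "\<bar>pd j (pd i (hk m)) \<xi> - pd j (pd i (hk m)) z\<bar> \<le> CARD('n) * (C1 * A / t) * norm (\<xi> - z)"
    unfolding t_def by (intro hk_second_lipschitz) (use z in auto)
  also have "\<dots> \<le> CARD('n) * (C1 * A / t) * (2 * t)"
    using C1_nonneg A t by (intro mult_left_mono \<xi>(1)) auto
  also have "\<dots> = 2 * CARD('n) * C1 * A" using t(1) by simp
  finally have 2: "\<bar>pd j (pd i (hk m)) \<xi> - pd j (pd i (hk m)) z\<bar> \<le> 2 * CARD('n) * C1 * A" .
  have "\<bar>pd j (pd i (hk m)) z\<bar> \<le> \<bar>pd j (pd i (hk m)) \<xi>\<bar> + \<bar>pd j (pd i (hk m)) \<xi> - pd j (pd i (hk m)) z\<bar>" by simp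
  also have "\<dots> \<le> (1 + 8 * C0) * A + 2 * CARD('n) * C1 * A" using 1 2 by (rule add_mono)
  also have "\<dots> = CF * A" by (simp add: flat_const_eq algebra_simps)
  finally show ?thesis .
qed

section \<open>The L2 estimate between two scales and the decay of the density\<close>

definition Psi :: "nat \<Rightarrow> nat \<Rightarrow> real^'n \<Rightarrow> real" where
  "Psi k m x = (\<Sum>l\<in>{k..<m}. psiS (rad l) x)"

text \<open>Cutting at twice the radius leaves the convolution with a kernel of radius
  \<open>rad k\<close> unchanged on \<open>cball x0 (rad k)\<close>, and gives it the compact
  support that the L2 estimate asks for.\<close>

definition gloc :: "real^'n \<Rightarrow> nat \<Rightarrow> real^'n \<Rightarrow> real" where
  "gloc x0 k y = indicator (cball x0 (2 * rad k)) y * g y"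

lemma psiS_csmooth_le: "k \<le> l \<Longrightarrow> csmooth (rad k) (psiS (rad l))"
  by (rule csmooth_mono[OF csmooth_psiS[OF rad_pos] rad_antimono])

lemma csmooth_Psi: "csmooth (rad k) (Psi k m)"
  unfolding Psi_def by (intro csmooth_sum psiS_csmooth_le) auto

lemma pd_pd_Psi: "pd j (pd i (Psi k m)) = (\<lambda>x. \<Sum>l\<in>{k..<m}. pd j (pd i (psiS (rad l))) x)"
proof -
  have 1: "pd i (Psi k m) = (\<lambda>x. \<Sum>l\<in>{k..<m}. pd i (psiS (rad l)) x)"
    unfolding Psi_def by (intro ext pd_sum csmooth_differentiable[OF csmooth_psiS[OF rad_pos]])
  show ?thesis
    unfolding 1 by (intro ext pd_sum csmooth_differentiable[OF csmooth_pd[OF csmooth_psiS[OF rad_pos]]])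
qed

text \<open>The sum telescopes to two kernels of mass one, so its L1 norm is at most 2 however many
  scales are summed.\<close>

lemma lap_Psi: "k \<le> m \<Longrightarrow> lap (Psi k m) = (\<lambda>x. etaS (rad k) x + (-1) * etaS (rad m) x)"
proof
  fix x assume km: "k \<le> m"
  have "lap (Psi k m) x = (\<Sum>l\<in>{k..<m}. lap (psiS (rad l)) x)"
    unfolding lap_def pd_pd_Psi by (rule sum.swap)
  also have "\<dots> = (\<Sum>l\<in>{k..<m}. (- etaS (rad (Suc l)) x) - (- etaS (rad l) x))"
    by (rule sum.cong[OF refl]) (simp add: lap_psiS[OF rad_pos] rad_Suc)
  also have "\<dots> = (- etaS (rad m) x) - (- etaS (rad k) x)" by (rule sum_Suc_diff'[OF km])
  finally show "lap (Psi k m) x = etaS (rad k) x + (-1) * etaS (rad m) x" by simp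
qed

lemma gloc_integrable: "integrable lborel (gloc x0 k)"
  unfolding gloc_def using integrable_mult_indicator[of "cball x0 (2 * rad k)" lborel g] g by simp

lemma gloc_le: "\<bar>gloc x0 k y\<bar> \<le> A"
  using g_le[of y] A by (auto simp: gloc_def indicator_def)

lemma gloc_L1: "(\<integral>y. \<bar>gloc x0 k y\<bar> \<partial>lborel) \<le> A * mu (2 * rad k) x0"
  using integral_g_le[where x=x0 and r="2 * rad k"] by (simp add: gloc_def abs_mult)

lemma csmooth_conv_gloc: "csmooth \<rho> \<phi> \<Longrightarrow> csmooth (norm x0 + 2 * rad k + \<rho>) (conv (gloc x0 k) \<phi>)"
proof (rule csmooth_conv[OF gloc_integrable])
  fix y :: "real^'n" assume "norm x0 + 2 * rad k < norm y"
  then have "y \<notin> cball x0 (2 * rad k)"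
    using norm_triangle_ineq2[of y x0] by (auto simp: dist_norm norm_minus_commute)
  then show "gloc x0 k y = 0" by (simp add: gloc_def)
qed

lemma hk_pd_pd_diff_eq:
  assumes z: "z \<in> cball x0 (rad k)" and x0: "norm x0 < 1/2" and km: "k \<le> m"
  shows "pd j (pd i (hk k)) z - pd j (pd i (hk m)) z = pd j (pd i (conv (gloc x0 k) (Psi k m))) z"
proof -
  have zS: "z \<in> S"
  proof -
    have "norm z \<le> norm x0 + norm (z - x0)" using norm_triangle_ineq[of x0 "z - x0"] by simp
    moreover have "norm (z - x0) \<le> rad k" using z by (simp add: dist_norm norm_minus_commute)
    ultimately show ?thesis using x0 rad_le[of k] by simp
  qed
  have "pd j (pd i (conv (gloc x0 k) (Psi k m))) = conv (gloc x0 k) (pd j (pd i (Psi k m)))"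
    using pd_conv[OF gloc_integrable csmooth_Psi] pd_conv[OF gloc_integrable csmooth_pd[OF csmooth_Psi]] by metis
  then have "pd j (pd i (conv (gloc x0 k) (Psi k m))) z = conv (gloc x0 k) (pd j (pd i (Psi k m))) z" by simp
  also have "conv (gloc x0 k) (pd j (pd i (Psi k m))) z = conv g (pd j (pd i (Psi k m))) z"
  proof (rule conv_cong_local[OF csmooth_pd[OF csmooth_pd[OF csmooth_Psi]]])
    fix y assume "y \<in> cball z (rad k)"
    then have "y \<in> cball x0 (2 * rad k)" using z dist_triangle[of x0 y z] by simp
    then show "gloc x0 k y = g y" by (simp add: gloc_def)
  qed
  also have "\<dots> = (\<Sum>l\<in>{k..<m}. conv g (pd j (pd i (psiS (rad l)))) z)"
    unfolding pd_pd_Psi by (rule conv_sum[where R="rad k", OF g]) (auto intro!: csmooth_pd psiS_csmooth_le)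
  also have "\<dots> = (\<Sum>l\<in>{k..<m}. (- pd j (pd i (hk (Suc l))) z) - (- pd j (pd i (hk l)) z))"
    by (rule sum.cong[OF refl]) (simp add: hk_pd_diff(2)[OF zS, symmetric])
  also have "\<dots> = (- pd j (pd i (hk m)) z) - (- pd j (pd i (hk k)) z)" by (rule sum_Suc_diff'[OF km])
  finally show ?thesis by simp
qed

text \<open>The squared L2 norm of the Laplacian is at most its sup norm times its L1 norm: the
  former is at most 2A, the latter at most 2A times the measure of \<Lambda> in the ball. Neither
  depends on \<open>m\<close>.\<close>

lemma integral_pd_pd_Psi_sq:
  assumes km: "k \<le> m"
  shows "(\<integral>z. (pd j (pd i (conv (gloc x0 k) (Psi k m))) z)\<^sup>2 \<partial>lborel) \<le> 4 * A\<^sup>2 * mu (2 * rad k) x0"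
proof -
  let ?\<Phi> = "conv (gloc x0 k) (Psi k m)"
  have cs\<Phi>: "csmooth (norm x0 + 2 * rad k + rad k) ?\<Phi>" by (rule csmooth_conv_gloc[OF csmooth_Psi])
  have csl: "csmooth (rad k) (lap (Psi k m))" by (rule csmooth_lap[OF csmooth_Psi])
  have lap: "lap ?\<Phi> = conv (gloc x0 k) (lap (Psi k m))"
    using lap_conv[OF gloc_integrable csmooth_Psi] by blast
  have L1: "(\<integral>x. \<bar>lap (Psi k m) x\<bar> \<partial>lborel) \<le> 2"
  proof -
    have i: "integrable lborel (\<lambda>x. \<bar>etaS (rad l) x\<bar>)" for l
      using csmooth_integrable[OF csmooth_etaS[OF rad_pos]] by simp
    have "(\<integral>x. \<bar>lap (Psi k m) x\<bar> \<partial>lborel) \<le> (\<integral>x. \<bar>etaS (rad k) x\<bar> + \<bar>etaS (rad m) x\<bar> \<partial>lborel)"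
    proof (rule integral_mono)
      show "integrable lborel (\<lambda>x. \<bar>lap (Psi k m) x\<bar>)" using csmooth_integrable[OF csl] by simp
      show "integrable lborel (\<lambda>x. \<bar>etaS (rad k) x\<bar> + \<bar>etaS (rad m) x\<bar>)"
        by (intro Bochner_Integration.integrable_add i)
      show "\<bar>lap (Psi k m) x\<bar> \<le> \<bar>etaS (rad k) x\<bar> + \<bar>etaS (rad m) x\<bar>" for x
        unfolding lap_Psi[OF km] by simp
    qed
    also have "\<dots> = 2" using i by (simp add: etaS_abs_integral[OF rad_pos])
    finally show ?thesis .
  qed
  have sup: "\<bar>lap ?\<Phi> x\<bar> \<le> 2 * A" for x
  proof -
    have "\<bar>lap ?\<Phi> x\<bar> \<le> A * (\<integral>x. \<bar>lap (Psi k m) x\<bar> \<partial>lborel)"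
      unfolding lap by (rule conv_bound_sup[OF gloc_integrable csl gloc_le])
    also have "\<dots> \<le> A * 2" using A by (intro mult_left_mono L1) auto
    finally show ?thesis by simp
  qed
  have csl\<Phi>: "csmooth (norm x0 + 2 * rad k + rad k) (lap ?\<Phi>)" by (rule csmooth_lap[OF cs\<Phi>])
  have "(\<integral>z. (pd j (pd i ?\<Phi>) z)\<^sup>2 \<partial>lborel) \<le> (\<integral>z. (lap ?\<Phi> z)\<^sup>2 \<partial>lborel)"
    by (rule integral_pd_pd_sq_le_lap[OF cs\<Phi>])
  also have "\<dots> \<le> (\<integral>z. 2 * A * \<bar>lap ?\<Phi> z\<bar> \<partial>lborel)"
  proof (rule integral_mono)
    show "integrable lborel (\<lambda>z. (lap ?\<Phi> z)\<^sup>2)"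
      using csmooth_mult_integrable[OF csl\<Phi> csmoothD(1)[OF csl\<Phi>]] by (simp add: power2_eq_square)
    show "integrable lborel (\<lambda>z. 2 * A * \<bar>lap ?\<Phi> z\<bar>)" using csmooth_integrable[OF csl\<Phi>] by simp
    show "(lap ?\<Phi> z)\<^sup>2 \<le> 2 * A * \<bar>lap ?\<Phi> z\<bar>" for z
    proof -
      have "(lap ?\<Phi> z)\<^sup>2 = \<bar>lap ?\<Phi> z\<bar> * \<bar>lap ?\<Phi> z\<bar>" by (simp add: power2_eq_square abs_mult[symmetric])
      also have "\<dots> \<le> 2 * A * \<bar>lap ?\<Phi> z\<bar>" using sup[of z] by (intro mult_right_mono) auto
      finally show ?thesis .
    qed
  qed
  also have "\<dots> = 2 * A * (\<integral>z. \<bar>lap ?\<Phi> z\<bar> \<partial>lborel)" by simp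
  also have "(\<integral>z. \<bar>lap ?\<Phi> z\<bar> \<partial>lborel) \<le> (\<integral>y. \<bar>gloc x0 k y\<bar> \<partial>lborel) * (\<integral>x. \<bar>lap (Psi k m) x\<bar> \<partial>lborel)"
    using csmooth_integrable[OF csl\<Phi>] unfolding lap by (intro conv_L1_bound[OF _ _ csl] gloc_integrable)
  also have "\<dots> \<le> (A * mu (2 * rad k) x0) * 2"
    using A mu_nonneg by (intro mult_mono gloc_L1 L1 mult_nonneg_nonneg integral_nonneg_AE) auto
  finally show ?thesis using A by (simp add: power2_eq_square mult_ac)
qed

text \<open>Chebyshev's inequality for the difference of the Hessians at scales k and m. At points
  of the coincidence set near \<open>x0\<close> the entry at scale m is at most CF A, that at scale
  k still close to its value at \<open>x0\<close>, so the difference is at least CD A / 2.\<close>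

lemma mu_decay:
  assumes x0: "norm x0 < 1/2" and big: "CD * A \<le> \<bar>pd j (pd i (hk k)) x0\<bar>"
  shows "mu (2 * rad (Suc k)) x0 \<le> 16 / CD\<^sup>2 * mu (2 * rad k) x0"
proof -
  define E where "E = \<Lambda>' \<inter> cball x0 (2 * rad (Suc k))"
  have E: "E \<in> sets borel" "bounded E"
    using \<Lambda>'_borel by (auto simp: E_def intro: bounded_subset[OF bounded_cball])
  have fin: "emeasure lborel B < \<infinity>" if "B \<subseteq> E" for B
    using emeasure_bounded_finite bounded_subset[OF E(2) that] by auto
  have CD: "CD > 0" using CD_ge by (rule less_le_trans[rotated]) simp
  \<comment> \<open>The points of \<open>E\<close> to which \<open>flat_hessian_bound\<close>
    applies at scale m.\<close>
  define Em where "Em m = {z \<in> E. z + rad m *\<^sub>R axis i 1 \<in> E \<and> z + rad m *\<^sub>R axis j 1 \<in> E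
      \<and> z + (rad m *\<^sub>R axis i 1 + rad m *\<^sub>R axis j 1) \<in> E}" for m
  have tr: "{z \<in> E. z + a \<in> E} \<in> sets borel" "{z \<in> E. z + a \<notin> E} \<in> sets borel" for a
  proof -
    have "(\<lambda>z. z + a) -` E \<in> sets borel" using measurable_sets[of "\<lambda>z. z + a" borel borel E] E(1) by simp
    moreover have "{z \<in> E. z + a \<in> E} = E \<inter> (\<lambda>z. z + a) -` E" "{z \<in> E. z + a \<notin> E} = E - (\<lambda>z. z + a) -` E" by auto
    ultimately show "{z \<in> E. z + a \<in> E} \<in> sets borel" "{z \<in> E. z + a \<notin> E} \<in> sets borel" using E(1) by auto
  qed
  have Emb: "Em m \<in> sets borel" for m
  proof -
    have "Em m = {z \<in> E. z + rad m *\<^sub>R axis i 1 \<in> E} \<inter> {z \<in> E. z + rad m *\<^sub>R axis j 1 \<in> E}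
        \<inter> {z \<in> E. z + (rad m *\<^sub>R axis i 1 + rad m *\<^sub>R axis j 1) \<in> E}" by (auto simp: Em_def)
    then show ?thesis using tr(1) by simp
  qed
  have Em_le: "measure lborel (Em m) \<le> 16 / CD\<^sup>2 * mu (2 * rad k) x0" if km: "k \<le> m" for m
  proof -
    let ?\<Phi> = "conv (gloc x0 k) (Psi k m)"
    have cs: "csmooth (norm x0 + 2 * rad k + rad k) (pd j (pd i ?\<Phi>))"
      by (intro csmooth_pd csmooth_conv_gloc csmooth_Psi)
    have lower: "(CD / 2 * A)\<^sup>2 \<le> (pd j (pd i ?\<Phi>) z)\<^sup>2" if z: "z \<in> Em m" for z
    proof -
      have d: "norm (x0 - z) \<le> rad k / 2" using z by (auto simp: Em_def E_def dist_norm rad_Suc)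
      have zc: "z \<in> cball x0 (rad k)" using d rad_pos[of k] by (simp add: dist_norm)
      have nz: "norm z < 5/8"
        using norm_triangle_ineq[of x0 "z - x0"] d x0 rad_le[of k] by (simp add: norm_minus_commute)
      have a: "\<bar>pd j (pd i (hk m)) z\<bar> \<le> CF * A"
        by (rule flat_hessian_bound[OF nz]) (use z in \<open>auto simp: Em_def E_def add.assoc\<close>)
      have "\<bar>pd j (pd i (hk k)) x0 - pd j (pd i (hk k)) z\<bar> \<le> CARD('n) * (C1 * A / rad k) * norm (x0 - z)"
        by (rule hk_second_lipschitz) (use x0 nz in auto)
      also have "\<dots> \<le> CARD('n) * (C1 * A / rad k) * rad k"
        using d rad_pos[of k] C1_nonneg A by (intro mult_left_mono) auto
      also have "\<dots> = CARD('n) * C1 * A" using rad_pos[of k] by simp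
      finally have b: "\<bar>pd j (pd i (hk k)) x0 - pd j (pd i (hk k)) z\<bar> \<le> CARD('n) * C1 * A" .
      have "pd j (pd i (hk k)) x0 = (pd j (pd i (hk k)) x0 - pd j (pd i (hk k)) z) + pd j (pd i (hk m)) z + pd j (pd i ?\<Phi>) z"
        using hk_pd_pd_diff_eq[OF zc x0 km, of j i] by simp
      then have "\<bar>pd j (pd i (hk k)) x0\<bar> \<le> \<bar>pd j (pd i (hk k)) x0 - pd j (pd i (hk k)) z\<bar> + \<bar>pd j (pd i (hk m)) z\<bar> + \<bar>pd j (pd i ?\<Phi>) z\<bar>"
        by linarith
      with a b big have "CD * A \<le> CARD('n) * C1 * A + CF * A + \<bar>pd j (pd i ?\<Phi>) z\<bar>" by linarith
      moreover have "CARD('n) * C1 * A + CF * A \<le> CD / 2 * A"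
      proof -
        have "CARD('n) * C1 + CF \<le> CD / 2" by (simp add: decay_const_eq)
        from mult_right_mono[OF this, of A] A show ?thesis by (simp add: distrib_right)
      qed
      ultimately have "CD / 2 * A \<le> \<bar>pd j (pd i ?\<Phi>) z\<bar>" by simp
      moreover have "0 \<le> CD / 2 * A" using CD A by simp
      ultimately have "(CD / 2 * A)\<^sup>2 \<le> \<bar>pd j (pd i ?\<Phi>) z\<bar>\<^sup>2" by (rule power_mono)
      then show ?thesis by simp
    qed
    have "(CD / 2 * A)\<^sup>2 * measure lborel (Em m) = (\<integral>z. (CD / 2 * A)\<^sup>2 * indicator (Em m) z \<partial>lborel)"
      by simp
    also have "\<dots> \<le> (\<integral>z. (pd j (pd i ?\<Phi>) z)\<^sup>2 \<partial>lborel)"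
    proof (rule integral_mono)
      show "integrable lborel (\<lambda>z. (CD / 2 * A)\<^sup>2 * indicator (Em m) z)"
        using fin[of "Em m"] Emb by (intro integrable_mult_right integrable_real_indicator) (auto simp: Em_def)
      show "integrable lborel (\<lambda>z. (pd j (pd i ?\<Phi>) z)\<^sup>2)"
        using csmooth_mult_integrable[OF cs csmoothD(1)[OF cs]] by (simp add: power2_eq_square)
      show "(CD / 2 * A)\<^sup>2 * indicator (Em m) z \<le> (pd j (pd i ?\<Phi>) z)\<^sup>2" for z
        using lower[of z] by (cases "z \<in> Em m") auto
    qed
    also have "\<dots> \<le> 4 * A\<^sup>2 * mu (2 * rad k) x0" by (rule integral_pd_pd_Psi_sq[OF km])
    \<comment> \<open>16 is the factor 4 of the L2 estimate times the square of the 2 in CD /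
      2.\<close>
    finally have "A\<^sup>2 * (CD\<^sup>2 * measure lborel (Em m)) \<le> A\<^sup>2 * (16 * mu (2 * rad k) x0)"
      by (simp add: power_mult_distrib power_divide field_simps)
    then have "CD\<^sup>2 * measure lborel (Em m) \<le> 16 * mu (2 * rad k) x0" using A by simp
    then show ?thesis using CD by (simp add: field_simps)
  qed
  let ?D = "\<lambda>a m. measure lborel {z \<in> E. z + a m \<notin> E}"
  let ?ai = "\<lambda>m. rad m *\<^sub>R axis i (1::real)" and ?aj = "\<lambda>m. rad m *\<^sub>R axis j (1::real)"
  \<comment> \<open>A point of \<open>E\<close> outside \<open>Em m\<close> has one of its three
    shifts outside \<open>E\<close>. The measure of such points vanishes as m grows, while the bound
    for \<open>Em m\<close> does not involve m.\<close>
  have E_split: "measure lborel E \<le> measure lborel (Em m) + (?D ?ai m + ?D ?aj m + ?D (\<lambda>m. ?ai m + ?aj m) m)" for m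
  proof -
    have "E \<subseteq> Em m \<union> ({z \<in> E. z + ?ai m \<notin> E} \<union> {z \<in> E. z + ?aj m \<notin> E} \<union> {z \<in> E. z + (?ai m + ?aj m) \<notin> E})"
      (is "_ \<subseteq> _ \<union> (?X \<union> ?Y \<union> ?Z)") by (auto simp: Em_def)
    then have "measure lborel E \<le> measure lborel (Em m \<union> (?X \<union> ?Y \<union> ?Z))"
      using E tr Emb fin by (intro measure_mono_fmeasurable fmeasurable.Un fmeasurableI) (auto simp: Em_def)
    also have "\<dots> \<le> measure lborel (Em m) + (measure lborel ?X + measure lborel ?Y + measure lborel ?Z)"
      using tr Emb by (intro order_trans[OF measure_Un_le] add_mono) auto
    finally show ?thesis .
  qed
  have "rad \<longlonglongrightarrow> 0" by (rule rad_tendsto_0)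
  then have l: "?ai \<longlonglongrightarrow> 0" "?aj \<longlonglongrightarrow> 0" "(\<lambda>m. ?ai m + ?aj m) \<longlonglongrightarrow> 0"
    by (auto intro!: tendsto_eq_intros)
  have lim: "(\<lambda>m. 16 / CD\<^sup>2 * mu (2 * rad k) x0 + (?D ?ai m + ?D ?aj m + ?D (\<lambda>m. ?ai m + ?aj m) m))
      \<longlonglongrightarrow> 16 / CD\<^sup>2 * mu (2 * rad k) x0 + (0 + 0 + 0)"
    by (intro tendsto_add tendsto_const measure_translation_diff_tendsto_0[OF E] l)
  have "measure lborel E \<le> 16 / CD\<^sup>2 * mu (2 * rad k) x0 + (0 + 0 + 0)"
    by (rule LIMSEQ_le_const[OF lim]) (use E_split Em_le in \<open>meson add_mono_thms_linordered_semiring(3) order_trans\<close>)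
  \<comment> \<open>The two sets differ by a null set, where \<open>w\<close> and \<open>h\<close>
    disagree.\<close>
  moreover have "measure lborel E = mu (2 * rad (Suc k)) x0"
    unfolding mu_def
  proof (rule measure_eq_AE)
    show "AE x in lborel. (x \<in> E) = (x \<in> \<Lambda> \<inter> cball x0 (2 * rad (Suc k)))"
      using w_eq_h
    proof eventually_elim
      case (elim x)
      have "x \<in> S" if "x \<in> cball x0 (2 * rad (Suc k))"
        using norm_triangle_ineq[of x0 "x - x0"] that x0 rad_le[of "Suc k"] by (auto simp: dist_norm norm_minus_commute)
      with elim show ?case by (auto simp: E_def \<Lambda>'_def)
    qed
  qed (use E \<Lambda> in auto)
  ultimately show ?thesis by simp
qed

lemma hk_hessian_bound:
  assumes x0: "norm x0 < 1/2"
  shows "\<bar>pd j (pd i (hk k)) x0\<bar> \<le> CH * A"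
proof -
  define \<kappa> where "\<kappa> k = (1 / rad k) ^ CARD('n) * mu (2 * rad k) x0" for k
  let ?a = "\<lambda>k. \<bar>pd j (pd i (hk k)) x0\<bar>"
  let ?V = "2 ^ CARD('n) * unit_vol TYPE('n)"
  have x0S: "x0 \<in> S" using x0 by simp
  have CmA: "0 \<le> Cm * A" using Cm_nonneg A by simp
  have \<kappa>0: "0 \<le> \<kappa> k" for k using rad_pos[of k] mu_nonneg by (simp add: \<kappa>_def)
  have \<kappa>V: "\<kappa> k \<le> ?V" for k
  proof -
    have "\<kappa> k \<le> (1 / rad k) ^ CARD('n) * ((2 * rad k) ^ CARD('n) * unit_vol TYPE('n))"
      unfolding \<kappa>_def using rad_pos[of k] by (intro mult_left_mono mu_le) auto
    then show ?thesis using rad_pos[of k] by (simp add: power_divide power_mult_distrib)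
  qed
  have inc: "?a (Suc k) \<le> ?a k + Cm * A * \<kappa> k" for k
  proof -
    have "mu (rad k) x0 \<le> mu (2 * rad k) x0"
      unfolding mu_def
    proof (rule measure_mono_fmeasurable)
      show "\<Lambda> \<inter> cball x0 (2 * rad k) \<in> fmeasurable lborel"
        by (intro fmeasurableI) (auto intro!: emeasure_bounded_finite[unfolded infinity_ennreal_def] intro: bounded_subset[OF bounded_cball])
    qed (use rad_pos[of k] in auto)
    then have "(1 / rad k) ^ CARD('n) * mu (rad k) x0 \<le> \<kappa> k"
      unfolding \<kappa>_def using rad_pos[of k] by (intro mult_left_mono) auto
    then have "Cm * A * ((1 / rad k) ^ CARD('n) * mu (rad k) x0) \<le> Cm * A * \<kappa> k" using CmA by (rule mult_left_mono)
    moreover have "\<bar>pd j (pd i (hk k)) x0 - pd j (pd i (hk (Suc k))) x0\<bar> \<le> Cm * A * ((1 / rad k) ^ CARD('n) * mu (rad k) x0)"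
      by (rule hk_diff_bounds(3)[OF x0S])
    moreover have "?a (Suc k) \<le> ?a k + \<bar>pd j (pd i (hk k)) x0 - pd j (pd i (hk (Suc k))) x0\<bar>" by simp
    ultimately show ?thesis by linarith
  qed
  \<comment> \<open>The normalisations of consecutive scales differ by 4^n; with the factor 16 /
    CD^2 of \<open>mu_decay\<close> the choice of \<open>CD\<close> leaves at most 1/2.\<close>
  have dec: "\<kappa> (Suc k) \<le> \<kappa> k / 2" if "CD * A \<le> ?a k" for k
  proof -
    have "\<kappa> (Suc k) \<le> (1 / rad (Suc k)) ^ CARD('n) * (16 / CD\<^sup>2 * mu (2 * rad k) x0)"
      unfolding \<kappa>_def using rad_pos[of "Suc k"] by (intro mult_left_mono mu_decay[OF x0 that]) auto
    also have "\<dots> = (4 ^ CARD('n) * 16 / CD\<^sup>2) * \<kappa> k"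
      using rad_pos[of k] by (simp add: rad_Suc \<kappa>_def power_divide power_mult_distrib field_simps)
    also have "\<dots> \<le> 1 / 2 * \<kappa> k"
    proof (rule mult_right_mono[OF _ \<kappa>0])
      have "32 * 4 ^ CARD('n) * 1 \<le> CD * CD"
      proof (rule mult_mono[OF CD_ge])
        have "(1::real) \<le> 32 * 4 ^ CARD('n)" using one_le_power[of "4::real" "CARD('n)"] by linarith
        then show "1 \<le> CD" using CD_ge by linarith
        have "(0::real) \<le> 32 * 4 ^ CARD('n)" by simp
        then show "0 \<le> CD" using CD_ge by linarith
      qed auto
      moreover have "0 < CD" using CD_ge by (rule less_le_trans[rotated]) simp
      ultimately show "4 ^ CARD('n) * 16 / CD\<^sup>2 \<le> 1 / 2" by (simp add: power2_eq_square field_simps)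
    qed
    finally show ?thesis by simp
  qed
  have CHA: "CH * A = C1 * A + CD * A + 3 * (Cm * A * ?V)" by (simp add: hess_const_eq algebra_simps)
  have \<kappa>VA: "Cm * A * \<kappa> k \<le> Cm * A * ?V" for k using \<kappa>V CmA by (rule mult_left_mono)
  have nn: "0 \<le> C1 * A" "0 \<le> CD * A" "0 \<le> Cm * A * \<kappa> k" for k
  proof -
    have "0 \<le> CD" by (rule order_trans[OF _ CD_ge]) simp
    then show "0 \<le> C1 * A" "0 \<le> CD * A" "0 \<le> Cm * A * \<kappa> k"
      using C1_nonneg A \<kappa>0 CmA by auto
  qed
  \<comment> \<open>the density term pays for the growth of the Hessian while the latter is large\<close>
  have "?a k + 2 * (Cm * A * \<kappa> k) \<le> CH * A"
  proof (induction k)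
    case 0
    have a0: "?a 0 \<le> C1 * A" by (rule hk_0_bounds(1))
    have "0 \<le> Cm * A * ?V" using \<kappa>VA[of 0] nn(3)[of 0] by linarith
    then show ?case using a0 \<kappa>VA[of 0] nn(2) unfolding CHA by linarith
  next
    case (Suc k)
    show ?case
    proof (cases "CD * A \<le> ?a k")
      case True
      \<comment> \<open>Halving \<kappa> releases Cm A \<kappa> from the term of weight 2, which is
        just the possible growth of the Hessian entry in one step; hence the weight.\<close>
      have "Cm * A * \<kappa> (Suc k) \<le> Cm * A * (\<kappa> k / 2)" using dec[OF True] CmA by (rule mult_left_mono)
      then show ?thesis using Suc inc[of k] by simp
    next
      case False
      \<comment> \<open>Below the threshold one increment and the trivial bound on the density
        already fit into \<open>CH * A\<close>.\<close>
      then show ?thesis using inc[of k] \<kappa>VA[of k] \<kappa>VA[of "Suc k"] nn(1) unfolding CHA by linarith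
    qed
  qed
  then show ?thesis using nn(3)[of k] by linarith
qed

text \<open>The uniform Hessian bound makes the approximating gradients uniformly Lipschitz, which
  survives the pointwise limit. One factor \<open>CARD('n)\<close> comes from the gradient of each
  component, the other from summing the components.\<close>

lemma W_lipschitz:
  assumes x: "norm x < 1/2" and y: "norm y < 1/2"
  shows "norm (W x - W y) \<le> (CARD('n) * (CARD('n) * CH)) * A * norm (x - y)"
proof -
  have comp: "\<bar>W x $ i - W y $ i\<bar> \<le> CARD('n) * (CH * A) * norm (x - y)" for i
  proof -
    have "\<bar>pd i (hk k) x - pd i (hk k) y\<bar> \<le> CARD('n) * (CH * A) * norm (x - y)" for k
      by (rule lipschitz_on_convex_pd[where S="ball 0 (1/2)"])
         (use x y hk_hessian_bound in \<open>auto intro!: smooth_fun_differentiable smooth_fun_pd hk_smooth\<close>)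
    moreover have "(\<lambda>k. \<bar>pd i (hk k) x - pd i (hk k) y\<bar>) \<longlonglongrightarrow> \<bar>W x $ i - W y $ i\<bar>"
      by (intro tendsto_intros pd_hk_tendsto(1)) (use x y in auto)
    ultimately show ?thesis by (intro LIMSEQ_le_const2) auto
  qed
  have "norm (W x - W y) \<le> (\<Sum>i\<in>UNIV. \<bar>(W x - W y) $ i\<bar>)" by (rule norm_le_l1_cart)
  also have "\<dots> \<le> (\<Sum>i\<in>(UNIV::'n set). CARD('n) * (CH * A) * norm (x - y))"
    by (rule sum_mono) (use comp in simp)
  finally show ?thesis by (simp add: mult_ac)
qed

end

subsection \<open>Boundedness of the right-hand side\<close>

lemma test_fun_pd:
  assumes "test_fun U \<phi>" shows "test_fun U (pd i \<phi>)"
proof -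
  let ?K = "closure {x. \<phi> x \<noteq> 0}"
  have z: "pd i \<phi> x = 0" if "x \<notin> ?K" for x
  proof -
    have "pd i \<phi> x = pd i (\<lambda>x. 0) x"
      by (rule pd_cong_open[of "- ?K"]) (use that closure_subset[of "{x. \<phi> x \<noteq> 0}"] in auto)
    then show ?thesis by (simp add: pd_def)
  qed
  then have "closure {x. pd i \<phi> x \<noteq> 0} \<subseteq> ?K" by (intro closure_minimal) auto
  then show ?thesis using assms
    by (auto simp: test_fun_def smooth_fun_pd compact_eq_bounded_closed intro: bounded_subset)
qed

lemma test_fun_outside: "test_fun U \<phi> \<Longrightarrow> x \<notin> U \<Longrightarrow> \<phi> x = 0"
  using closure_subset[of "{x. \<phi> x \<noteq> 0}"] by (auto simp: test_fun_def)

lemma test_fun_lap_outside: "test_fun U \<phi> \<Longrightarrow> x \<notin> U \<Longrightarrow> lap \<phi> x = 0"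
  by (simp add: lap_def test_fun_outside[OF test_fun_pd[OF test_fun_pd]])

lemma test_fun_mono: "test_fun U \<phi> \<Longrightarrow> U \<subseteq> V \<Longrightarrow> test_fun V \<phi>"
  by (auto simp: test_fun_def)

text \<open>The hypotheses are integrals over \<open>lebesgue\<close>, whereas Fubini, translation
  and convolution are carried out on \<open>lborel\<close>; Borel versions mediate between
  them.\<close>

lemma lebesgue_borel_version:
  fixes F :: "'a::euclidean_space \<Rightarrow> real"
  assumes "F \<in> borel_measurable lebesgue"
  obtains F' where "F' \<in> borel_measurable borel" "AE x in lborel. F x = F' x"
  using completion_ex_borel_measurable_real[OF assms] by auto

lemma lebesgue_integral_borel_version:
  fixes F F' :: "'a::euclidean_space \<Rightarrow> real"
  assumes F': "F' \<in> borel_measurable borel" and eq: "AE x in lborel. F x = F' x" and F: "F \<in> borel_measurable lebesgue"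
  shows "integral\<^sup>L lebesgue F = integral\<^sup>L lborel F'" "integrable lebesgue F \<longleftrightarrow> integrable lborel F'"
proof -
  have F'L: "F' \<in> borel_measurable lborel" using F' by simp
  have eqL: "AE x in lebesgue. F x = F' x" using eq by (rule AE_completion)
  have "integral\<^sup>L lebesgue F = integral\<^sup>L lebesgue F'"
    by (rule integral_cong_AE[OF F measurable_completion[OF F'L] eqL])
  also have "\<dots> = integral\<^sup>L lborel F'" by (rule integral_completion[OF F'L])
  finally show "integral\<^sup>L lebesgue F = integral\<^sup>L lborel F'" .
  have "integrable lebesgue F \<longleftrightarrow> integrable lebesgue F'"
    by (rule integrable_cong_AE[OF F measurable_completion[OF F'L] eqL])
  also have "\<dots> \<longleftrightarrow> integrable lborel F'" by (rule integrable_completion[OF F'L])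
  finally show "integrable lebesgue F \<longleftrightarrow> integrable lborel F'" .
qed

text \<open>Local integrability gives measurability on closed balls inside the unit ball; these
  exhaust it, and a pointwise limit does the rest.\<close>

lemma loc_integrable_borel_measurable:
  fixes F :: "real^'n \<Rightarrow> real"
  assumes "loc_integrable (ball 0 1) F"
  shows "(\<lambda>x. indicator (ball 0 1) x * F x) \<in> borel_measurable lebesgue"
proof (rule borel_measurable_LIMSEQ_real)
  let ?K = "\<lambda>n. cball (0::real^'n) (1 - inverse (real (Suc n)))"
  show "(\<lambda>x. indicator (?K n) x * F x) \<in> borel_measurable lebesgue" for n
  proof -
    have "?K n \<subseteq> ball 0 1"
    proof
      fix x assume "x \<in> ?K n"
      moreover have "inverse (real (Suc n)) > 0" by simp
      ultimately show "x \<in> ball 0 1" unfolding mem_cball_0 mem_ball_0 by linarith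
    qed
    then have "set_integrable lebesgue (?K n) F" using assms by (simp add: loc_integrable_def del: of_nat_Suc)
    then show ?thesis by (auto simp: set_integrable_def)
  qed
  fix x :: "real^'n"
  show "(\<lambda>n. indicator (?K n) x * F x) \<longlonglongrightarrow> indicator (ball 0 1) x * F x"
  proof (cases "x \<in> ball 0 1")
    case True
    then have "0 < 1 - norm x" by simp
    then obtain n0 where n0: "inverse (real (Suc n0)) < 1 - norm x" using reals_Archimedean by blast
    have "\<forall>\<^sub>F n in sequentially. indicator (ball 0 1) x * F x = indicator (?K n) x * F x"
      unfolding eventually_sequentially
    proof (intro exI allI impI)
      fix n assume "n0 \<le> n"
      then have "inverse (real (Suc n)) \<le> inverse (real (Suc n0))" by (intro le_imp_inverse_le) auto
      then have "x \<in> ?K n" using n0 unfolding mem_cball_0 by linarith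
      then show "indicator (ball 0 1) x * F x = indicator (?K n) x * F x" using True by simp
    qed
    then show ?thesis by (rule Lim_transform_eventually[OF tendsto_const])
  next
    case False
    have "x \<notin> ?K n" for n
    proof -
      have "inverse (real (Suc n)) > 0" by simp
      then show ?thesis using False unfolding mem_cball_0 mem_ball_0 by linarith
    qed
    then show ?thesis using False by simp
  qed
qed

text \<open>This constant involves the gradient at 0 and must not reach the final bound; it serves
  to make the theory of Lipschitz functions applicable to \<open>v\<close> itself.\<close>

lemma lipschitz_ball_grad:
  fixes v :: "real^'n \<Rightarrow> real" and M :: real
  assumes v: "\<And>x. x \<in> ball 0 1 \<Longrightarrow> v differentiable (at x)"
    and lip: "\<And>x y. x \<in> ball 0 1 \<Longrightarrow> y \<in> ball 0 1 \<Longrightarrow> norm (grad v x - grad v y) \<le> M * norm (x - y)" and M: "0 \<le> M"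
  obtains L where "0 \<le> L" "\<And>x y. x \<in> ball 0 1 \<Longrightarrow> y \<in> ball 0 1 \<Longrightarrow> \<bar>v x - v y\<bar> \<le> L * norm (x - y)"
proof (rule that)
  let ?C = "norm (grad v 0) + M"
  show "0 \<le> CARD('n) * ?C" using M by simp
  show "\<bar>v x - v y\<bar> \<le> CARD('n) * ?C * norm (x - y)" if "x \<in> ball 0 1" "y \<in> ball 0 1" for x y
  proof (rule lipschitz_on_convex_pd[OF convex_ball open_ball v _ that])
    fix x :: "real^'n" and i assume x: "x \<in> ball 0 1"
    have "\<bar>pd i v x\<bar> \<le> norm (grad v x)" using component_le_norm_cart[of "grad v x" i] by (simp add: grad_def)
    also have "\<dots> \<le> norm (grad v 0) + norm (grad v x - grad v 0)" using norm_triangle_ineq[of "grad v 0" "grad v x - grad v 0"] by simp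
    also have "norm (grad v x - grad v 0) \<le> M * norm (x - 0)" by (rule lip) (use x in auto)
    also have "M * norm (x - 0) \<le> M * 1" using x M by (intro mult_left_mono) auto
    finally show "\<bar>pd i v x\<bar> \<le> ?C" by simp
  qed
qed

text \<open>Two integrations by parts: the first passes from \<open>v\<close> to its gradient, the
  second from the Lipschitz components of the gradient to functions bounded by \<open>M\<close>.
  Each of the coordinate directions contributes \<open>M\<close>.\<close>

lemma integral_lap_le:
  fixes v :: "real^'n \<Rightarrow> real" and M :: real
  assumes v: "\<And>x. x \<in> ball 0 1 \<Longrightarrow> v differentiable (at x)"
    and lip: "\<And>x y. x \<in> ball 0 1 \<Longrightarrow> y \<in> ball 0 1 \<Longrightarrow> norm (grad v x - grad v y) \<le> M * norm (x - y)" and M: "0 \<le> M"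
    and r: "0 \<le> r" "r < 1" and \<phi>: "test_fun (ball 0 r) \<phi>"
  shows "\<bar>\<integral>x. v (clip r x) * lap \<phi> x \<partial>lborel\<bar> \<le> CARD('n) * M * (\<integral>x. \<bar>\<phi> x\<bar> \<partial>lborel)"
proof -
  obtain R where cs: "csmooth R \<phi>" using test_fun_csmooth[OF \<phi>] by blast
  obtain L where L: "0 \<le> L" "\<And>x y. x \<in> ball 0 1 \<Longrightarrow> y \<in> ball 0 1 \<Longrightarrow> \<bar>v x - v y\<bar> \<le> L * norm (x - y)"
    using lipschitz_ball_grad[OF v lip M] by blast
  define V where "V = (\<lambda>x. v (clip r x))"
  define F where "F = (\<lambda>i x. grad v (clip r x) $ i)"
  have Vlip: "\<bar>V x - V y\<bar> \<le> L * norm (x - y)" for x y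
    unfolding V_def by (rule lipschitz_clip[OF L(2) r L(1)])
  have Flip: "\<bar>F i x - F i y\<bar> \<le> M * norm (x - y)" for i x y
    unfolding F_def
  proof (rule lipschitz_clip[where F="\<lambda>x. grad v x $ i", OF _ r M])
    fix x y :: "real^'n" assume "x \<in> ball 0 1" "y \<in> ball 0 1"
    from lip[OF this] show "\<bar>grad v x $ i - grad v y $ i\<bar> \<le> M * norm (x - y)"
      using component_le_norm_cart[of "grad v x - grad v y" i] by simp
  qed
  let ?e = "\<lambda>i. axis i (1::real) :: real^'n"
  have ga: "grad k x \<bullet> ?e i = pd i k x" for k :: "real^'n \<Rightarrow> real" and x i
    by (simp add: inner_axis_one grad_def)
  \<comment> \<open>Clipping is invisible here: inside the ball it is the identity, and outside the
    test function vanishes.\<close>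
  have E2: "lim (\<lambda>n. dquot V (?e i) n x) * pd i \<phi> x = F i x * pd i \<phi> x" for i x
  proof (cases "x \<in> ball 0 r")
    case True
    then have "x \<in> ball 0 1" using r by simp
    from has_derivative_grad[OF v[OF this]] have "(V has_derivative (\<lambda>h. grad v x \<bullet> h)) (at x)"
      by (rule has_derivative_transform_within_open[OF _ open_ball True]) (simp add: V_def clip_props(3)[OF r(1)])
    from limI[OF dquot_tendsto[OF this]] have "lim (\<lambda>n. dquot V (?e i) n x) = grad v x $ i" by (simp add: inner_axis_one)
    then show ?thesis using True by (simp add: F_def clip_props(3)[OF r(1)])
  next
    case False
    then show ?thesis using test_fun_outside[OF test_fun_pd[OF \<phi>]] by simp
  qed
  have one: "(\<integral>x. V x * pd i (pd i \<phi>) x \<partial>lborel) = (\<integral>x. lim (\<lambda>n. dquot (F i) (?e i) n x) * \<phi> x \<partial>lborel)" for i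
  proof -
    have "(\<integral>x. V x * pd i (pd i \<phi>) x \<partial>lborel) = - (\<integral>x. lim (\<lambda>n. dquot V (?e i) n x) * pd i \<phi> x \<partial>lborel)"
      using integral_lim_dquot_mult(1)[OF Vlip csmooth_pd[OF cs], of "?e i" i] unfolding ga by simp
    also have "\<dots> = - (\<integral>x. F i x * pd i \<phi> x \<partial>lborel)" unfolding E2 ..
    also have "\<dots> = (\<integral>x. lim (\<lambda>n. dquot (F i) (?e i) n x) * \<phi> x \<partial>lborel)"
      using integral_lim_dquot_mult(1)[OF Flip cs, of i "?e i"] unfolding ga by simp
    finally show ?thesis .
  qed
  have bound: "\<bar>\<integral>x. V x * pd i (pd i \<phi>) x \<partial>lborel\<bar> \<le> M * (\<integral>x. \<bar>\<phi> x\<bar> \<partial>lborel)" for i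
  proof -
    have "\<bar>\<integral>x. lim (\<lambda>n. dquot (F i) (?e i) n x) * \<phi> x \<partial>lborel\<bar> \<le> (\<integral>x. M * \<bar>\<phi> x\<bar> \<partial>lborel)"
    proof (rule order_trans[OF integral_abs_bound integral_mono_AE])
      show "integrable lborel (\<lambda>x. \<bar>lim (\<lambda>n. dquot (F i) (?e i) n x) * \<phi> x\<bar>)"
        by (intro integrable_abs integral_lim_dquot_mult(2)[OF Flip cs])
      show "integrable lborel (\<lambda>x. M * \<bar>\<phi> x\<bar>)" using csmooth_integrable[OF cs] by simp
      show "AE x in lborel. \<bar>lim (\<lambda>n. dquot (F i) (?e i) n x) * \<phi> x\<bar> \<le> M * \<bar>\<phi> x\<bar>"
        using lipschitz_AE_directional[OF Flip, of i "?e i"]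
      proof eventually_elim
        case (elim x)
        then have "(\<lambda>n. dquot (F i) (?e i) n x) \<longlonglongrightarrow> lim (\<lambda>n. dquot (F i) (?e i) n x)" by (simp add: convergent_LIMSEQ_iff)
        from tendsto_rabs[OF this] have "\<bar>lim (\<lambda>n. dquot (F i) (?e i) n x)\<bar> \<le> M"
          by (rule LIMSEQ_le_const2) (use dquot_bound[OF Flip, of i "?e i"] in auto)
        then show ?case by (simp add: abs_mult mult_right_mono)
      qed
    qed
    then show ?thesis unfolding one by simp
  qed
  have int: "integrable lborel (\<lambda>x. V x * pd i (pd i \<phi>) x)" for i
    using integral_lim_dquot_mult(3)[OF Vlip csmooth_pd[OF cs], of i "?e i"] unfolding ga .
  have "(\<integral>x. V x * lap \<phi> x \<partial>lborel) = (\<Sum>i\<in>UNIV. \<integral>x. V x * pd i (pd i \<phi>) x \<partial>lborel)"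
    using int by (simp add: lap_def sum_distrib_left)
  also have "\<bar>\<dots>\<bar> \<le> (\<Sum>i\<in>(UNIV::'n set). M * (\<integral>x. \<bar>\<phi> x\<bar> \<partial>lborel))"
    by (rule order_trans[OF sum_abs sum_mono]) (rule bound)
  finally show ?thesis by (simp add: V_def)
qed

text \<open>Duality: integration against \<open>f\<close> is bounded by \<open>CARD('n) * M\<close>
  times the L1 norm of the test function, and nonnegative test functions turn this into bounds for
  \<open>f\<close> and \<open>- f\<close>. Smaller balls come first because \<open>f\<close> is only
  locally integrable.\<close>

lemma weak_lap_bound:
  fixes v f :: "real^'n \<Rightarrow> real" and M :: real
  assumes v: "\<And>x. x \<in> ball 0 1 \<Longrightarrow> v differentiable (at x)"
    and lip: "\<And>x y. x \<in> ball 0 1 \<Longrightarrow> y \<in> ball 0 1 \<Longrightarrow> norm (grad v x - grad v y) \<le> M * norm (x - y)" and M: "0 \<le> M"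
    and wl: "weak_lap (ball 0 1) v f"
  shows "AE x in lborel. x \<in> ball 0 1 \<longrightarrow> \<bar>f x\<bar> \<le> CARD('n) * M"
proof -
  let ?r = "\<lambda>n. 1 - inverse (real (Suc n))"
  have r: "0 \<le> ?r n" "?r n < 1" for n
  proof -
    have "inverse (real (Suc n)) \<le> 1" "inverse (real (Suc n)) > 0" by (auto simp: field_simps)
    then show "0 \<le> ?r n" "?r n < 1" by (auto simp del: of_nat_Suc)
  qed
  obtain fb where fb: "fb \<in> borel_measurable borel" "AE x in lborel. indicator (ball 0 1) x * f x = fb x"
    using lebesgue_borel_version[OF loc_integrable_borel_measurable] wl by (auto simp: weak_lap_def)
  have "AE x in lborel. x \<in> ball 0 (?r n) \<longrightarrow> \<bar>f x\<bar> \<le> CARD('n) * M" for n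
  proof -
    let ?B = "ball (0::real^'n) (?r n)"
    have sub: "?B \<subseteq> ball 0 1" "cball 0 (?r n) \<subseteq> ball (0::real^'n) 1" 
      unfolding subset_iff mem_ball_0 mem_cball_0 using r(2)[of n] less_trans le_less_trans by blast+
    let ?F = "\<lambda>x. indicator ?B x * fb x"
    have Fm: "?F \<in> borel_measurable borel" using borel_measurable_times[OF borel_measurable_indicator fb(1), of ?B] by simp
    have Fi: "integrable lborel ?F"
    proof -
      have "set_integrable lebesgue (cball 0 (?r n)) f" using wl sub(2) by (simp add: weak_lap_def loc_integrable_def del: of_nat_Suc)
      then have "set_integrable lebesgue ?B f" by (rule set_integrable_subset) auto
      then have i: "integrable lebesgue (\<lambda>x. indicator ?B x * f x)" by (simp add: set_integrable_def)
      have "AE x in lborel. indicator ?B x * f x = ?F x"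
        using fb(2) by eventually_elim (use sub(1) in \<open>auto simp: indicator_def simp del: of_nat_Suc\<close>)
      from lebesgue_integral_borel_version(2)[OF Fm this] i show ?thesis by auto
    qed
    have Ii: "integrable lborel (\<lambda>x. CARD('n) * M * indicator ?B x)"
      by (intro integrable_mult_right integrable_real_indicator)
         (auto intro: emeasure_bounded_finite[unfolded infinity_ennreal_def] simp del: of_nat_Suc)
    have key: "\<bar>\<integral>x. ?F x * \<phi> x \<partial>lborel\<bar> \<le> CARD('n) * M * (\<integral>x. \<bar>\<phi> x\<bar> \<partial>lborel)" "integrable lborel (\<lambda>x. ?F x * \<phi> x)"
      "integrable lborel \<phi>" if t: "test_fun ?B \<phi>" for \<phi>
    proof -
      obtain R where cs: "csmooth R \<phi>" using test_fun_csmooth[OF t] by blast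
      note [measurable] = csmooth_borel[OF cs] csmooth_borel[OF csmooth_lap[OF cs]]
      obtain C where C: "C > 0" "\<And>x. \<bar>\<phi> x\<bar> \<le> C" using csmooth_bounded[OF cs] by blast
      show "integrable lborel \<phi>" by (rule csmooth_integrable[OF cs])
      show "integrable lborel (\<lambda>x. ?F x * \<phi> x)"
        by (rule Bochner_Integration.integrable_bound[where f="\<lambda>x. C * ?F x"])
           (use Fi Fm C in \<open>auto simp: abs_mult mult.commute[of C] intro!: mult_left_mono\<close>)
      have t1: "test_fun (ball 0 1) \<phi>" by (rule test_fun_mono[OF t sub(1)])
      have eq: "(LINT x:ball 0 1|lebesgue. v x * lap \<phi> x) = (LINT x:ball 0 1|lebesgue. f x * \<phi> x)"
        using wl t1 by (simp add: weak_lap_def)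
      have "(LINT x:ball 0 1|lebesgue. f x * \<phi> x) = (\<integral>x. ?F x * \<phi> x \<partial>lborel)"
        unfolding set_lebesgue_integral_def
      proof (rule lebesgue_integral_borel_version(1))
        show "(\<lambda>x. ?F x * \<phi> x) \<in> borel_measurable borel"
          using borel_measurable_times[OF Fm csmooth_borel[OF cs]] .
        show "AE x in lborel. indicat_real (ball 0 1) x *\<^sub>R (f x * \<phi> x) = ?F x * \<phi> x"
          using fb(2)
        proof eventually_elim
          case (elim x)
          then show ?case using test_fun_outside[OF t, of x] sub(1) by (cases "x \<in> ?B") (auto simp del: of_nat_Suc)
        qed
        have "(\<lambda>x. (indicator (ball 0 1) x * f x) * \<phi> x) \<in> borel_measurable lebesgue"
          using wl csmooth_borel[OF cs]
          by (intro borel_measurable_times loc_integrable_borel_measurable) (auto simp: weak_lap_def measurable_completion)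
        then show "(\<lambda>x. indicat_real (ball 0 1) x *\<^sub>R (f x * \<phi> x)) \<in> borel_measurable lebesgue" by (simp add: mult.assoc)
      qed
      moreover have "(LINT x:ball 0 1|lebesgue. v x * lap \<phi> x) = (\<integral>x. v (clip (?r n) x) * lap \<phi> x \<partial>lborel)"
      proof -
        have e: "indicat_real (ball 0 1) x *\<^sub>R (v x * lap \<phi> x) = v (clip (?r n) x) * lap \<phi> x" for x
        proof (cases "x \<in> ?B")
          case True
          then have "clip (?r n) x = x" by (intro clip_props(3)[OF r(1)]) (simp del: of_nat_Suc)
          then show ?thesis using True sub(1) by (auto simp del: of_nat_Suc)
        qed (use test_fun_lap_outside[OF t] in simp)
        obtain L where L: "0 \<le> L" "\<And>x y. x \<in> ball 0 1 \<Longrightarrow> y \<in> ball 0 1 \<Longrightarrow> \<bar>v x - v y\<bar> \<le> L * norm (x - y)"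
          using lipschitz_ball_grad[OF v lip M] by blast
        have Vlip: "\<bar>v (clip (?r n) x) - v (clip (?r n) y)\<bar> \<le> L * norm (x - y)" for x y
          by (rule lipschitz_clip[OF L(2) r L(1)])
        have "(\<lambda>x. v (clip (?r n) x) * lap \<phi> x) \<in> borel_measurable borel"
          using lipschitz_borel[OF Vlip] csmooth_borel[OF csmooth_lap[OF cs]] by (rule borel_measurable_times)
        then show ?thesis unfolding set_lebesgue_integral_def e by (intro integral_completion) simp
      qed
      ultimately have "(\<integral>x. ?F x * \<phi> x \<partial>lborel) = (\<integral>x. v (clip (?r n) x) * lap \<phi> x \<partial>lborel)" using eq by simp
      then show "\<bar>\<integral>x. ?F x * \<phi> x \<partial>lborel\<bar> \<le> CARD('n) * M * (\<integral>x. \<bar>\<phi> x\<bar> \<partial>lborel)"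
        using integral_lap_le[OF v lip M r t] by simp
    qed
    have ind: "c * indicator ?B x * \<phi> x = c * \<phi> x" if "test_fun ?B \<phi>" for \<phi> x and c :: real
      using test_fun_outside[OF that, of x] by (cases "x \<in> ?B") auto
    have "AE x in lborel. x \<in> ?B \<longrightarrow> ?F x - CARD('n) * M * indicator ?B x \<le> 0"
    proof (rule AE_le_0_if_test_integrals_le_0)
      fix \<phi> assume t: "test_fun ?B \<phi>" and nn: "\<And>x. 0 \<le> \<phi> x"
      have "(\<integral>x. (?F x - CARD('n) * M * indicator ?B x) * \<phi> x \<partial>lborel) = (\<integral>x. ?F x * \<phi> x \<partial>lborel) - CARD('n) * M * (\<integral>x. \<bar>\<phi> x\<bar> \<partial>lborel)"
        unfolding left_diff_distrib ind[OF t] using key(2,3)[OF t] nn by (simp add: )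
      then show "(\<integral>x. (?F x - CARD('n) * M * indicator ?B x) * \<phi> x \<partial>lborel) \<le> 0" using key(1)[OF t] by simp
    qed (use Fi Ii in \<open>auto simp del: of_nat_Suc\<close>)
    moreover have "AE x in lborel. x \<in> ?B \<longrightarrow> - ?F x - CARD('n) * M * indicator ?B x \<le> 0"
    proof (rule AE_le_0_if_test_integrals_le_0)
      fix \<phi> assume t: "test_fun ?B \<phi>" and nn: "\<And>x. 0 \<le> \<phi> x"
      have "(\<integral>x. (- ?F x - CARD('n) * M * indicator ?B x) * \<phi> x \<partial>lborel) = - (\<integral>x. ?F x * \<phi> x \<partial>lborel) - CARD('n) * M * (\<integral>x. \<bar>\<phi> x\<bar> \<partial>lborel)"
        unfolding left_diff_distrib ind[OF t] using key(2,3)[OF t] nn by (simp add: )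
      then show "(\<integral>x. (- ?F x - CARD('n) * M * indicator ?B x) * \<phi> x \<partial>lborel) \<le> 0" using key(1)[OF t] by simp
    qed (use Fi Ii in \<open>auto simp del: of_nat_Suc\<close>)
    ultimately show ?thesis using fb(2)
    proof eventually_elim
      case (elim x)
      show ?case
      proof
        assume x: "x \<in> ?B"
        then have "x \<in> ball 0 1" using sub(1) by blast
        then have "f x = ?F x" using elim(3) x by simp
        then show "\<bar>f x\<bar> \<le> CARD('n) * M" using elim(1,2) x by (simp add: abs_le_iff del: of_nat_Suc)
      qed
    qed
  qed
  then have "AE x in lborel. \<forall>n. x \<in> ball 0 (?r n) \<longrightarrow> \<bar>f x\<bar> \<le> CARD('n) * M" by (subst AE_all_countable) blast
  then show ?thesis
  proof eventually_elim
    case (elim x)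
    show ?case
    proof
      assume "x \<in> ball 0 1"
      then have "0 < 1 - norm x" by simp
      then obtain n where "inverse (real (Suc n)) < 1 - norm x" using reals_Archimedean by blast
      then have "x \<in> ball 0 (?r n)" by (simp del: of_nat_Suc)
      then show "\<bar>f x\<bar> \<le> CARD('n) * M" using elim by blast
    qed
  qed
qed

subsection \<open>Regularity of the solution\<close>

text \<open>One mean value step along \<open>axis i 1\<close>, after which the Lipschitz bound of
  the gradient over the distance t takes the place of a second derivative. Convexity puts the two
  segments into \<open>B\<close> once their end points are there.\<close>

lemma second_difference_le_lipschitz_gradient:
  fixes v :: "real^'n \<Rightarrow> real" and M t :: real
  assumes B: "convex B" and v: "\<And>x. x \<in> B \<Longrightarrow> (v has_derivative (\<lambda>h. G x \<bullet> h)) (at x)"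
    and lip: "\<And>x y. x \<in> B \<Longrightarrow> y \<in> B \<Longrightarrow> norm (G x - G y) \<le> M * norm (x - y)"
    and t: "0 < t" and pts: "z \<in> B" "z + t *\<^sub>R axis i 1 \<in> B" "z + t *\<^sub>R axis j 1 \<in> B" "z + t *\<^sub>R axis i 1 + t *\<^sub>R axis j 1 \<in> B"
  shows "\<bar>v (z + t *\<^sub>R axis i 1 + t *\<^sub>R axis j 1) - v (z + t *\<^sub>R axis i 1) - v (z + t *\<^sub>R axis j 1) + v z\<bar> \<le> M * t\<^sup>2"
proof -
  let ?e = "axis i (1::real) :: real^'n" and ?d = "t *\<^sub>R axis j (1::real) :: real^'n"
  have seg: "p + s *\<^sub>R ?e \<in> B" if "p \<in> B" "p + t *\<^sub>R ?e \<in> B" "0 \<le> s" "s \<le> t" for p s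
  proof -
    have "(1 - s / t) *\<^sub>R p + (s / t) *\<^sub>R (p + t *\<^sub>R ?e) \<in> B"
      using that t by (intro convexD[OF B]) (auto simp: field_simps)
    moreover have "(1 - s / t) *\<^sub>R p + (s / t) *\<^sub>R (p + t *\<^sub>R ?e) = p + s *\<^sub>R ?e"
      using t by (simp add: scaleR_add_right scaleR_diff_left)
    ultimately show ?thesis by simp
  qed
  have in1: "z + s *\<^sub>R ?e \<in> B" if "0 \<le> s" "s \<le> t" for s using seg pts that by blast
  have in2: "z + ?d + s *\<^sub>R ?e \<in> B" if "0 \<le> s" "s \<le> t" for s
  proof (rule seg[OF pts(3) _ that])
    show "z + ?d + t *\<^sub>R ?e \<in> B" using pts(4) by (simp add: add.commute add.left_commute)
  qed
  have der: "((\<lambda>s. v (p + s *\<^sub>R ?e)) has_real_derivative G (p + s *\<^sub>R ?e) $ i) (at s)" if "p + s *\<^sub>R ?e \<in> B" for p s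
  proof -
    have "((\<lambda>s. p + s *\<^sub>R ?e) has_derivative (\<lambda>h. h *\<^sub>R ?e)) (at s)" by (auto intro!: derivative_eq_intros)
    from diff_chain_at[OF this v[OF that]]
    show ?thesis by (simp add: o_def has_field_derivative_def inner_axis_one mult_commute_abs)
  qed
  let ?\<phi> = "\<lambda>s. v (z + ?d + s *\<^sub>R ?e) - v (z + s *\<^sub>R ?e)"
  obtain s where s: "0 < s" "s < t" and eq: "?\<phi> t - ?\<phi> 0 = (t - 0) * (G (z + ?d + s *\<^sub>R ?e) $ i - G (z + s *\<^sub>R ?e) $ i)"
    using MVT2[OF t, of ?\<phi> "\<lambda>s. G (z + ?d + s *\<^sub>R ?e) $ i - G (z + s *\<^sub>R ?e) $ i"] DERIV_diff[OF der der] in1 in2 by blast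
  have "\<bar>G (z + ?d + s *\<^sub>R ?e) $ i - G (z + s *\<^sub>R ?e) $ i\<bar> \<le> norm (G (z + ?d + s *\<^sub>R ?e) - G (z + s *\<^sub>R ?e))"
    using component_le_norm_cart[of "G (z + ?d + s *\<^sub>R ?e) - G (z + s *\<^sub>R ?e)" i] by simp
  also have "\<dots> \<le> M * norm ((z + ?d + s *\<^sub>R ?e) - (z + s *\<^sub>R ?e))" using s by (intro lip in1 in2) auto
  also have "\<dots> = M * t" using t by simp
  finally have "t * \<bar>G (z + ?d + s *\<^sub>R ?e) $ i - G (z + s *\<^sub>R ?e) $ i\<bar> \<le> t * (M * t)" using t by (intro mult_left_mono) auto
  then have "\<bar>?\<phi> t - ?\<phi> 0\<bar> \<le> M * t\<^sup>2" unfolding eq using t by (simp add: abs_mult power2_eq_square mult_ac)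
  moreover have "?\<phi> t - ?\<phi> 0 = v (z + t *\<^sub>R ?e + ?d) - v (z + t *\<^sub>R ?e) - v (z + ?d) + v z"
    by (simp add: add.commute add.left_commute)
  ultimately show ?thesis by simp
qed

lemma integrable_mult_csmooth:
  assumes F: "integrable lborel F" and \<phi>: "csmooth R \<phi>"
  shows "integrable lborel (\<lambda>x. F x * \<phi> x)"
proof -
  obtain C where C: "C > 0" "\<And>x. \<bar>\<phi> x\<bar> \<le> C" using csmooth_bounded[OF \<phi>] by blast
  note [measurable] = csmooth_borel[OF \<phi>]
  show ?thesis
    by (rule Bochner_Integration.integrable_bound[where f="\<lambda>x. C * F x"])
       (use F C in \<open>auto simp: abs_mult mult.commute[of C] intro!: mult_left_mono\<close>)
qed

text \<open>Integration by parts moves one derivative to the affine function and leaves a constant,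
  against which the other derivative of \<phi> integrates to zero.\<close>

lemma integral_affine_lap:
  fixes \<phi> :: "real^'n \<Rightarrow> real"
  assumes \<phi>: "csmooth R \<phi>"
  shows "(\<integral>x. (c + a \<bullet> x) * lap \<phi> x \<partial>lborel) = 0" "integrable lborel (\<lambda>x. (c + a \<bullet> x) * lap \<phi> x)"
proof -
  have "bump_alg (\<lambda>t (x::real^'n). c + (\<Sum>i\<in>UNIV. a $ i * x $ i))"
    by (intro bump_alg.add bump_alg_const bump_alg_sum bump_alg.mult bump_alg.coord)
  from smooth_fun_bump_alg[OF this] have sm: "smooth_fun (\<lambda>x. c + a \<bullet> x)" by (simp add: inner_vec_def)
  have "((\<lambda>x. c + a \<bullet> x) has_derivative (\<lambda>h. a \<bullet> h)) (at x)" for x by (auto intro!: derivative_eq_intros)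
  from has_derivative_inner_pd(1)[OF this] have pa: "pd i (\<lambda>x. c + a \<bullet> x) = (\<lambda>x. a $ i)" for i by blast
  have int: "integrable lborel (\<lambda>x. (c + a \<bullet> x) * pd i (pd i \<phi>) x)" for i
    using csmooth_mult_integrable[OF csmooth_pd[OF csmooth_pd[OF \<phi>]] sm] by (simp add: mult.commute)
  have z: "(\<integral>x. (c + a \<bullet> x) * pd i (pd i \<phi>) x \<partial>lborel) = 0" for i
  proof -
    have "(\<integral>x. pd i \<phi> x * pd i (\<lambda>x. c + a \<bullet> x) x \<partial>lborel) = - (\<integral>x. pd i (pd i \<phi>) x * (c + a \<bullet> x) \<partial>lborel)"
      by (rule integral_by_parts_pd[OF csmooth_pd[OF \<phi>] sm])
    moreover have "(\<integral>x. pd i \<phi> x * pd i (\<lambda>x. c + a \<bullet> x) x \<partial>lborel) = 0"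
      unfolding pa by (simp add: integral_pd_eq_0[OF \<phi>])
    ultimately show ?thesis by (simp add: mult.commute)
  qed
  show "(\<integral>x. (c + a \<bullet> x) * lap \<phi> x \<partial>lborel) = 0"
    using int z by (simp add: lap_def sum_distrib_left)
  show "integrable lborel (\<lambda>x. (c + a \<bullet> x) * lap \<phi> x)"
    using int by (simp add: lap_def sum_distrib_left)
qed

lemma integrable_indicator_bounded:
  fixes F :: "'a::euclidean_space \<Rightarrow> real"
  assumes "B \<in> sets borel" "bounded B" "(\<lambda>x. indicator B x * F x) \<in> borel_measurable borel" "\<And>x. x \<in> B \<Longrightarrow> \<bar>F x\<bar> \<le> C"
  shows "integrable lborel (\<lambda>x. indicator B x * F x)"
proof (rule Bochner_Integration.integrable_bound[where f="\<lambda>x. C * indicator B x"])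
  show "integrable lborel (\<lambda>x. C * indicator B x)"
    using assms(1,2) by (intro integrable_mult_right integrable_real_indicator)
      (auto intro: emeasure_bounded_finite[unfolded infinity_ennreal_def])
  show "AE x in lborel. norm (indicator B x * F x) \<le> norm (C * indicator B x)"
  proof (rule AE_I2)
    fix x show "norm (indicator B x * F x) \<le> norm (C * indicator B x)"
      using assms(4)[of x] by (cases "x \<in> B") auto
  qed
qed (use assms(3) in simp)

text \<open>The locale \<open>flat_pair\<close> is instantiated with u - v, corrected by an affine
  function, and with \<open>A\<close> a multiple of U + M. The summand 1 in \<open>C\<close> absorbs
  the gradient of \<open>v\<close> when it is added back.\<close>

lemma no_sign_obstacle_regularity:
  fixes \<eta> \<psi> v f u :: "real^'n \<Rightarrow> real" and M :: real
  assumes mol: "mollifier \<eta> \<psi> Cm"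
    and v: "\<And>x. x \<in> ball 0 1 \<Longrightarrow> v differentiable (at x)"
    and lip: "\<And>x y. x \<in> ball 0 1 \<Longrightarrow> y \<in> ball 0 1 \<Longrightarrow> norm (grad v x - grad v y) \<le> M * norm (x - y)" and M: "0 \<le> M"
    and vf: "weak_lap (ball 0 1) v f" and W12: "W12 (ball 0 1) u"
    and uf: "weak_lap (ball 0 1) u (\<lambda>x. f x * indicator {y. u y \<noteq> 0} x)"
  defines "C \<equiv> CARD('n) * (CARD('n) * hess_const Cm TYPE('n)) * (CARD('n) + 1 + measure lborel (ball (0::real^'n) 1)) + 1"
    and "U \<equiv> LINT x:ball 0 1|lebesgue. \<bar>u x\<bar>"
  shows "\<exists>w. (\<forall>x\<in>ball 0 (1/2). w differentiable (at x)) \<and>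
    (\<forall>x\<in>ball 0 (1/2). \<forall>y\<in>ball 0 (1/2). norm (grad w x - grad w y) \<le> C * (U + M) * norm (x - y)) \<and>
    (AE x in lborel. x \<in> ball 0 (1/2) \<longrightarrow> u x = w x)" and "0 \<le> U"
proof -
  let ?B = "ball (0::real^'n) 1"
  let ?V = "measure lborel ?B"
  have um: "(\<lambda>x. indicator ?B x * u x) \<in> borel_measurable lebesgue"
    using uf by (intro loc_integrable_borel_measurable) (simp add: weak_lap_def)
  have fm: "(\<lambda>x. indicator ?B x * f x) \<in> borel_measurable lebesgue"
    using vf by (intro loc_integrable_borel_measurable) (simp add: weak_lap_def)
  obtain ub where ub [measurable]: "ub \<in> borel_measurable borel" and uub: "AE x in lborel. indicator ?B x * u x = ub x"
    using lebesgue_borel_version[OF um] .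
  obtain fb where fb [measurable]: "fb \<in> borel_measurable borel" and ffb: "AE x in lborel. indicator ?B x * f x = fb x"
    using lebesgue_borel_version[OF fm] .
  have ui: "integrable lebesgue (\<lambda>x. indicator ?B x * u x)"
  proof (rule Bochner_Integration.integrable_bound[where f="\<lambda>x. indicator ?B x * 1 + indicator ?B x * (u x)\<^sup>2"])
    have 1: "integrable lebesgue (\<lambda>x. indicator ?B x * (u x)\<^sup>2)"
      using W12 by (auto simp: W12_def W12_grad_def set_integrable_def)
    have "integrable lborel (\<lambda>x. indicator ?B x * (1::real))"
      by (rule integrable_indicator_bounded[where C=1]) (auto intro!: borel_measurable_indicator)
    then have "integrable lebesgue (\<lambda>x. indicator ?B x * (1::real))"
      by (subst integrable_completion) auto
    then show "integrable lebesgue (\<lambda>x. indicator ?B x * 1 + indicator ?B x * (u x)\<^sup>2)"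
      using 1 by (rule Bochner_Integration.integrable_add)
    have "\<bar>y\<bar> \<le> 1 + y\<^sup>2" for y :: real
      using zero_le_power2[of "\<bar>y\<bar> - 1"] zero_le_power2[of y] by (simp add: power2_diff)
    then show "AE x in lebesgue. norm (indicator ?B x * u x) \<le> norm (indicator ?B x * 1 + indicator ?B x * (u x)\<^sup>2)"
      by (intro AE_I2) (simp add: indicator_def)
  qed (rule um)
  have ubi: "integrable lborel ub" using lebesgue_integral_borel_version(2)[OF ub uub um] ui by blast
  have U: "U = (\<integral>x. \<bar>ub x\<bar> \<partial>lborel)"
    unfolding U_def set_lebesgue_integral_def
  proof (rule lebesgue_integral_borel_version(1))
    show "AE x in lborel. indicat_real ?B x *\<^sub>R \<bar>u x\<bar> = \<bar>ub x\<bar>"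
      using uub by eventually_elim (auto simp: indicator_def)
    have "(\<lambda>x. \<bar>indicator ?B x * u x\<bar>) \<in> borel_measurable lebesgue" using um by measurable
    then show "(\<lambda>x. indicat_real ?B x *\<^sub>R \<bar>u x\<bar>) \<in> borel_measurable lebesgue" by (simp add: abs_mult)
  qed measurable
  then show U0: "0 \<le> U" by simp
  show "\<exists>w. (\<forall>x\<in>ball 0 (1/2). w differentiable (at x)) \<and>
    (\<forall>x\<in>ball 0 (1/2). \<forall>y\<in>ball 0 (1/2). norm (grad w x - grad w y) \<le> C * (U + M) * norm (x - y)) \<and>
    (AE x in lborel. x \<in> ball 0 (1/2) \<longrightarrow> u x = w x)"
  \<comment> \<open>The locale asks for \<open>A > 0\<close>; in the degenerate case
    \<open>u\<close> vanishes almost everywhere.\<close>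
  proof (cases "U + M = 0")
    case True
    then have "U = 0" using U0 M by linarith
    then have "AE x in lborel. \<bar>ub x\<bar> = 0"
      using integral_nonneg_eq_0_iff_AE[of lborel "\<lambda>x. \<bar>ub x\<bar>"] ubi U by simp
    then have "AE x in lborel. x \<in> ball 0 (1/2) \<longrightarrow> u x = 0"
      using uub by eventually_elim auto
    moreover have "grad (\<lambda>x::real^'n. 0::real) x = 0" for x
      using has_derivative_inner_pd(2)[of "\<lambda>x. 0" 0 x] by simp
    ultimately show ?thesis using True by (intro exI[of _ "\<lambda>x. 0"]) simp
  next
    case False
    then have UM: "0 < U + M" using U0 M by linarith
    \<comment> \<open>After subtraction of the Taylor polynomial at 0 the obstacle is bounded by
      \<open>M\<close> on the unit ball, so that neither \<open>v 0\<close> nor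
      \<open>grad v 0\<close> enters the L1 norm of \<open>h\<close>.\<close>
    define a where "a = grad v 0"
    define vb where "vb x = v x - (v 0 + a \<bullet> x)" for x
    have vbd: "(vb has_derivative (\<lambda>h. (grad v x - a) \<bullet> h)) (at x)" if "x \<in> ?B" for x
      unfolding vb_def[abs_def]
      using has_derivative_grad[OF v[OF that]] by (auto intro!: derivative_eq_intros simp: inner_diff_left)
    have vb_le: "\<bar>vb x\<bar> \<le> M" if x: "x \<in> ?B" for x
    proof -
      have "norm (vb x - vb 0) \<le> M * norm (x - 0)"
      proof (rule differentiable_bound[where f'="\<lambda>x h. (grad v x - a) \<bullet> h" and S="?B"])
        fix y assume y: "y \<in> ?B"
        show "(vb has_derivative (\<bullet>) (grad v y - a)) (at y within ?B)"
          by (rule has_derivative_at_withinI[OF vbd[OF y]])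
        have "norm (grad v y - a) \<le> M * norm (y - 0)" unfolding a_def by (rule lip) (use y in auto)
        also have "\<dots> \<le> M * 1" using y M by (intro mult_left_mono) auto
        finally have n: "norm (grad v y - a) \<le> M" by simp
        show "onorm ((\<bullet>) (grad v y - a)) \<le> M"
        proof (rule onorm_le)
          fix h
          have "norm ((grad v y - a) \<bullet> h) \<le> norm (grad v y - a) * norm h" using Cauchy_Schwarz_ineq2 by simp
          also have "\<dots> \<le> M * norm h" using n by (rule mult_right_mono) simp
          finally show "norm ((grad v y - a) \<bullet> h) \<le> M * norm h" .
        qed
      qed (use x in auto)
      also have "\<dots> \<le> M * 1" using x M by (intro mult_left_mono) auto
      finally show ?thesis by (simp add: vb_def)
    qed
    define c where "c = CARD('n) * M"
    have c0: "0 \<le> c" using M by (simp add: c_def)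
    \<comment> \<open>\<open>f\<close> is bounded by \<open>c\<close> only almost everywhere;
      truncating its Borel version makes the bound hold at every point, as the locale asks.\<close>
    define f2 where "f2 x = max (- c) (min c (fb x))" for x
    have f2 [measurable]: "f2 \<in> borel_measurable borel" unfolding f2_def[abs_def] by measurable
    have f2_le: "\<bar>f2 x\<bar> \<le> c" for x using c0 by (auto simp: f2_def)
    have fbd: "AE x in lborel. x \<in> ?B \<longrightarrow> \<bar>f x\<bar> \<le> CARD('n) * M"
      by (rule weak_lap_bound[OF v lip M vf])
    have ff2: "AE x in lborel. x \<in> ?B \<longrightarrow> f x = f2 x"
      using ffb fbd
    proof eventually_elim
      case (elim x)
      then show ?case by (auto simp: f2_def c_def[symmetric] indicator_def abs_le_iff max_def min_def)
    qed
    \<comment> \<open>Taken from the Borel version of \<open>u\<close>; up to a null set this is the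
      coincidence set in the unit ball.\<close>
    define \<Lambda> where "\<Lambda> = {x \<in> ?B. ub x = 0}"
    have \<Lambda>B: "\<Lambda> \<subseteq> ?B" by (auto simp: \<Lambda>_def)
    have \<Lambda>m: "\<Lambda> \<in> sets borel"
    proof -
      have "{x. ub x = 0} \<in> sets borel" by measurable
      moreover have "\<Lambda> = ?B \<inter> {x. ub x = 0}" by (auto simp: \<Lambda>_def)
      ultimately show ?thesis by simp
    qed
    define h where "h x = indicator ?B x * (ub x - vb x)" for x
    define g where "g x = - (indicator \<Lambda> x * f2 x)" for x
    have cv: "continuous_on ?B v"
      using v by (meson continuous_at_imp_continuous_on differentiable_imp_continuous_within)
    have cvb: "continuous_on ?B vb" unfolding vb_def[abs_def] by (intro continuous_intros cv)
    have indm: "(\<lambda>x. indicator ?B x * F x) \<in> borel_measurable borel" if "continuous_on ?B F" for F :: "real^'n \<Rightarrow> real"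
      using borel_measurable_continuous_on_indicator[of ?B F] that by simp
    have vbi: "integrable lborel (\<lambda>x. indicator ?B x * vb x)"
      by (rule integrable_indicator_bounded[OF _ _ indm[OF cvb] vb_le]) auto
    have vi: "integrable lborel (\<lambda>x. indicator ?B x * v x)"
    proof (rule integrable_indicator_bounded[OF _ _ indm[OF cv], where C="M + (\<bar>v 0\<bar> + norm a)"])
      fix x assume x: "x \<in> ?B"
      have "\<bar>a \<bullet> x\<bar> \<le> norm a * norm x" by (rule Cauchy_Schwarz_ineq2)
      also have "\<dots> \<le> norm a * 1" using x by (intro mult_left_mono) auto
      finally have "\<bar>a \<bullet> x\<bar> \<le> norm a" by simp
      then show "\<bar>v x\<bar> \<le> M + (\<bar>v 0\<bar> + norm a)" using vb_le[OF x] unfolding vb_def by linarith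
    qed auto
    have ubBi: "integrable lborel (\<lambda>x. indicator ?B x * ub x)"
      using integrable_mult_indicator[of ?B lborel ub] ubi by simp
    have hi: "integrable lborel h"
      using Bochner_Integration.integrable_diff[OF ubBi vbi] by (simp add: h_def[abs_def] right_diff_distrib)
    have f2m: "(\<lambda>x. indicator B x * f2 x) \<in> borel_measurable borel" if "B \<in> sets borel" for B
      by (rule borel_measurable_times[OF borel_measurable_indicator f2]) (use that in simp)
    have f2\<Lambda>i: "integrable lborel (\<lambda>x. indicator \<Lambda> x * f2 x)"
      by (rule integrable_indicator_bounded[OF \<Lambda>m _ f2m[OF \<Lambda>m] f2_le]) (rule bounded_subset[OF bounded_ball \<Lambda>B])
    have f2Bi: "integrable lborel (\<lambda>x. indicator ?B x * f2 x)"
      by (rule integrable_indicator_bounded[OF _ _ f2m f2_le]) auto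
    have gi: "integrable lborel g" unfolding g_def[abs_def] using f2\<Lambda>i by simp
    have weak: "(\<integral>y. h y * lap \<phi> y \<partial>lborel) = (\<integral>y. g y * \<phi> y \<partial>lborel)" if t: "test_fun ?B \<phi>" for \<phi>
    proof -
      obtain R where cs: "csmooth R \<phi>" using test_fun_csmooth[OF t] by blast
      note csl = csmooth_lap[OF cs]
      note bm = csmooth_borel[OF cs] csmooth_borel[OF csl]
      have bmL: "\<phi> \<in> borel_measurable lebesgue" "lap \<phi> \<in> borel_measurable lebesgue"
        using bm by (auto intro!: measurable_completion)
      have out: "\<phi> x = 0" "lap \<phi> x = 0" if "x \<notin> ?B" for x
        using test_fun_outside[OF t that] test_fun_lap_outside[OF t that] by auto
      have e1: "(LINT x:?B|lebesgue. u x * lap \<phi> x) = (\<integral>x. ub x * lap \<phi> x \<partial>lborel)"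
        unfolding set_lebesgue_integral_def
      proof (rule lebesgue_integral_borel_version(1))
        show "(\<lambda>x. ub x * lap \<phi> x) \<in> borel_measurable borel" using ub bm(2) by (rule borel_measurable_times)
        show "AE x in lborel. indicat_real ?B x *\<^sub>R (u x * lap \<phi> x) = ub x * lap \<phi> x"
          using uub by eventually_elim (simp add: mult.assoc[symmetric])
        show "(\<lambda>x. indicat_real ?B x *\<^sub>R (u x * lap \<phi> x)) \<in> borel_measurable lebesgue"
          using borel_measurable_times[OF um bmL(2)] by (simp add: mult.assoc)
      qed
      have e2: "(LINT x:?B|lebesgue. (f x * indicator {y. u y \<noteq> 0} x) * \<phi> x)
        = (\<integral>x. (indicator ?B x * f2 x) * \<phi> x - (indicator \<Lambda> x * f2 x) * \<phi> x \<partial>lborel)"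
        unfolding set_lebesgue_integral_def
      proof (rule lebesgue_integral_borel_version(1))
        show "(\<lambda>x. (indicator ?B x * f2 x) * \<phi> x - (indicator \<Lambda> x * f2 x) * \<phi> x) \<in> borel_measurable borel"
          by (intro borel_measurable_diff borel_measurable_times[OF _ bm(1)] f2m \<Lambda>m) auto
        show "AE x in lborel. indicat_real ?B x *\<^sub>R (f x * indicator {y. u y \<noteq> 0} x * \<phi> x) = (indicator ?B x * f2 x) * \<phi> x - (indicator \<Lambda> x * f2 x) * \<phi> x"
          using uub ff2
        proof eventually_elim
          case (elim x)
          show ?case
          proof (cases "x \<in> ?B")
            case True
            then have "x \<in> \<Lambda> \<longleftrightarrow> u x = 0" using elim(1) by (auto simp: \<Lambda>_def)
            then show ?thesis using True elim(2) by (auto simp: indicator_def)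
          qed (use out in auto)
        qed
        have "(\<lambda>x. (indicator ?B x * (f x * indicator {y. u y \<noteq> 0} x)) * \<phi> x) \<in> borel_measurable lebesgue"
          using uf by (intro borel_measurable_times[OF loc_integrable_borel_measurable bmL(1)]) (simp add: weak_lap_def)
        then show "(\<lambda>x. indicat_real ?B x *\<^sub>R (f x * indicator {y. u y \<noteq> 0} x * \<phi> x)) \<in> borel_measurable lebesgue" by (simp add: mult.assoc)
      qed
      have e3: "(LINT x:?B|lebesgue. v x * lap \<phi> x) = (\<integral>x. (indicator ?B x * v x) * lap \<phi> x \<partial>lborel)"
      proof -
        have "(\<lambda>x. (indicator ?B x * v x) * lap \<phi> x) \<in> borel_measurable borel"
          by (rule borel_measurable_times[OF indm[OF cv] bm(2)])
        then show ?thesis unfolding set_lebesgue_integral_def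
          using integral_completion[of "\<lambda>x. (indicator ?B x * v x) * lap \<phi> x" lborel] by (simp add: mult.assoc)
      qed
      have e4: "(LINT x:?B|lebesgue. f x * \<phi> x) = (\<integral>x. (indicator ?B x * f2 x) * \<phi> x \<partial>lborel)"
        unfolding set_lebesgue_integral_def
      proof (rule lebesgue_integral_borel_version(1))
        show "(\<lambda>x. (indicator ?B x * f2 x) * \<phi> x) \<in> borel_measurable borel"
          by (intro borel_measurable_times[OF _ bm(1)] f2m) auto
        show "AE x in lborel. indicat_real ?B x *\<^sub>R (f x * \<phi> x) = (indicator ?B x * f2 x) * \<phi> x"
          using ff2 by eventually_elim (auto simp: indicator_def)
        show "(\<lambda>x. indicat_real ?B x *\<^sub>R (f x * \<phi> x)) \<in> borel_measurable lebesgue"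
          using borel_measurable_times[OF fm bmL(1)] by (simp add: mult.assoc)
      qed
      note i1 = integrable_mult_csmooth[OF ubi csl] integrable_mult_csmooth[OF vi csl] integral_affine_lap(2)[OF cs, of "v 0" a]
      note i2 = integrable_mult_csmooth[OF f2Bi cs] integrable_mult_csmooth[OF f2\<Lambda>i cs]
      \<comment> \<open>The affine part is split off here and disappears in the next step by
        \<open>integral_affine_lap\<close>.\<close>
      have "(\<integral>y. h y * lap \<phi> y \<partial>lborel) = (\<integral>x. ub x * lap \<phi> x - (indicator ?B x * v x) * lap \<phi> x + (v 0 + a \<bullet> x) * lap \<phi> x \<partial>lborel)"
      proof (rule Bochner_Integration.integral_cong[OF refl])
        fix x show "h x * lap \<phi> x = ub x * lap \<phi> x - (indicator ?B x * v x) * lap \<phi> x + (v 0 + a \<bullet> x) * lap \<phi> x"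
          using out(2)[of x] by (cases "x \<in> ?B") (auto simp: h_def vb_def algebra_simps)
      qed
      also have "\<dots> = (\<integral>x. ub x * lap \<phi> x \<partial>lborel) - (\<integral>x. (indicator ?B x * v x) * lap \<phi> x \<partial>lborel) + 0"
        using i1 integral_affine_lap(1)[OF cs, of "v 0" a] by simp
      also have "\<dots> = (LINT x:?B|lebesgue. u x * lap \<phi> x) - (LINT x:?B|lebesgue. v x * lap \<phi> x)" unfolding e1 e3 by simp
      also have "\<dots> = (LINT x:?B|lebesgue. (f x * indicator {y. u y \<noteq> 0} x) * \<phi> x) - (LINT x:?B|lebesgue. f x * \<phi> x)"
        using uf vf t by (simp add: weak_lap_def)
      also have "\<dots> = - (\<integral>x. (indicator \<Lambda> x * f2 x) * \<phi> x \<partial>lborel)"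
        unfolding e2 e4 using i2 by simp
      also have "\<dots> = (\<integral>y. g y * \<phi> y \<partial>lborel)" by (simp add: g_def)
      finally show ?thesis .
    qed
    \<comment> \<open>In the coefficient, \<open>CARD('n)\<close> covers the bound \<open>c\<close>
      of \<open>g\<close>, 1 covers \<open>U\<close> and the second differences of
      \<open>vb\<close>, and the volume covers the L1 norm of \<open>vb\<close>.\<close>
    define A where "A = (CARD('n) + 1 + ?V) * (U + M)"
    have V0: "0 \<le> ?V" by simp
    have A: "A > 0" unfolding A_def using UM V0 by (intro mult_pos_pos) (auto intro: add_pos_nonneg)
    have A_eq: "A = CARD('n) * U + CARD('n) * M + U + M + ?V * U + ?V * M" by (simp add: A_def algebra_simps)
    have nn: "0 \<le> CARD('n) * U" "0 \<le> CARD('n) * M" "0 \<le> ?V * U" "0 \<le> ?V * M" using U0 M V0 by auto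
    have AM: "M \<le> A" "c \<le> A" "U + M * ?V \<le> A"
      unfolding A_eq c_def using nn U0 M by (auto simp: mult.commute)
    have h_le: "(\<integral>y. \<bar>h y\<bar> \<partial>lborel) \<le> A"
    proof -
      have "(\<integral>y. \<bar>h y\<bar> \<partial>lborel) \<le> (\<integral>y. \<bar>ub y\<bar> + M * indicator ?B y \<partial>lborel)"
      proof (rule integral_mono)
        show "integrable lborel (\<lambda>y. \<bar>ub y\<bar> + M * indicator ?B y)"
          using ubi by (intro Bochner_Integration.integrable_add integrable_mult_right integrable_real_indicator)
            (auto intro: emeasure_bounded_finite[unfolded infinity_ennreal_def])
        show "\<bar>h y\<bar> \<le> \<bar>ub y\<bar> + M * indicator ?B y" for y
          using vb_le[of y] by (cases "y \<in> ?B") (auto simp: h_def)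
      qed (use hi in simp)
      also have "\<dots> = U + M * ?V"
        unfolding U using ubi emeasure_bounded_finite[OF bounded_ball, of "0::real^'n" 1]
        by (subst Bochner_Integration.integral_add) (auto simp: infinity_ennreal_def)
      finally show ?thesis using AM(3) by linarith
    qed
    interpret mollifier \<eta> \<psi> Cm by (rule mol)
    interpret flat_pair \<eta> \<psi> Cm h g \<Lambda> A
    proof
      show "\<bar>g y\<bar> \<le> A" for y using f2_le[of y] AM(2) A by (auto simp: g_def indicator_def)
      show "y \<notin> \<Lambda> \<Longrightarrow> g y = 0" for y by (simp add: g_def)
      fix z t i j assume t: "0 < t" and pts: "z \<in> \<Lambda>" "z + t *\<^sub>R axis i 1 \<in> \<Lambda>" "z + t *\<^sub>R axis j 1 \<in> \<Lambda>"
        "z + t *\<^sub>R axis i 1 + t *\<^sub>R axis j 1 \<in> \<Lambda>"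
      \<comment> \<open>Where \<open>ub\<close> vanishes, \<open>h\<close> is minus the obstacle, so
        flatness becomes a property of \<open>v\<close> alone.\<close>
      have hv: "h y = - vb y" if "y \<in> \<Lambda>" for y using that by (simp add: h_def \<Lambda>_def)
      have "\<bar>vb (z + t *\<^sub>R axis i 1 + t *\<^sub>R axis j 1) - vb (z + t *\<^sub>R axis i 1) - vb (z + t *\<^sub>R axis j 1) + vb z\<bar> \<le> M * t\<^sup>2"
        by (rule second_difference_le_lipschitz_gradient[where G="\<lambda>x. grad v x - a" and B="?B", OF convex_ball vbd])
           (use lip t pts \<Lambda>B in auto)
      also have "\<dots> \<le> A * t\<^sup>2" by (intro mult_right_mono AM(1)) simp
      finally show "\<bar>h (z + t *\<^sub>R axis i 1 + t *\<^sub>R axis j 1) - h (z + t *\<^sub>R axis i 1) - h (z + t *\<^sub>R axis j 1) + h z\<bar> \<le> A * t\<^sup>2"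
        unfolding hv[OF pts(1)] hv[OF pts(2)] hv[OF pts(3)] hv[OF pts(4)] by (simp add: abs_le_iff)
    qed (use hi gi A \<Lambda>m weak h_le in auto)
    \<comment> \<open>\<open>w\<close> represents u - vb by a differentiable function; adding
      \<open>vb\<close> back represents \<open>u\<close>.\<close>
    let ?w = "\<lambda>x. w x + vb x"
    have wd: "(?w has_derivative (\<lambda>h. (W x + (grad v x - a)) \<bullet> h)) (at x)" if "x \<in> ball 0 (1/2)" for x
      using has_derivative_add[OF w_has_derivative[of x] vbd[of x]] that by (simp add: inner_add_left)
    have gw: "grad ?w x = W x + (grad v x - a)" if "x \<in> ball 0 (1/2)" for x
      by (rule has_derivative_inner_pd(2)[OF wd[OF that]])
    have "norm (grad ?w x - grad ?w y) \<le> C * (U + M) * norm (x - y)" if xy: "x \<in> ball 0 (1/2)" "y \<in> ball 0 (1/2)" for x y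
    proof -
      have "norm (grad ?w x - grad ?w y) \<le> norm (W x - W y) + norm (grad v x - grad v y)"
        unfolding gw[OF xy(1)] gw[OF xy(2)] using norm_triangle_ineq[of "W x - W y" "grad v x - grad v y"]
        by (simp add: algebra_simps)
      also have "\<dots> \<le> (CARD('n) * (CARD('n) * CH)) * A * norm (x - y) + M * norm (x - y)"
        by (intro add_mono W_lipschitz lip) (use xy in auto)
      also have "\<dots> \<le> (CARD('n) * (CARD('n) * CH)) * A * norm (x - y) + (U + M) * norm (x - y)"
        using U0 by (intro add_left_mono mult_right_mono) auto
      also have "\<dots> = C * (U + M) * norm (x - y)"
        by (simp add: C_def CH_def A_def algebra_simps)
      finally show ?thesis .
    qed
    moreover have "AE x in lborel. x \<in> ball 0 (1/2) \<longrightarrow> u x = ?w x"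
      using uub w_eq_h by eventually_elim (auto simp: h_def)
    moreover have "\<forall>x\<in>ball 0 (1/2). ?w differentiable (at x)"
      using wd unfolding differentiable_def by blast
    ultimately show ?thesis by blast
  qed
qed

section \<open>Uniform constants and the regularity theorem\<close>

lemma finite_family_bound:
  fixes F :: "'i::finite \<Rightarrow> 'a \<Rightarrow> real"
  assumes "\<And>i. \<exists>C. \<forall>x. \<bar>F i x\<bar> \<le> C" obtains C where "\<And>i x. \<bar>F i x\<bar> \<le> C"
proof -
  obtain c where c: "\<And>i x. \<bar>F i x\<bar> \<le> c i" using assms by metis
  have "\<bar>F i x\<bar> \<le> Max (range c)" for i x
    by (rule order_trans[OF c Max_ge]) auto
  then show ?thesis using that by blast
qed

text \<open>Compact support bounds each of the finitely many derivatives, and \<open>Cm\<close> is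
  the largest bound. Kernels and constant are fixed by the dimension, before any solution is
  given.\<close>

lemma mollifier_locale_exists: "\<exists>(\<eta>::real^'n \<Rightarrow> real) \<psi> Cm. mollifier \<eta> \<psi> Cm"
proof -
  obtain \<eta> \<psi> :: "real^'n \<Rightarrow> real" where k: "csmooth 1 \<eta>" "csmooth 1 \<psi>" "\<And>x. \<eta> x \<ge> 0" "(\<integral>x. \<eta> x \<partial>lborel) = 1"
    "\<And>x. lap \<psi> x = \<eta> x - 4 ^ CARD('n) * \<eta> (4 *\<^sub>R x)"
    using mollifier_exists by blast
  have b: "\<exists>C. \<forall>x. \<bar>\<phi> x\<bar> \<le> C" if "csmooth 1 \<phi>" for \<phi> :: "real^'n \<Rightarrow> real"
    using csmooth_bounded[OF that] by metis
  obtain c0 where c0: "\<And>x. \<bar>\<psi> x\<bar> \<le> c0" using b[OF k(2)] by blast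
  have d1: "\<exists>C. \<forall>i x. \<bar>pd i \<phi> x\<bar> \<le> C" if "csmooth 1 \<phi>" for \<phi> :: "real^'n \<Rightarrow> real"
    using finite_family_bound[of "\<lambda>i. pd i \<phi>"] b[OF csmooth_pd[OF that]] by metis
  have d2: "\<exists>C. \<forall>i j x. \<bar>pd j (pd i \<phi>) x\<bar> \<le> C" if "csmooth 1 \<phi>" for \<phi> :: "real^'n \<Rightarrow> real"
    using finite_family_bound[of "\<lambda>p. pd (fst p) (pd (snd p) \<phi>)"] b[OF csmooth_pd[OF csmooth_pd[OF that]]]
    by (metis fst_conv snd_conv)
  have d3: "\<exists>C. \<forall>i j l x. \<bar>pd l (pd j (pd i \<phi>)) x\<bar> \<le> C" if "csmooth 1 \<phi>" for \<phi> :: "real^'n \<Rightarrow> real"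
    using finite_family_bound[of "\<lambda>p. pd (fst p) (pd (fst (snd p)) (pd (snd (snd p)) \<phi>))"]
      b[OF csmooth_pd[OF csmooth_pd[OF csmooth_pd[OF that]]]]
    by (metis fst_conv snd_conv)
  obtain c1 c2 c3 c4 c5 where c: "\<And>i x. \<bar>pd i \<psi> x\<bar> \<le> c1" "\<And>i j x. \<bar>pd j (pd i \<psi>) x\<bar> \<le> c2"
    "\<And>i j l x. \<bar>pd l (pd j (pd i \<psi>)) x\<bar> \<le> c3" "\<And>i j x. \<bar>pd j (pd i \<eta>) x\<bar> \<le> c4" "\<And>i j l x. \<bar>pd l (pd j (pd i \<eta>)) x\<bar> \<le> c5"
    using d1[OF k(2)] d2[OF k(2)] d3[OF k(2)] d2[OF k(1)] d3[OF k(1)] by metis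
  define Cm where "Cm = Max {c0, c1, c2, c3, c4, c5}"
  have "y \<le> Cm" if "y \<in> {c0, c1, c2, c3, c4, c5}" for y unfolding Cm_def using that by (intro Max_ge) auto
  then have m: "c0 \<le> Cm" "c1 \<le> Cm" "c2 \<le> Cm" "c3 \<le> Cm" "c4 \<le> Cm" "c5 \<le> Cm" by auto
  have "mollifier \<eta> \<psi> Cm"
    by unfold_locales (fact k order_trans[OF c0 m(1)] order_trans[OF c(1) m(2)] order_trans[OF c(2) m(3)]
      order_trans[OF c(3) m(4)] order_trans[OF c(4) m(5)] order_trans[OF c(5) m(6)])+
  then show ?thesis by blast
qed

lemma (in mollifier) hess_const_nonneg: "0 \<le> hess_const Cm TYPE('n)"
  using Cm_nonneg unit_vol_nonneg[of "TYPE('n)"]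
  by (auto simp: hess_const_def decay_const_def flat_const_def intro!: add_nonneg_nonneg mult_nonneg_nonneg)

text \<open>A weak solution is determined only up to null sets, so the regularity is that of a
  representative \<open>w\<close>.\<close>

theorem theorem1:
  assumes "CARD('n::finite) \<ge> 2"
  shows "\<exists>C::real. C > 0 \<and>
    (\<forall>(v::real^'n \<Rightarrow> real) f g u.
       C11 (ball 0 1) v \<longrightarrow>
       weak_lap (ball 0 1) v f \<longrightarrow>
       continuous_on (sphere 0 1) g \<longrightarrow>
       W12 (ball 0 1) u \<longrightarrow>
       weak_lap (ball 0 1) u (\<lambda>x. f x * indicator {y. u y \<noteq> 0} x) \<longrightarrow>
       trace_eq u g \<longrightarrow>
       (\<exists>w. C11 (ball 0 (1/2)) w \<and>
            (AE x in lebesgue. x \<in> ball 0 (1/2) \<longrightarrow> u x = w x) \<and>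
            hess_Linf (ball 0 (1/2)) w
              \<le> ereal C * (ereal (LINT x:ball 0 1|lebesgue. \<bar>u x\<bar>) + hess_Linf (ball 0 1) v)))"
proof -
  obtain \<eta> \<psi> :: "real^'n \<Rightarrow> real" and Cm where mol: "mollifier \<eta> \<psi> Cm"
    using mollifier_locale_exists by blast
  define C where "C = CARD('n) * (CARD('n) * hess_const Cm TYPE('n)) * (CARD('n) + 1 + measure lborel (ball (0::real^'n) 1)) + 1"
  have C: "C > 0"
    unfolding C_def using mollifier.hess_const_nonneg[OF mol] by (intro add_nonneg_pos mult_nonneg_nonneg add_nonneg_nonneg) auto
  show ?thesis
  proof (intro exI[of _ C] conjI C allI impI)
    fix v f g u :: "real^'n \<Rightarrow> real"
    assume v: "C11 (ball 0 1) v" and vf: "weak_lap (ball 0 1) v f" and W12: "W12 (ball 0 1) u"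
      and uf: "weak_lap (ball 0 1) u (\<lambda>x. f x * indicator {y. u y \<noteq> 0} x)"
    let ?U = "LINT x:ball 0 1|lebesgue. \<bar>u x\<bar>" and ?H = "hess_Linf (ball 0 1) v"
    have vd: "\<And>x. x \<in> ball 0 1 \<Longrightarrow> v differentiable (at x)" using v by (simp add: C11_def)
    obtain L0 where L0: "\<And>x y. x \<in> ball 0 1 \<Longrightarrow> y \<in> ball 0 1 \<Longrightarrow> norm (grad v x - grad v y) \<le> L0 * dist x y"
      using v unfolding C11_def by blast
    define L where "L = max L0 0"
    have L: "0 \<le> L" by (simp add: L_def)
    have lip: "norm (grad v x - grad v y) \<le> L * norm (x - y)" if "x \<in> ball 0 1" "y \<in> ball 0 1" for x y
      using L0[OF that] mult_right_mono[of L0 L "norm (x - y)"] by (simp add: L_def dist_norm)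
    \<comment> \<open>Any Lipschitz constant \<open>M\<close> of \<open>grad v\<close> is allowed,
      since a qualitative one and the one given by the Hessian are both used below.\<close>
    have reg: "\<exists>w. C11 (ball 0 (1/2)) w \<and> (AE x in lebesgue. x \<in> ball 0 (1/2) \<longrightarrow> u x = w x) \<and>
        hess_Linf (ball 0 (1/2)) w \<le> ereal (C * (?U + M))"
      if M: "0 \<le> M" and lipM: "\<And>x y. x \<in> ball 0 1 \<Longrightarrow> y \<in> ball 0 1 \<Longrightarrow> norm (grad v x - grad v y) \<le> M * norm (x - y)" for M
    proof -
      note R = no_sign_obstacle_regularity[OF mol vd lipM M vf W12 uf, folded C_def]
      obtain w where w: "\<And>x. x \<in> ball 0 (1/2) \<Longrightarrow> w differentiable (at x)"
        "\<And>x y. x \<in> ball 0 (1/2) \<Longrightarrow> y \<in> ball 0 (1/2) \<Longrightarrow> norm (grad w x - grad w y) \<le> C * (?U + M) * norm (x - y)"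
        "AE x in lborel. x \<in> ball 0 (1/2) \<longrightarrow> u x = w x"
        using R(1) by blast
      have "C11 (ball 0 (1/2)) w" using w(1,2) unfolding C11_def dist_norm by blast
      moreover have "AE x in lebesgue. x \<in> ball 0 (1/2) \<longrightarrow> u x = w x" using w(3) by (rule AE_completion)
      moreover have "hess_Linf (ball 0 (1/2)) w \<le> ereal (C * (?U + M))"
        by (rule hess_Linf_le[OF w(2)]) (use C M R(2) in auto)
      ultimately show ?thesis by blast
    qed
    show "\<exists>w. C11 (ball 0 (1/2)) w \<and> (AE x in lebesgue. x \<in> ball 0 (1/2) \<longrightarrow> u x = w x) \<and>
        hess_Linf (ball 0 (1/2)) w \<le> ereal C * (ereal ?U + ?H)"
    proof (cases "?H = \<infinity>")
      case True
      \<comment> \<open>The estimate is trivial in this case, but the regularity of \<open>w\<close>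
        is not; it comes from the qualitative constant \<open>L\<close>.\<close>
      then show ?thesis using reg[OF L lip] C by auto
    next
      case False
      have lipH: "norm (grad v x - grad v y) \<le> M * norm (x - y)" if "?H \<le> ereal M" "x \<in> ball 0 1" "y \<in> ball 0 1" for M x y
        using grad_lipschitz_hess_Linf[OF lip L that] .
      have nonneg: "0 \<le> M" if "?H \<le> ereal M" for M
      proof -
        let ?x = "(1/2) *\<^sub>R axis undefined 1 :: real^'n"
        have "0 \<le> M * norm (?x - 0)"
          by (rule order_trans[OF norm_ge_zero lipH[OF that]]) auto
        then show ?thesis by simp
      qed
      \<comment> \<open>The value minus infinity is excluded too, since -1 would then be an
        admissible bound, contrary to \<open>nonneg\<close>.\<close>
      obtain M where HM: "?H = ereal M"
        using False nonneg[of "-1"] by (cases ?H) auto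
      then have a: "?H \<le> ereal M" by simp
      show ?thesis using reg[OF nonneg[OF a] lipH[OF a]] HM by simp
    qed
  qed
qed

end
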